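(* Let $-A$ be the generator of a bounded $C_0$-semigroup $(e^{-tA})_{t\ge0}$ on a complex Hilbert space $H$. If $(e^{-tA})_{t\ge0}$ is in the Crandall–Pazy class with parameter $\beta\in(0,1]$, then the following statements hold for a fixed $q\in(0,1/2)$: a) $A^{\beta q}f(A)\in\mathcal{L}(H)$ for all $f\in\mathcal{B}_0$ satisfying $|||f|||_{\mathcal{B}_0,q}<\infty$. b) There exists a constant $M>0$ such that $$\|A^{\beta q}f(A)\|\le M\,|||f|||_{\mathcal{B}_0,q}$$ for all $f\in\mathcal{B}_0$ satisfying $|||f|||_{\mathcal{B}_0,q}<\infty$.
   Context: A $C_0$-semigroup $(e^{-tA})_{t\ge0}$ is bounded if $\sup_{t\ge0}\|e^{-tA}\|<\infty$; it is in the Crandall–Pazy class with parameter $\beta\in(0,1]$ if it is immediately differentiable (i.e., $t\mapsto e^{-tA}x$ is differentiable on $(0,\infty)$ for all $x$) and $\|Ae^{-tA}\|=O(t^{-1/\beta})$ as $t\to0+$. $\mathcal{L}(H)$ is the algebra of bounded linear operators on $H$. $A^{\beta q}$ is the fractional power of the sectorial operator $A$. Let $\mathbb{C}_+=\{z\in\mathbb{C}:\mathrm{Re}\,z>0\}$. $\mathcal{B}$ is the space of holomorphic functions $f$ on $\mathbb{C}_+$ with $\int_0^\infty\sup_{\eta\in\mathbb{R}}|f'(\xi+i\eta)|\,d\xi<\infty$. For $f\in\mathcal{B}$ the limit $f(\infty)=\lim_{\mathrm{Re}\,z\to\infty}f(z)$ exists in $\mathbb{C}$; $\mathcal{B}_0=\{f\in\mathcal{B}:f(\infty)=0\}$.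 For $q>0$ and $f\in\mathcal{B}$, $$|||f|||_{\mathcal{B}_0,q}=\int_0^\infty\varphi_q(\xi)\sup_{\eta\in\mathbb{R}}|f'(\xi+i\eta)|\,d\xi,\qquad\varphi_q(\xi)=\begin{cases}1,&0<\xi<1,\\ \xi^q,&\xi\ge1.\end{cases}$$ For $f\in\mathcal{B}$, $f(A)\in\mathcal{L}(H)$ is the ($\mathcal{B}$-calculus) operator defined by $$\langle f(A)x,y\rangle=f(\infty)\langle x,y\rangle-\frac{2}{\pi}\int_0^\infty\xi\int_{-\infty}^\infty\langle(\xi-i\eta+A)^{-2}x,y\rangle f'(\xi+i\eta)\,d\eta\,d\xi,\qquad x,y\in H.$$ The map $f\mapsto f(A)$ is a bounded algebra homomorphism from $\mathcal{B}$ to $\mathcal{L}(H)$. *)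

theory Defs
  imports "HOL-Complex_Analysis.Complex_Analysis"
begin

section \<open>Complex Hilbert spaces and their operators\<close>

text \<open>
  The real structure inherited from \<^class>\<open>banach\<close> is required to be the restriction of the complex
  one. The inner product is linear in its first argument; its positive definiteness follows from
  \<open>power2_norm_eq_cinner\<close>.
\<close>

class complex_hilbert_space = banach +
  fixes scaleC :: "complex \<Rightarrow> 'a \<Rightarrow> 'a" (infixr "*\<^sub>C" 75)
    and cinner :: "'a \<Rightarrow> 'a \<Rightarrow> complex"
  assumes scaleC_add_right: "c *\<^sub>C (x + y) = c *\<^sub>C x + c *\<^sub>C y"
    and scaleC_add_left: "(c + d) *\<^sub>C x = c *\<^sub>C x + d *\<^sub>C x"
    and scaleC_scaleC: "c *\<^sub>C d *\<^sub>C x = (c * d) *\<^sub>C x"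
    and scaleR_scaleC: "r *\<^sub>R x = complex_of_real r *\<^sub>C x"
    and cinner_add_left: "cinner (x + y) z = cinner x z + cinner y z"
    and cinner_scaleC_left: "cinner (c *\<^sub>C x) y = c * cinner x y"
    and cinner_commute: "cinner x y = cnj (cinner y x)"
    and power2_norm_eq_cinner: "complex_of_real ((norm x)\<^sup>2) = cinner x x"

definition bounded_clinear :: "('h::complex_hilbert_space \<Rightarrow> 'h) \<Rightarrow> bool" where
  "bounded_clinear B \<longleftrightarrow> bounded_linear B \<and> (\<forall>c x. B (c *\<^sub>C x) = c *\<^sub>C B x)"

text \<open>
  A not necessarily everywhere defined operator is represented by its graph, a subset of
  \<open>H \<times> H\<close>; its domain is \<^const>\<open>Domain\<close>. Since relational composition \<open>O\<close> reads
  from left to right, the product \<open>S R\<close> of operators (first \<open>R\<close>, then \<open>S\<close>, with the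
  natural domain) is \<open>R O S\<close>.
\<close>

type_synonym 'h op = "('h \<times> 'h) set"

definition op_graph :: "('h \<Rightarrow> 'h) \<Rightarrow> 'h op" where
  "op_graph B = {(x, B x) | x. True}"

definition op_uminus :: "'h::complex_hilbert_space op \<Rightarrow> 'h op" where
  "op_uminus A = {(x, - y) | x y. (x, y) \<in> A}"

definition in_LH :: "'h::complex_hilbert_space op \<Rightarrow> bool" where
  "in_LH R \<longleftrightarrow> (\<exists>B. bounded_clinear B \<and> R = op_graph B)"

definition op_norm :: "'h::complex_hilbert_space op \<Rightarrow> ennreal" where
  "op_norm R = (SUP (x, y) \<in> {(x, y) \<in> R. norm x \<le> 1}. ennreal (norm y))"

text \<open>
  \<open>shift_inv A z\<close> is \<open>(z + A)\<inverse>\<close>; it is meaningful only if \<open>- z\<close> lies in the resolvent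
  set of \<open>A\<close>.
\<close>

definition shift_inv :: "'h::complex_hilbert_space op \<Rightarrow> complex \<Rightarrow> 'h \<Rightarrow> 'h" where
  "shift_inv A z x = (THE y. (y, x - z *\<^sub>C y) \<in> A)"

section \<open>Semigroups\<close>

text \<open>Only the values \<open>T t\<close> with \<open>t \<ge> 0\<close> are relevant.\<close>

definition c0_semigroup :: "(real \<Rightarrow> 'h::complex_hilbert_space \<Rightarrow> 'h) \<Rightarrow> bool" where
  "c0_semigroup T \<longleftrightarrow>
     (\<forall>t\<ge>0. bounded_clinear (T t)) \<and>
     T 0 = id \<and>
     (\<forall>s\<ge>0. \<forall>t\<ge>0. T (s + t) = T s \<circ> T t) \<and>
     (\<forall>x. ((\<lambda>t. T t x) \<longlongrightarrow> x) (at_right 0))"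

definition bounded_semigroup :: "(real \<Rightarrow> 'h::complex_hilbert_space \<Rightarrow> 'h) \<Rightarrow> bool" where
  "bounded_semigroup T \<longleftrightarrow> bdd_above ((\<lambda>t. onorm (T t)) ` {0..})"

definition generator :: "(real \<Rightarrow> 'h::complex_hilbert_space \<Rightarrow> 'h) \<Rightarrow> 'h op" where
  "generator T = {(x, y). ((\<lambda>h. (T h x - x) /\<^sub>R h) \<longlongrightarrow> y) (at_right 0)}"

definition crandall_pazy :: "real \<Rightarrow> (real \<Rightarrow> 'h::complex_hilbert_space \<Rightarrow> 'h) \<Rightarrow> bool" where
  "crandall_pazy \<beta> T \<longleftrightarrow>
     (\<forall>x. \<forall>t>0. (\<lambda>s. T s x) differentiable (at t)) \<and>
     (\<exists>C. \<forall>\<^sub>F t in at_right 0.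
        op_norm (op_graph (T t) O op_uminus (generator T)) \<le> ennreal (C * t powr (- (1 / \<beta>))))"

section \<open>Fractional powers\<close>

text \<open>
  For a densely defined sectorial operator \<open>A\<close> and \<open>0 < \<alpha> < 1\<close>, the fractional power
  \<open>A\<^sup>\<alpha>\<close> is the closure of the Balakrishnan operator
  \[ x \mapsto \frac{\sin \pi\alpha}{\pi} \int_0^\infty \lambda^{\alpha-1} (\lambda+A)^{-1} A x \, d\lambda
     \qquad (x \in D(A)); \]
  \<open>A\<close> need not be injective. The integral is the Henstock-Kurzweil one because
  the Bochner integral of the library is restricted to separable spaces; the integrand is norm
  continuous with integrable norm, so the two notions agree.
\<close>

definition balakrishnan :: "'h::complex_hilbert_space op \<Rightarrow> real \<Rightarrow> 'h op" where
  "balakrishnan A \<alpha> =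
     {(x, (sin (pi * \<alpha>) / pi) *\<^sub>R
            integral {0<..} (\<lambda>r::real. r powr (\<alpha> - 1) *\<^sub>R shift_inv A (complex_of_real r) y)) | x y.
        (x, y) \<in> A}"

definition frac_power :: "'h::complex_hilbert_space op \<Rightarrow> real \<Rightarrow> 'h op" where
  "frac_power A \<alpha> = closure (balakrishnan A \<alpha>)"

section \<open>The space \<open>\<B>\<close> and its functional calculus\<close>

text \<open>
  Functions on the open right half-plane are total functions of which only the values there matter.
\<close>

definition sup_deriv :: "(complex \<Rightarrow> complex) \<Rightarrow> real \<Rightarrow> ennreal" where
  "sup_deriv f \<xi> = (SUP \<eta>::real. ennreal (norm (deriv f (Complex \<xi> \<eta>))))"

definition B_space :: "(complex \<Rightarrow> complex) set" where
  "B_space = {f. f holomorphic_on {z. Re z > 0} \<and>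
                 (\<integral>\<^sup>+\<xi>\<in>{0<..}. sup_deriv f \<xi> \<partial>lborel) < \<infinity>}"

definition at_inf :: "(complex \<Rightarrow> complex) \<Rightarrow> complex" where
  "at_inf f = Lim (filtercomap Re at_top) f"

definition B0_space :: "(complex \<Rightarrow> complex) set" where
  "B0_space = {f \<in> B_space. at_inf f = 0}"

definition B0_weight :: "real \<Rightarrow> real \<Rightarrow> real" where
  "B0_weight q \<xi> = (if \<xi> < 1 then 1 else \<xi> powr q)"

definition B0_norm :: "real \<Rightarrow> (complex \<Rightarrow> complex) \<Rightarrow> ennreal" where
  "B0_norm q f = (\<integral>\<^sup>+\<xi>\<in>{0<..}. ennreal (B0_weight q \<xi>) * sup_deriv f \<xi> \<partial>lborel)"

definition B_calc :: "'h::complex_hilbert_space op \<Rightarrow> (complex \<Rightarrow> complex) \<Rightarrow> 'h \<Rightarrow> 'h" where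
  "B_calc A f = (THE B. bounded_clinear B \<and>
     (\<forall>x y. cinner (B x) y =
        at_inf f * cinner x y -
        complex_of_real (2 / pi) *
          (LINT \<xi>:{0<..}|lborel. complex_of_real \<xi> *
            (LINT \<eta>|lborel. cinner ((shift_inv A (Complex \<xi> (- \<eta>)) ^^ 2) x) y *
               deriv f (Complex \<xi> \<eta>)))))"

end

theory Submission
  imports Defs "HOL-Probability.Characteristic_Functions"
begin

text \<open>
  Write \<open>\<alpha> = \<beta> q\<close>. For \<open>f\<close> vanishing at infinity the form of \<open>A\<^sup>\<alpha> f(A)\<close> is, up to a constant, the integral of
  \<open>\<xi> \<langle>A\<^sup>\<alpha> (\<xi> - i\<eta> + A)\<inverse> x, ((\<xi> - i\<eta> + A)\<inverse>)\<^sup>* y\<rangle> f'(\<xi> + i\<eta>)\<close>, so it suffices to bound, on each line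
  \<open>Re z = \<xi>\<close>, the integral over \<open>\<eta>\<close> of the modulus of the inner product by a constant times
  \<open>\<phi>\<^sub>q(\<xi>) \<parallel>x\<parallel> \<parallel>y\<parallel> / \<xi>\<close> (\<open>R_comp_vertical_bound\<close>). By the Cauchy-Schwarz inequality this integral is controlled
  by two \<open>L\<^sup>2\<close> norms over the line. Both factors are Laplace transforms, of \<open>A\<^sup>\<alpha> T(t) x\<close> and of \<open>T(t)\<^sup>* y\<close>,
  hence by Plancherel (\<open>plancherel_inequality\<close>) the squares of these norms are at most \<open>2\<pi>\<close> times the
  integrals over \<open>t > 0\<close> of \<open>e\<^sup>-\<^sup>2\<^sup>\<xi>\<^sup>t \<parallel>A\<^sup>\<alpha> T(t) x\<parallel>\<^sup>2\<close> and \<open>e\<^sup>-\<^sup>2\<^sup>\<xi>\<^sup>t \<parallel>T(t)\<^sup>* y\<parallel>\<^sup>2\<close>.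
  The second one is of order \<open>1 / \<xi>\<close>. For the first one, the moment inequality and the
  Crandall-Pazy estimate give \<open>\<parallel>A\<^sup>\<alpha> T(t)\<parallel> \<le> C (t\<^sup>-\<^sup>q + 1)\<close> (\<open>A_pow_T_norm\<close>), whose square is integrable at 0
  because \<open>2 q < 1\<close>; the integral is of order \<open>\<xi>\<^sup>2\<^sup>q\<^sup>-\<^sup>1 + 1 / \<xi>\<close>.

  All vector-valued integrals are taken weakly, that is, tested against vectors and recovered by the Riesz
  representation theorem; this also covers non-separable spaces. Unboundedness of \<open>A\<^sup>\<alpha>\<close> is dealt with
  by multiplying by \<open>(1 + A)\<inverse>\<close>: a pair \<open>(x, w)\<close> belongs to the graph of \<open>A\<^sup>\<alpha>\<close> if and only if
  \<open>(1 + A)\<inverse> w = A\<^sup>\<alpha> (1 + A)\<inverse> x\<close>, where the right-hand side is a bounded operator (\<open>frac_power_iff\<close>).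
  Since bounded operators may be moved through the forms by means of their adjoints, this criterion
  identifies the bounded operator of the form above with \<open>A\<^sup>\<alpha> f(A)\<close> (\<open>frac_power_B_calc\<close>).
\<close>

section \<open>Complex Hilbert spaces\<close>

lemma cinner_add_right: "cinner x (y + z) = cinner x y + cinner x z"
  for x y z :: "'h::complex_hilbert_space"
  by (metis cinner_add_left cinner_commute complex_cnj_add)

lemma cinner_scaleC_right: "cinner x (c *\<^sub>C y) = cnj c * cinner x y"
  for x y :: "'h::complex_hilbert_space"
  by (metis cinner_scaleC_left cinner_commute complex_cnj_mult)

lemma cinner_scaleR_left: "cinner (r *\<^sub>R x) y = complex_of_real r * cinner x y"
  for x y :: "'h::complex_hilbert_space"
  by (simp add: scaleR_scaleC cinner_scaleC_left)

lemma cinner_scaleR_right: "cinner x (r *\<^sub>R y) = complex_of_real r * cinner x y"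
  for x y :: "'h::complex_hilbert_space"
  by (simp add: scaleR_scaleC cinner_scaleC_right)

lemma cinner_zero_left [simp]: "cinner 0 (y::'h::complex_hilbert_space) = 0"
  using cinner_scaleR_left[of 0 0 y] by simp

lemma cinner_zero_right [simp]: "cinner (y::'h::complex_hilbert_space) 0 = 0"
  using cinner_scaleR_right[of y 0 0] by simp

lemma cinner_minus_left: "cinner (- x) y = - cinner x y"
  for x y :: "'h::complex_hilbert_space"
  using cinner_scaleR_left[of "-1" x y] by simp

lemma cinner_minus_right: "cinner x (- y) = - cinner x y"
  for x y :: "'h::complex_hilbert_space"
  using cinner_scaleR_right[of x "-1" y] by simp

lemma cinner_diff_left: "cinner (x - y) z = cinner x z - cinner y z"
  for x y z :: "'h::complex_hilbert_space"
  using cinner_add_left[of x "- y" z] by (simp add: cinner_minus_left)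

lemma cinner_diff_right: "cinner z (x - y) = cinner z x - cinner z y"
  for x y z :: "'h::complex_hilbert_space"
  using cinner_add_right[of z x "- y"] by (simp add: cinner_minus_right)

lemma scaleC_of_real: "complex_of_real r *\<^sub>C x = r *\<^sub>R x"
  for x :: "'h::complex_hilbert_space"
  by (simp add: scaleR_scaleC)

lemma scaleC_one [simp]: "1 *\<^sub>C x = x" for x :: "'h::complex_hilbert_space"
  using scaleR_scaleC[of 1 x] by simp

lemma scaleC_zero_right [simp]: "c *\<^sub>C 0 = (0::'h::complex_hilbert_space)"
  using scaleC_add_right[of c 0 "0::'h"] by simp

lemma scaleC_zero_left [simp]: "0 *\<^sub>C x = (0::'h::complex_hilbert_space)"
  using scaleC_add_left[of 0 0 x] by simp

lemma scaleC_minus_right: "c *\<^sub>C (- x) = - (c *\<^sub>C x)"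
  for x :: "'h::complex_hilbert_space"
  using scaleC_add_right[of c x "- x"] by (simp add: eq_neg_iff_add_eq_0 add.commute)

lemma scaleC_minus_left: "(- c) *\<^sub>C x = - (c *\<^sub>C x)"
  for x :: "'h::complex_hilbert_space"
  using scaleC_add_left[of c "- c" x] by (simp add: eq_neg_iff_add_eq_0 add.commute)

lemma scaleC_diff_right: "c *\<^sub>C (x - y) = c *\<^sub>C x - c *\<^sub>C y"
  for x y :: "'h::complex_hilbert_space"
  using scaleC_add_right[of c x "- y"] by (simp add: scaleC_minus_right)

lemma scaleC_diff_left: "(c - d) *\<^sub>C x = c *\<^sub>C x - d *\<^sub>C x"
  for x :: "'h::complex_hilbert_space"
  using scaleC_add_left[of c "- d" x] by (simp add: scaleC_minus_left)

lemma cinner_self_norm: "cinner x x = complex_of_real ((norm x)\<^sup>2)"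
  for x :: "'h::complex_hilbert_space"
  using power2_norm_eq_cinner[of x] by simp

lemma norm_scaleC: "norm (c *\<^sub>C x) = cmod c * norm x"
  for x :: "'h::complex_hilbert_space"
proof -
  have "complex_of_real ((norm (c *\<^sub>C x))\<^sup>2) = complex_of_real ((cmod c * norm x)\<^sup>2)"
    unfolding power2_norm_eq_cinner cinner_scaleC_left cinner_scaleC_right
    using complex_norm_square[of c]
    by (simp add: cinner_self_norm power_mult_distrib mult.assoc[symmetric])
  hence "(norm (c *\<^sub>C x))\<^sup>2 = (cmod c * norm x)\<^sup>2"
    using of_real_eq_iff by blast
  thus ?thesis by (simp add: power2_eq_iff_nonneg)
qed

lemma norm_diff_square:
  "(norm (x - y))\<^sup>2 = (norm x)\<^sup>2 - 2 * Re (cinner x y) + (norm y)\<^sup>2"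
  for x y :: "'h::complex_hilbert_space"
proof -
  have "complex_of_real ((norm (x - y))\<^sup>2)
      = cinner x x - (cinner x y + cnj (cinner x y)) + cinner y y"
    unfolding power2_norm_eq_cinner
    by (simp add: cinner_diff_left cinner_diff_right cinner_commute[of y x])
  also have "\<dots> = complex_of_real ((norm x)\<^sup>2 - 2 * Re (cinner x y) + (norm y)\<^sup>2)"
    by (simp add: cinner_self_norm complex_add_cnj)
  finally show ?thesis using of_real_eq_iff by blast
qed

lemma cinner_cauchy_schwarz: "cmod (cinner x y) \<le> norm x * norm y"
  for x y :: "'h::complex_hilbert_space"
proof (cases "y = 0")
  case False
  define c where "c = cinner x y / complex_of_real ((norm y)\<^sup>2)"
  have "Re (cinner x (c *\<^sub>C y)) = (cmod (cinner x y))\<^sup>2 / (norm y)\<^sup>2"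
    using complex_norm_square[of "cinner x y"] False
    by (simp add: cinner_scaleC_right c_def cmod_power2 power2_eq_square[of "Re _"] power2_eq_square[of "Im _"])
  moreover have "(norm (c *\<^sub>C y))\<^sup>2 = (cmod (cinner x y))\<^sup>2 / (norm y)\<^sup>2"
    using False by (simp add: norm_scaleC c_def norm_divide norm_mult power2_eq_square)
  ultimately have "0 \<le> (norm x)\<^sup>2 - (cmod (cinner x y))\<^sup>2 / (norm y)\<^sup>2"
    using norm_diff_square[of x "c *\<^sub>C y"] zero_le_power2[of "norm (x - c *\<^sub>C y)"] by linarith
  hence "(cmod (cinner x y))\<^sup>2 \<le> (norm x * norm y)\<^sup>2"
    using False by (simp add: field_simps power_mult_distrib)
  thus ?thesis by (rule power2_le_imp_le) auto
qed auto

lemma bounded_bilinear_cinner: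
  "bounded_bilinear (cinner :: 'h::complex_hilbert_space \<Rightarrow> 'h \<Rightarrow> complex)"
  by unfold_locales
    (auto simp: cinner_add_left cinner_add_right cinner_scaleR_left cinner_scaleR_right
      scaleR_conv_of_real intro!: exI[of _ 1] cinner_cauchy_schwarz)

lemma bounded_bilinear_scaleC:
  "bounded_bilinear (scaleC :: complex \<Rightarrow> 'h::complex_hilbert_space \<Rightarrow> 'h)"
  by unfold_locales
    (auto simp: scaleC_add_left scaleC_add_right scaleR_scaleC scaleC_scaleC norm_scaleC
      scaleR_conv_of_real mult_ac intro!: exI[of _ 1])

lemmas continuous_on_cinner [continuous_intros] =
  bounded_bilinear.continuous_on[OF bounded_bilinear_cinner]
lemmas continuous_on_scaleC [continuous_intros] =
  bounded_bilinear.continuous_on[OF bounded_bilinear_scaleC]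

lemma cinner_ext:
  fixes x y :: "'h::complex_hilbert_space"
  assumes "\<And>v. cinner x v = cinner y v"
  shows "x = y"
proof -
  have "cinner (x - y) (x - y) = 0"
    using assms[of "x - y"] by (simp add: cinner_diff_left)
  thus ?thesis by (simp add: cinner_self_norm)
qed

lemma norm_le_of_cinner:
  fixes x :: "'h::complex_hilbert_space"
  assumes "\<And>v. cmod (cinner x v) \<le> M * norm v" "0 \<le> M"
  shows "norm x \<le> M"
proof (cases "x = 0")
  case False
  have "norm x * norm x \<le> M * norm x"
    using assms(1)[of x] by (simp add: cinner_self_norm norm_power power2_eq_square norm_mult)
  thus ?thesis using False by simp
qed (use assms in auto)

lemma bounded_clinearI:
  fixes B :: "'h::complex_hilbert_space \<Rightarrow> 'h"
  assumes "\<And>x y. B (x + y) = B x + B y" "\<And>c x. B (c *\<^sub>C x) = c *\<^sub>C B x"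
    and "\<And>x. norm (B x) \<le> M * norm x"
  shows "bounded_clinear B"
  unfolding bounded_clinear_def using assms
  by (auto intro!: bounded_linear_intro[where K = M] simp: scaleR_scaleC mult.commute)

lemma
  fixes B :: "'h::complex_hilbert_space \<Rightarrow> 'h"
  assumes "bounded_clinear B"
  shows bounded_clinear_imp_bounded_linear: "bounded_linear B"
    and bounded_clinear_add: "B (x + y) = B x + B y"
    and bounded_clinear_diff: "B (x - y) = B x - B y"
    and bounded_clinear_minus: "B (- x) = - B x"
    and bounded_clinear_scaleC: "B (c *\<^sub>C x) = c *\<^sub>C B x"
    and bounded_clinear_scaleR: "B (r *\<^sub>R x) = r *\<^sub>R B x"
    and bounded_clinear_zero: "B 0 = 0"
    and bounded_clinear_norm: "norm (B x) \<le> onorm B * norm x"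
    and bounded_clinear_onorm_nonneg: "0 \<le> onorm B"
  using assms unfolding bounded_clinear_def
  by (auto simp: linear_simps onorm onorm_pos_le scaleR_scaleC)

text \<open>
  The representing vector minimises \<open>\<parallel>u\<parallel>\<^sup>2 - 2 Re \<phi>(u)\<close>; minimising sequences are Cauchy by the
  parallelogram identity.
\<close>

theorem riesz_representation:
  fixes \<phi> :: "'h::complex_hilbert_space \<Rightarrow> complex"
  assumes add: "\<And>x y. \<phi> (x + y) = \<phi> x + \<phi> y"
    and scale: "\<And>c x. \<phi> (c *\<^sub>C x) = c * \<phi> x"
    and bound: "\<And>x. cmod (\<phi> x) \<le> M * norm x"
  shows "\<exists>w. \<forall>x. \<phi> x = cinner x w"
proof -
  define F where "F u = (norm u)\<^sup>2 - 2 * Re (\<phi> u)" for u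
  define d where "d = (INF u. F u)"
  have scaleR: "\<phi> (r *\<^sub>R x) = complex_of_real r * \<phi> x" for r x
    by (simp add: scaleR_scaleC scale)
  have "- (M\<^sup>2) \<le> F u" for u
  proof -
    have "Re (\<phi> u) \<le> M * norm u"
      using complex_Re_le_cmod[of "\<phi> u"] bound[of u] by linarith
    moreover have "0 \<le> (norm u - M)\<^sup>2" by simp
    ultimately show ?thesis
      unfolding F_def power2_diff by (simp add: mult_ac)
  qed
  hence bdd: "bdd_below (range F)" by (auto intro!: bdd_belowI[of _ "- (M\<^sup>2)"])
  have d_le: "d \<le> F u" for u
    unfolding d_def by (rule cINF_lower[OF bdd]) auto
  have "\<exists>u. F u < d + 1 / real (Suc n)" for n
  proof (rule ccontr)
    assume "\<nexists>u. F u < d + 1 / real (Suc n)"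
    hence "d + 1 / real (Suc n) \<le> d"
      by (subst (2) d_def, intro cINF_greatest) (auto simp: not_less)
    thus False by simp
  qed
  then obtain u where u: "\<And>n. F (u n) < d + 1 / real (Suc n)" by metis
  have near: "(norm (v - w))\<^sup>2 \<le> 2 * (F v - d) + 2 * (F w - d)" for v w
  proof -
    have "(norm ((1/2) *\<^sub>R (v + w)))\<^sup>2 = (norm (v + w))\<^sup>2 / 4"
      by (simp add: power_divide)
    moreover have "(norm (v + w))\<^sup>2 + (norm (v - w))\<^sup>2 = 2 * (norm v)\<^sup>2 + 2 * (norm w)\<^sup>2"
      using norm_diff_square[of v w] norm_diff_square[of v "- w"]
      by (simp add: cinner_minus_right)
    moreover have "\<phi> ((1/2) *\<^sub>R (v + w)) = (\<phi> v + \<phi> w) / 2"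
      by (simp add: scaleR add field_simps)
    hence "Re (\<phi> ((1/2) *\<^sub>R (v + w))) = (Re (\<phi> v) + Re (\<phi> w)) / 2"
      by (simp only: Re_divide_numeral plus_complex.sel)
    ultimately have "(norm (v - w))\<^sup>2 = 2 * F v + 2 * F w - 4 * F ((1/2) *\<^sub>R (v + w))"
      unfolding F_def by argo
    thus ?thesis using d_le[of "(1/2) *\<^sub>R (v + w)"] by argo
  qed
  have "Cauchy u"
  proof (rule CauchyI)
    fix e :: real assume "0 < e"
    then obtain N where N: "4 / e\<^sup>2 < real N" using reals_Archimedean2 by blast
    show "\<exists>N. \<forall>m\<ge>N. \<forall>n\<ge>N. norm (u m - u n) < e"
    proof (intro exI allI impI)
      fix m n assume mn: "N \<le> m" "N \<le> n"
      have N0: "0 < real N" using N \<open>0 < e\<close> by (intro less_trans[OF _ N]) auto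
      have small: "F (u k) - d < 1 / real N" if "N \<le> k" for k
      proof -
        have "1 / real (Suc k) \<le> 1 / real N"
          using that N0 by (intro divide_left_mono) auto
        thus ?thesis using u[of k] by linarith
      qed
      have "4 / real N = 4 * (1 / real N)" by simp
      hence "(norm (u m - u n))\<^sup>2 < 4 / real N"
        using near[of "u m" "u n"] small[OF mn(1)] small[OF mn(2)] by argo
      also have "\<dots> < e\<^sup>2"
        using N N0 \<open>0 < e\<close> by (simp add: field_simps)
      finally show "norm (u m - u n) < e"
        using \<open>0 < e\<close> by (simp add: power_less_imp_less_base)
    qed
  qed
  then obtain w where w: "u \<longlonglongrightarrow> w"
    using Cauchy_convergent_iff convergent_def by blast
  have blin: "bounded_linear \<phi>"
    using add bound scaleR
    by (intro bounded_linear_intro[where K = M]) (auto simp: scaleR_conv_of_real mult.commute)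
  have "(\<lambda>n. F (u n)) \<longlonglongrightarrow> F w"
    unfolding F_def by (intro tendsto_intros w bounded_linear.tendsto[OF blin])
  moreover have "(\<lambda>n. d + 1 / real (Suc n)) \<longlonglongrightarrow> d + 0"
    by (intro tendsto_intros LIMSEQ_Suc lim_1_over_n)
  ultimately have "F w \<le> d + 0"
    using u by (intro LIMSEQ_le) (auto intro!: less_imp_le)
  hence min: "F w \<le> F v" for v using d_le[of v] by linarith
  have Re_eq: "Re (cinner x w) = Re (\<phi> x)" for x
  proof -
    define a where "a = Re (cinner x w) - Re (\<phi> x)"
    have "0 \<le> t\<^sup>2 * (norm x)\<^sup>2 + 2 * t * a" for t
    proof -
      have "(norm (w - (- t) *\<^sub>R x))\<^sup>2 = (norm w)\<^sup>2 + 2 * t * Re (cinner x w) + t\<^sup>2 * (norm x)\<^sup>2"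
        using cinner_commute[of w x]
        by (subst norm_diff_square) (simp add: cinner_scaleR_right cinner_minus_right power_mult_distrib)
      moreover have "\<phi> (w - (- t) *\<^sub>R x) = \<phi> w + complex_of_real t * \<phi> x"
        by (simp add: add scaleR)
      ultimately have "F (w - (- t) *\<^sub>R x) = F w + 2 * t * a + t\<^sup>2 * (norm x)\<^sup>2"
        unfolding F_def a_def by (simp add: algebra_simps)
      thus ?thesis using min[of "w - (- t) *\<^sub>R x"] by linarith
    qed
    \<comment> \<open>nearly the minimiser of the quadratic in \<open>t\<close>; adding 1 avoids a case distinction on \<open>x = 0\<close>\<close>
    from this[of "- a / ((norm x)\<^sup>2 + 1)"]
    have "0 \<le> (a / ((norm x)\<^sup>2 + 1))\<^sup>2 * (norm x)\<^sup>2 - 2 * a\<^sup>2 / ((norm x)\<^sup>2 + 1)"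
      by (simp add: power2_eq_square)
    moreover have "(a / ((norm x)\<^sup>2 + 1))\<^sup>2 * (norm x)\<^sup>2 \<le> (a / ((norm x)\<^sup>2 + 1))\<^sup>2 * ((norm x)\<^sup>2 + 1)"
      by (intro mult_left_mono) auto
    moreover have "(a / ((norm x)\<^sup>2 + 1))\<^sup>2 * ((norm x)\<^sup>2 + 1) = a\<^sup>2 / ((norm x)\<^sup>2 + 1)"
    proof -
      have "(norm x)\<^sup>2 + 1 \<noteq> 0" using zero_le_power2[of "norm x"] by linarith
      thus ?thesis by (simp add: power2_eq_square)
    qed
    ultimately have "a\<^sup>2 / ((norm x)\<^sup>2 + 1) \<le> 0" by simp
    moreover have "0 < (norm x)\<^sup>2 + 1" by (simp add: add_nonneg_pos)
    ultimately have "a\<^sup>2 \<le> 0" by (simp add: divide_le_0_iff)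
    hence "a = 0" by simp
    thus ?thesis unfolding a_def by simp
  qed
  have "\<phi> x = cinner x w" for x
    using Re_eq[of x] Re_eq[of "\<i> *\<^sub>C x"] by (intro complex_eqI) (auto simp: scale cinner_scaleC_left)
  thus ?thesis by blast
qed

lemma sesquilinear_form_operator:
  fixes b :: "'h::complex_hilbert_space \<Rightarrow> 'h \<Rightarrow> complex"
  assumes addl: "\<And>x x' y. b (x + x') y = b x y + b x' y"
    and addr: "\<And>x y y'. b x (y + y') = b x y + b x y'"
    and scl: "\<And>c x y. b (c *\<^sub>C x) y = c * b x y"
    and scr: "\<And>c x y. b x (c *\<^sub>C y) = cnj c * b x y"
    and bound: "\<And>x y. cmod (b x y) \<le> M * norm x * norm y" and "0 \<le> M"
  shows "\<exists>B. bounded_clinear B \<and> (\<forall>x y. cinner (B x) y = b x y) \<and> (\<forall>x. norm (B x) \<le> M * norm x)"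
proof -
  have "\<exists>w. \<forall>y. cnj (b x y) = cinner y w" for x
    using bound by (intro riesz_representation[where M = "M * norm x"]) (auto simp: addr scr)
  then obtain B where B: "\<And>x y. cnj (b x y) = cinner y (B x)" by metis
  have B': "cinner (B x) y = b x y" for x y
    by (metis B cinner_commute complex_cnj_cnj)
  have le: "norm (B x) \<le> M * norm x" for x
    using bound \<open>0 \<le> M\<close> by (intro norm_le_of_cinner) (auto simp: B')
  have "bounded_clinear B"
  proof (rule bounded_clinearI[OF _ _ le])
    show "B (x + y) = B x + B y" for x y
      by (rule cinner_ext) (simp add: B' addl cinner_add_left)
    show "B (c *\<^sub>C x) = c *\<^sub>C B x" for c x
      by (rule cinner_ext) (simp add: B' scl cinner_scaleC_left)
  qed
  thus ?thesis using B' le by blast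
qed

text \<open>The adjoint; the definition is meaningful for bounded complex-linear operators.\<close>

definition adj :: "('h::complex_hilbert_space \<Rightarrow> 'h) \<Rightarrow> 'h \<Rightarrow> 'h" where
  "adj B y = (THE w. \<forall>x. cinner x w = cinner (B x) y)"

lemma cinner_adj:
  fixes B :: "'h::complex_hilbert_space \<Rightarrow> 'h"
  assumes "bounded_clinear B"
  shows "cinner x (adj B y) = cinner (B x) y"
proof -
  have "cmod (cinner (B x) y) \<le> onorm B * norm y * norm x" for x
  proof -
    have "cmod (cinner (B x) y) \<le> norm (B x) * norm y" by (rule cinner_cauchy_schwarz)
    also have "\<dots> \<le> onorm B * norm x * norm y"
      using bounded_clinear_norm[OF assms] by (intro mult_right_mono) auto
    finally show ?thesis by (simp add: mult_ac)
  qed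
  then obtain w where w: "\<forall>x. cinner (B x) y = cinner x w"
    using riesz_representation[of "\<lambda>x. cinner (B x) y" "onorm B * norm y"]
    by (auto simp: bounded_clinear_add[OF assms] bounded_clinear_scaleC[OF assms]
        cinner_add_left cinner_scaleC_left)
  have "(\<forall>x. cinner x (adj B y) = cinner (B x) y)"
    unfolding adj_def
  proof (rule theI[where a = w])
    fix v assume "\<forall>x. cinner x v = cinner (B x) y"
    hence "cinner v x = cinner w x" for x
      using w cinner_commute by metis
    thus "v = w" by (rule cinner_ext)
  qed (use w in auto)
  thus ?thesis by blast
qed

lemma cinner_adj':
  fixes B :: "'h::complex_hilbert_space \<Rightarrow> 'h"
  assumes "bounded_clinear B"
  shows "cinner (adj B y) x = cinner y (B x)"
  by (metis assms cinner_adj cinner_commute)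

lemma adj_diff_norm_le:
  fixes B C :: "'h::complex_hilbert_space \<Rightarrow> 'h"
  assumes "bounded_clinear B" "bounded_clinear C"
    and "\<And>x. norm (B x - C x) \<le> M * norm x" "0 \<le> M"
  shows "norm (adj B y - adj C y) \<le> M * norm y"
proof (rule norm_le_of_cinner)
  fix v
  have "cinner (adj B y - adj C y) v = cinner y (B v - C v)"
    by (simp add: cinner_diff_left cinner_diff_right cinner_adj' assms)
  also have "cmod \<dots> \<le> norm y * norm (B v - C v)" by (rule cinner_cauchy_schwarz)
  also have "\<dots> \<le> norm y * (M * norm v)" using assms(3) by (intro mult_left_mono) auto
  finally show "cmod (cinner (adj B y - adj C y) v) \<le> M * norm y * norm v" by (simp add: mult_ac)
qed (use assms in auto)

lemma adj_norm_le:
  fixes B :: "'h::complex_hilbert_space \<Rightarrow> 'h"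
  assumes "bounded_clinear B" and "\<And>x. norm (B x) \<le> M * norm x" "0 \<le> M"
  shows "norm (adj B y) \<le> M * norm y"
proof (rule norm_le_of_cinner)
  fix v
  have "cmod (cinner (adj B y) v) \<le> norm y * norm (B v)"
    by (simp add: cinner_adj' assms cinner_cauchy_schwarz)
  also have "\<dots> \<le> norm y * (M * norm v)" using assms(2) by (intro mult_left_mono) auto
  finally show "cmod (cinner (adj B y) v) \<le> M * norm y * norm v" by (simp add: mult_ac)
qed (use assms in auto)

section \<open>Weak integrals\<close>

text \<open>
  A function into \<open>H\<close> is \<open>dominated\<close> on a Borel set by a scalar function if it is norm continuous
  there and bounded in norm by that scalar function, which is integrable. The weak integral of such
  a function is defined by testing against all vectors.
\<close>

definition dominated :: "real set \<Rightarrow> (real \<Rightarrow> 'h::complex_hilbert_space) \<Rightarrow> (real \<Rightarrow> real) \<Rightarrow> bool" where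
  "dominated S g m \<longleftrightarrow> S \<in> sets borel \<and> continuous_on S g \<and> (\<forall>t\<in>S. norm (g t) \<le> m t) \<and>
     set_integrable lborel S m"

definition wint :: "real set \<Rightarrow> (real \<Rightarrow> 'h::complex_hilbert_space) \<Rightarrow> 'h" where
  "wint S g = (THE w. \<forall>y. cinner w y = (LINT t:S|lborel. cinner (g t) y))"

lemma set_integrable_dominated:
  fixes f :: "real \<Rightarrow> 'a::{banach, second_countable_topology}"
  assumes "S \<in> sets borel" "continuous_on S f" "set_integrable lborel S m"
    and "\<And>t. t \<in> S \<Longrightarrow> norm (f t) \<le> m t"
  shows "set_integrable lborel S f"
  unfolding set_integrable_def
proof (rule Bochner_Integration.integrable_bound)
  show "integrable lborel (\<lambda>t. indicator S t *\<^sub>R m t)"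
    using assms(3) unfolding set_integrable_def .
  show "(\<lambda>t. indicator S t *\<^sub>R f t) \<in> borel_measurable lborel"
    using borel_measurable_continuous_on_indicator[OF assms(1,2)] by simp
  show "AE t in lborel. norm (indicator S t *\<^sub>R f t) \<le> norm (indicator S t *\<^sub>R m t)"
    using assms(4) by (intro AE_I2) (auto simp: indicator_def intro: order_trans[OF _ abs_ge_self])
qed

lemma dominated_subset:
  assumes "dominated S g m" "S' \<subseteq> S" "S' \<in> sets borel"
  shows "dominated S' g m"
  using assms set_integrable_subset[of lborel S m S'] unfolding dominated_def
  by (auto intro: continuous_on_subset)

lemma dominated_mono:
  assumes "dominated S g m" "\<And>t. t \<in> S \<Longrightarrow> norm (g t) \<le> m' t" "set_integrable lborel S m'"
  shows "dominated S g m'"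
  using assms unfolding dominated_def by auto

lemma dominated_cinner_integrable:
  assumes "dominated S g m"
  shows "set_integrable lborel S (\<lambda>t. cinner (g t) y)"
proof (rule set_integrable_dominated[where m = "\<lambda>t. m t * norm y"])
  show "set_integrable lborel S (\<lambda>t. m t * norm y)"
    using assms unfolding dominated_def by auto
  show "norm (cinner (g t) y) \<le> m t * norm y" if "t \<in> S" for t
    using assms that unfolding dominated_def
    by (intro order_trans[OF cinner_cauchy_schwarz] mult_right_mono) auto
qed (use assms in \<open>auto simp: dominated_def intro!: continuous_intros\<close>)

lemma cmod_lint_cinner_le:
  assumes "dominated S g m"
  shows "cmod (LINT t:S|lborel. cinner (g t) y) \<le> (LINT t:S|lborel. m t) * norm y"
proof -
  have "cmod (LINT t:S|lborel. cinner (g t) y) \<le> (LINT t:S|lborel. cmod (cinner (g t) y))"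
    by (rule set_integral_norm_bound[OF dominated_cinner_integrable[OF assms]])
  also have "\<dots> \<le> (LINT t:S|lborel. m t * norm y)"
  proof (rule set_integral_mono)
    show "cmod (cinner (g t) y) \<le> m t * norm y" if "t \<in> S" for t
      using assms that unfolding dominated_def
      by (intro order_trans[OF cinner_cauchy_schwarz] mult_right_mono) auto
  qed (use assms dominated_cinner_integrable[OF assms] in \<open>auto simp: dominated_def intro!: set_integrable_norm\<close>)
  finally show ?thesis by simp
qed

lemma dominated_lint_nonneg:
  assumes "dominated S g m"
  shows "0 \<le> (LINT t:S|lborel. m t)"
  using assms unfolding dominated_def set_lebesgue_integral_def
  by (intro integral_nonneg_AE AE_I2) (auto simp: indicator_def intro: order_trans[OF norm_ge_zero])

lemma cinner_wint:
  fixes g :: "real \<Rightarrow> 'h::complex_hilbert_space"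
  assumes "dominated S g m"
  shows "cinner (wint S g) y = (LINT t:S|lborel. cinner (g t) y)"
proof -
  note int = dominated_cinner_integrable[OF assms]
  define \<phi> where "\<phi> y = cnj (LINT t:S|lborel. cinner (g t) y)" for y
  have "\<exists>w. \<forall>x. \<phi> x = cinner x w"
  proof (rule riesz_representation)
    show "\<phi> (x + y) = \<phi> x + \<phi> y" for x y
      unfolding \<phi>_def by (simp add: cinner_add_right set_integral_add int)
    show "\<phi> (c *\<^sub>C x) = c * \<phi> x" for c x
      unfolding \<phi>_def by (simp add: cinner_scaleC_right)
    show "cmod (\<phi> x) \<le> (LINT t:S|lborel. m t) * norm x" for x
      unfolding \<phi>_def using cmod_lint_cinner_le[OF assms] by simp
  qed
  then obtain w where w: "\<forall>x. \<phi> x = cinner x w" by blast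
  hence w: "cinner w x = (LINT t:S|lborel. cinner (g t) x)" for x
    unfolding \<phi>_def by (metis cinner_commute complex_cnj_cnj)
  have "\<forall>y. cinner (wint S g) y = (LINT t:S|lborel. cinner (g t) y)"
    unfolding wint_def
  proof (rule theI[where a = w])
    fix v assume "\<forall>y. cinner v y = (LINT t:S|lborel. cinner (g t) y)"
    thus "v = w" using w by (intro cinner_ext) auto
  qed (use w in auto)
  thus ?thesis by blast
qed

lemma wint_eqI:
  fixes g :: "real \<Rightarrow> 'h::complex_hilbert_space"
  assumes "\<And>y. cinner w y = (LINT t:S|lborel. cinner (g t) y)"
  shows "wint S g = w"
  unfolding wint_def
proof (rule the_equality)
  show "v = w" if "\<forall>y. cinner v y = (LINT t:S|lborel. cinner (g t) y)" for v
    using that assms by (intro cinner_ext) simp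
qed (use assms in simp)

lemma norm_wint_le:
  assumes "dominated S g m"
  shows "norm (wint S g) \<le> (LINT t:S|lborel. m t)"
  using cmod_lint_cinner_le[OF assms] dominated_lint_nonneg[OF assms]
  by (intro norm_le_of_cinner) (auto simp: cinner_wint[OF assms])

lemma wint_empty [simp]: "wint {} g = 0"
  by (rule wint_eqI) (simp add: set_lebesgue_integral_def)

lemma wint_Un:
  assumes "dominated (S \<union> S') g m" "S \<in> sets borel" "S' \<in> sets borel" "S \<inter> S' = {}"
  shows "wint (S \<union> S') g = wint S g + wint S' g"
proof -
  have d: "dominated S g m" "dominated S' g m"
    using assms by (auto intro: dominated_subset)
  show ?thesis
    by (rule wint_eqI)
      (simp add: cinner_add_left cinner_wint[OF d(1)] cinner_wint[OF d(2)] set_integral_Un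
        assms(4) dominated_cinner_integrable[OF d(1)] dominated_cinner_integrable[OF d(2)])
qed

lemma wint_add:
  assumes "dominated S g m" "dominated S g' m'"
  shows "wint S (\<lambda>t. g t + g' t) = wint S g + wint S g'"
  by (rule wint_eqI)
    (simp add: cinner_add_left cinner_wint[OF assms(1)] cinner_wint[OF assms(2)]
      dominated_cinner_integrable[OF assms(1)] dominated_cinner_integrable[OF assms(2)]
      set_integral_add)

lemma wint_cong: "(\<And>t. t \<in> S \<Longrightarrow> g t = g' t) \<Longrightarrow> wint S g = wint S g'"
proof -
  assume "\<And>t. t \<in> S \<Longrightarrow> g t = g' t"
  hence "(LINT t:S|lborel. cinner (g t) y) = (LINT t:S|lborel. cinner (g' t) y)" for y
    unfolding set_lebesgue_integral_def by (intro Bochner_Integration.integral_cong) (auto simp: indicator_def)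
  thus ?thesis unfolding wint_def by simp
qed

lemma bounded_clinear_wint:
  fixes g :: "real \<Rightarrow> 'h::complex_hilbert_space"
  assumes "bounded_clinear B" "dominated S g m"
  shows "B (wint S g) = wint S (\<lambda>t. B (g t))"
  by (rule wint_eqI[symmetric])
    (simp add: cinner_adj[OF assms(1), symmetric] cinner_wint[OF assms(2)])

lemma bounded_clinear_scaleC_op: "bounded_clinear (\<lambda>x::'h::complex_hilbert_space. c *\<^sub>C x)"
  by (rule bounded_clinearI[where M = "cmod c"])
    (auto simp: scaleC_add_right scaleC_scaleC norm_scaleC mult.commute)

lemmas scaleC_wint = bounded_clinear_wint[OF bounded_clinear_scaleC_op]

lemma set_integrable_const:
  fixes c :: real
  shows "set_integrable lborel {a<..b::real} (\<lambda>_. c)"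
  unfolding set_integrable_def real_scaleR_def
  by (rule integrable_mult_left) (cases "a \<le> b"; simp add: integrable_indicator_iff)

lemma wint_const_approx:
  fixes g :: "real \<Rightarrow> 'h::complex_hilbert_space"
  assumes "dominated {a<..b} g m" "a \<le> b" and "\<And>t. a < t \<Longrightarrow> t \<le> b \<Longrightarrow> norm (g t - c) \<le> e"
  shows "norm (wint {a<..b} g - (b - a) *\<^sub>R c) \<le> e * (b - a)"
proof -
  have c1: "dominated {a<..b} (\<lambda>t. - c) (\<lambda>t. norm c)"
    unfolding dominated_def using assms(2)
    by (auto intro!: set_integrable_dominated[where m = "\<lambda>_. norm c"] set_integrable_const)
  have c2: "wint {a<..b} (\<lambda>t. - c) = - ((b - a) *\<^sub>R c)"
    using assms(2) by (intro wint_eqI) (simp add: cinner_minus_left cinner_scaleR_left set_lebesgue_integral_def scaleR_conv_of_real)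
  have "wint {a<..b} g - (b - a) *\<^sub>R c = wint {a<..b} (\<lambda>t. g t + (- c))"
    by (subst wint_add[OF assms(1) c1]) (simp add: c2)
  also have "norm \<dots> \<le> (LINT t:{a<..b}|lborel. e)"
  proof (rule norm_wint_le)
    show "dominated {a<..b} (\<lambda>t. g t + - c) (\<lambda>_. e)"
      using assms set_integrable_const[of a b e] unfolding dominated_def
      by (auto intro!: continuous_intros)
  qed
  also have "\<dots> = e * (b - a)" using assms(2) by (simp add: set_lebesgue_integral_def)
  finally show ?thesis .
qed

lemma wint_shift:
  fixes g :: "real \<Rightarrow> 'h::complex_hilbert_space"
  shows "wint {0<..} (\<lambda>t. g (t + h)) = wint {h<..} g"
proof -
  have "(LINT t:{0<..}|lborel. cinner (g (t + h)) y) = (LINT t:{h<..}|lborel. cinner (g t) y)" for y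
    unfolding set_lebesgue_integral_def
    using lborel_integral_real_affine[of 1 "\<lambda>t. indicator {h<..} t *\<^sub>R cinner (g t) y" h]
    by (simp add: indicator_def add.commute[of h])
  thus ?thesis unfolding wint_def by simp
qed

lemma lint_tail_tendsto_0:
  fixes m :: "real \<Rightarrow> real"
  assumes "set_integrable lborel {0<..} m"
  shows "((\<lambda>s. LINT t:{s<..}|lborel. m t) \<longlongrightarrow> 0) at_top"
    and "((\<lambda>s. LINT t:{0<..s}|lborel. m t) \<longlongrightarrow> 0) (at_right 0)"
proof -
  have lim: "((\<lambda>s. LINT t:B s|lborel. m t) \<longlongrightarrow> 0) F"
    if B: "\<And>s::real. B s \<in> sets borel" "\<And>s. s > 0 \<Longrightarrow> B s \<subseteq> {0<..}" and F: "eventually (\<lambda>s. s > 0) F"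
      and ev: "\<And>t. 0 < t \<Longrightarrow> eventually (\<lambda>s. t \<notin> B s) F"
      and cb: "F = at_top \<or> F = at_right 0" for B and F :: "real filter"
  proof -
    have "((\<lambda>s. LINT t|lborel. indicator (B s) t *\<^sub>R m t) \<longlongrightarrow> (LINT t::real|lborel. (0::real))) F"
    proof -
      have seq: "(\<lambda>n. LINT t|lborel. indicator (B (X n)) t *\<^sub>R m t) \<longlonglongrightarrow> (LINT t::real|lborel. (0::real))"
        if X: "filterlim X F sequentially" "\<And>n. X n > 0" for X :: "nat \<Rightarrow> real"
      proof (rule integral_dominated_convergence[where w = "\<lambda>t. \<bar>indicator {0<..} t *\<^sub>R m t\<bar>"
              and s = "\<lambda>n t. indicator (B (X n)) t *\<^sub>R m t" and f = "\<lambda>_. 0" and M = lborel])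
        show "integrable lborel (\<lambda>t. \<bar>indicator {0<..} t *\<^sub>R m t\<bar>)"
          using assms unfolding set_integrable_def by (rule integrable_abs)
        show "(\<lambda>t. indicator (B (X n)) t *\<^sub>R m t) \<in> borel_measurable lborel" for n
        proof -
          have "set_integrable lborel (B (X n)) m"
            using assms B X(2)[of n] by (intro set_integrable_subset[OF assms]) auto
          thus ?thesis unfolding set_integrable_def by auto
        qed
        show "AE t in lborel. norm (indicator (B (X n)) t *\<^sub>R m t) \<le> \<bar>indicator {0<..} t *\<^sub>R m t\<bar>" for n
          using B(2)[OF X(2)[of n]] by (intro AE_I2) (auto simp: indicator_def)
        show "AE t in lborel. (\<lambda>n. indicator (B (X n)) t *\<^sub>R m t) \<longlonglongrightarrow> 0"
        proof (intro AE_I2)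
          fix t :: real
          have "eventually (\<lambda>n. t \<notin> B (X n)) sequentially"
          proof (cases "0 < t")
            case True
            thus ?thesis using ev[OF True] X(1) unfolding filterlim_iff by blast
          next
            case False
            thus ?thesis using B(2)[OF X(2)] by (intro always_eventually) auto
          qed
          thus "(\<lambda>n. indicator (B (X n)) t *\<^sub>R m t) \<longlonglongrightarrow> 0"
            by (intro tendsto_eventually) (auto elim!: eventually_mono)
        qed
      qed simp
      from cb show ?thesis
      proof
        assume F: "F = at_top"
        show ?thesis unfolding F
        proof (rule tendsto_at_topI_sequentially)
          fix X :: "nat \<Rightarrow> real" assume X: "filterlim X at_top sequentially"
          hence "eventually (\<lambda>n. X n > 0) sequentially"
            using filterlim_at_top_dense by blast
          then obtain N where N: "\<And>n. n \<ge> N \<Longrightarrow> X n > 0" unfolding eventually_sequentially by blast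
          have "(\<lambda>n. LINT t|lborel. indicator (B (X (n + N))) t *\<^sub>R m t) \<longlonglongrightarrow> (LINT t::real|lborel. (0::real))"
            by (rule seq) (use F N in \<open>auto intro: filterlim_compose[OF X filterlim_add_const_nat_at_top]\<close>)
          thus "(\<lambda>n. LINT t|lborel. indicator (B (X n)) t *\<^sub>R m t) \<longlonglongrightarrow> (LINT t::real|lborel. (0::real))"
            by (rule LIMSEQ_offset)
        qed
      next
        assume F: "F = at_right 0"
        show ?thesis unfolding F
        proof (rule tendsto_at_right_sequentially[where b = 1])
          fix S :: "nat \<Rightarrow> real" assume S: "\<And>n. 0 < S n" "S \<longlonglongrightarrow> 0"
          hence "\<forall>\<^sub>F n in sequentially. S n \<noteq> 0 \<and> S n > 0" by (intro always_eventually) (auto simp: less_le)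
          with S show "(\<lambda>n. LINT t|lborel. indicator (B (S n)) t *\<^sub>R m t) \<longlonglongrightarrow> (LINT t::real|lborel. (0::real))"
            by (intro seq) (auto simp: F filterlim_at eventually_conj_iff)
        qed simp
      qed
    qed
    thus ?thesis unfolding set_lebesgue_integral_def by simp
  qed
  show "((\<lambda>s. LINT t:{s<..}|lborel. m t) \<longlongrightarrow> 0) at_top"
  proof (rule lim)
    show "eventually (\<lambda>s. t \<notin> {s<..}) at_top" for t :: real
      using eventually_ge_at_top[of t] by eventually_elim simp
  qed (auto intro: eventually_gt_at_top)
  show "((\<lambda>s. LINT t:{0<..s}|lborel. m t) \<longlongrightarrow> 0) (at_right 0)"
  proof (rule lim)
    show "eventually (\<lambda>s. t \<notin> {0<..s}) (at_right 0)" if "0 < t" for t :: real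
      using eventually_at_right_less[of 0] that
      by (auto simp: eventually_at_right intro!: exI[of _ t])
  qed (auto intro: eventually_at_right_less)
qed

text \<open>
  The Henstock-Kurzweil integral is improper at both ends. On \<open>{0..b}\<close> it is obtained from the fundamental
  theorem of calculus for the indefinite weak integral, which is differentiable on \<open>(0, b)\<close> and continuous up
  to the end point 0.
\<close>

lemma has_integral_wint:
  fixes g :: "real \<Rightarrow> 'h::complex_hilbert_space"
  assumes dom: "dominated {0<..} g m"
  shows "(g has_integral wint {0<..} g) {0<..}"
proof -
  define F where "F s = wint {0<..s} g" for s
  have m: "set_integrable lborel {0<..} m" and cont: "continuous_on {0<..} g"
    using dom unfolding dominated_def by auto
  have sub: "dominated S g m" if "S \<subseteq> {0<..}" "S \<in> sets borel" for S
    using dominated_subset[OF dom] that by blast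
  have F_diff: "F t - F s = wint {s<..t} g" if "0 \<le> s" "s \<le> t" for s t
  proof -
    have "{0<..t} = {0<..s} \<union> {s<..t}" using that by auto
    moreover have "wint ({0<..s} \<union> {s<..t}) g = wint {0<..s} g + wint {s<..t} g"
      by (rule wint_Un[OF sub]) (use that in auto)
    ultimately show ?thesis unfolding F_def by simp
  qed
  have deriv: "(F has_vector_derivative g s) (at s)" if "0 < s" for s
  proof -
    have "\<exists>d>0. \<forall>t. norm (t - s) < d \<longrightarrow> norm (F t - F s - (t - s) *\<^sub>R g s) \<le> e * norm (t - s)"
      if "0 < e" for e
    proof -
      have "isCont g s"
        using cont \<open>0 < s\<close> by (simp add: continuous_on_eq_continuous_at)
      then obtain d where d: "d > 0" "\<And>t. dist t s < d \<Longrightarrow> dist (g t) (g s) < e"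
        using \<open>0 < e\<close> unfolding continuous_at_eps_delta by blast
      have near: "norm (g r - g s) \<le> e" if "norm (r - s) < d" for r
        using d(2)[of r] that by (simp add: dist_norm)
      show ?thesis
      proof (intro exI[of _ "min d s"] conjI allI impI)
        fix t assume t: "norm (t - s) < min d s"
        hence "0 < t" by auto
        show "norm (F t - F s - (t - s) *\<^sub>R g s) \<le> e * norm (t - s)"
        proof (cases "s \<le> t")
          case True
          have "norm (wint {s<..t} g - (t - s) *\<^sub>R g s) \<le> e * (t - s)"
            by (rule wint_const_approx[OF sub]) (use True t \<open>0 < s\<close> in \<open>auto intro!: near\<close>)
          thus ?thesis using F_diff[of s t] True \<open>0 < s\<close> by simp
        next
          case False
          have "norm (wint {t<..s} g - (s - t) *\<^sub>R g s) \<le> e * (s - t)"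
            by (rule wint_const_approx[OF sub]) (use False t \<open>0 < t\<close> in \<open>auto intro!: near\<close>)
          moreover have "F t - F s - (t - s) *\<^sub>R g s = - (wint {t<..s} g - (s - t) *\<^sub>R g s)"
            using F_diff[of t s] False \<open>0 < t\<close> by (simp add: algebra_simps)
          ultimately show ?thesis using False by (simp only: norm_minus_cancel) simp
        qed
      qed (use d(1) \<open>0 < s\<close> in auto)
    qed
    thus ?thesis
      unfolding has_vector_derivative_def has_derivative_at_alt
      by (auto intro: bounded_linear_scaleR_left)
  qed
  have F_le: "norm (F s) \<le> (LINT t:{0<..s}|lborel. m t)" for s
    unfolding F_def by (rule norm_wint_le[OF sub]) auto
  have F0: "F 0 = 0" unfolding F_def by simp
  have F_cont: "continuous_on {0..b} F" if "0 < b" for b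
    unfolding continuous_on_eq_continuous_within
  proof
    fix s assume s: "s \<in> {0..b}"
    show "continuous (at s within {0..b}) F"
    proof (cases "s = 0")
      case True
      have "(F \<longlongrightarrow> 0) (at_right 0)"
        using F_le by (intro Lim_null_comparison[OF _ lint_tail_tendsto_0(2)[OF m]]) auto
      thus ?thesis
        using True that F0 by (simp add: continuous_within at_within_Icc_at_right)
    next
      case False
      thus ?thesis
        using s has_vector_derivative_continuous[OF deriv[of s]] continuous_at_imp_continuous_within by auto
    qed
  qed
  have fin: "(g has_integral F b) {0..b}" if "0 < b" for b
    using fundamental_theorem_of_calculus_interior[of 0 b F g] F_cont[OF that] deriv that F0 by simp
  have restr: "((\<lambda>x. if x \<in> {0<..} then g x else 0) has_integral F b) {a..b}" if "a \<le> 0" "0 < b" for a b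
  proof -
    have "((\<lambda>x. if x \<in> {0<..} then g x else 0) has_integral F b) {0..b}"
      by (rule has_integral_spike_finite[OF _ _ fin[OF that(2)], of "{0}"]) auto
    hence "((\<lambda>x. if x \<in> {0..b} then (if x \<in> {0<..} then g x else 0) else 0) has_integral F b) {a..b}"
      using that by (subst has_integral_restrict) auto
    thus ?thesis by (rule has_integral_eq[rotated]) auto
  qed
  have F_inf: "norm (F b - wint {0<..} g) \<le> (LINT t:{b<..}|lborel. m t)" if "0 < b" for b
  proof -
    have "{0<..} = {0<..b} \<union> {b<..}" using that by auto
    moreover have "wint ({0<..b} \<union> {b<..}) g = wint {0<..b} g + wint {b<..} g"
      by (rule wint_Un[OF sub]) (use that in auto)
    ultimately have "F b - wint {0<..} g = - wint {b<..} g" unfolding F_def by simp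
    moreover have "norm (wint {b<..} g) \<le> (LINT t:{b<..}|lborel. m t)"
      by (rule norm_wint_le[OF sub]) (use that in auto)
    ultimately show ?thesis by simp
  qed
  have nbox: "\<not> (\<exists>a b. {0<..} = cbox a (b::real))"
  proof safe
    fix a b :: real assume "{0<..} = cbox a b"
    moreover have "max 1 (b + 1) \<in> {0<..}" by simp
    ultimately have "max 1 (b + 1) \<in> cbox a b" by blast
    thus False by simp
  qed
  have "\<forall>e>0. \<exists>B>0. \<forall>a b. ball 0 B \<subseteq> cbox a b \<longrightarrow>
        (\<exists>z. ((\<lambda>x. if x \<in> {0<..} then g x else 0) has_integral z) (cbox a b) \<and>
          norm (z - wint {0<..} g) < e)"
  proof (intro allI impI)
    fix e :: real assume "0 < e"
    have "\<forall>\<^sub>F b in at_top. (LINT t:{b<..}|lborel. m t) < e"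
      by (rule order_tendstoD(2)[OF lint_tail_tendsto_0(1)[OF m] \<open>0 < e\<close>])
    then obtain B where B: "\<And>b. B \<le> b \<Longrightarrow> (LINT t:{b<..}|lborel. m t) < e"
      unfolding eventually_at_top_linorder by blast
    define C where "C = max B 1"
    have C_pos: "0 < C" unfolding C_def by simp
    show "\<exists>B>0. \<forall>a b. ball 0 B \<subseteq> cbox a b \<longrightarrow>
        (\<exists>z. ((\<lambda>x. if x \<in> {0<..} then g x else 0) has_integral z) (cbox a b) \<and>
          norm (z - wint {0<..} g) < e)"
    proof (intro exI[of _ "2 * C"] conjI allI impI)
      fix a b :: real assume ab: "ball 0 (2 * C) \<subseteq> cbox a b"
      have "0 \<in> cbox a b" "C \<in> cbox a b"
        using subsetD[OF ab, of 0] subsetD[OF ab, of C] C_pos by (auto simp: dist_norm)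
      hence "a \<le> 0" "C \<le> b" by auto
      hence "0 < b" "B \<le> b" unfolding C_def by auto
      thus "\<exists>z. ((\<lambda>x. if x \<in> {0<..} then g x else 0) has_integral z) (cbox a b) \<and>
          norm (z - wint {0<..} g) < e"
        using restr[OF \<open>a \<le> 0\<close>, of b] order_le_less_trans[OF F_inf[of b] B[of b]]
        by (intro exI[of _ "F b"]) (simp only: cbox_interval)
    qed (simp add: C_def)
  qed
  thus ?thesis
    using nbox by (subst has_integral_alt) simp
qed

section \<open>A Plancherel inequality for weak Fourier integrals\<close>

text \<open>The characteristic function of the standard normal distribution, rescaled.\<close>

lemma gaussian_fourier_integral:
  fixes n s :: real
  assumes "0 < n"
  shows "(LINT \<eta>|lborel. complex_of_real (exp (- (\<eta> / n)\<^sup>2 / 2)) * exp (\<i> * complex_of_real (\<eta> * s)))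
     = complex_of_real (2 * pi * normal_density 0 (1 / n) s)"
proof -
  have "char std_normal_distribution (n * s)
      = (LINT x|lborel. std_normal_density x *\<^sub>R exp (\<i> * complex_of_real (n * s * x)))"
    unfolding char_def by (subst integral_density) auto
  also have "\<dots> = (1 / n) *\<^sub>R (LINT \<eta>|lborel. std_normal_density (\<eta> / n) *\<^sub>R exp (\<i> * complex_of_real (\<eta> * s)))"
    using assms by (subst lborel_integral_real_affine[where c = "1 / n" and t = 0]) (auto simp: mult_ac)
  also have "(LINT \<eta>|lborel. std_normal_density (\<eta> / n) *\<^sub>R exp (\<i> * complex_of_real (\<eta> * s)))
      = (1 / sqrt (2 * pi)) *\<^sub>R (LINT \<eta>|lborel. complex_of_real (exp (- (\<eta> / n)\<^sup>2 / 2)) * exp (\<i> * complex_of_real (\<eta> * s)))"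
    unfolding std_normal_density_def
    by (simp add: scaleR_conv_of_real mult.assoc flip: integral_mult_right_zero)
  finally have "(LINT \<eta>|lborel. complex_of_real (exp (- (\<eta> / n)\<^sup>2 / 2)) * exp (\<i> * complex_of_real (\<eta> * s)))
      = (n * sqrt (2 * pi)) *\<^sub>R char std_normal_distribution (n * s)"
    using assms by simp
  also have "\<dots> = complex_of_real (2 * pi * normal_density 0 (1 / n) s)"
  proof -
    have "sqrt (2 * pi * (1 / n)\<^sup>2) = sqrt (2 * pi) / n"
      using assms by (simp add: real_sqrt_mult real_sqrt_divide)
    moreover have "- (s - 0)\<^sup>2 / (2 * (1 / n)\<^sup>2) = - (n * s)\<^sup>2 / 2"
      using assms by (simp add: field_simps power2_eq_square)
    ultimately have "normal_density 0 (1 / n) s = n / sqrt (2 * pi) * exp (- (n * s)\<^sup>2 / 2)"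
      unfolding normal_density_def by simp
    hence "2 * pi * normal_density 0 (1 / n) s = (2 * pi / sqrt (2 * pi)) * n * exp (- (n * s)\<^sup>2 / 2)"
      by simp
    moreover have "2 * pi / sqrt (2 * pi) = sqrt (2 * pi)" by (rule real_div_sqrt) simp
    ultimately have "2 * pi * normal_density 0 (1 / n) s = n * sqrt (2 * pi) * exp (- (n * s)\<^sup>2 / 2)"
      by (simp only: mult.commute[of n])
    thus ?thesis unfolding char_std_normal_distribution by (simp add: scaleR_conv_of_real)
  qed
  finally show ?thesis .
qed

text \<open>
  For a probability density \<open>k\<close>, the quadratic form \<open>\<integral>\<integral> M(t) M(s) k(t - s)\<close> is at most \<open>\<integral> M\<^sup>2\<close>, because
  \<open>2 ab \<le> a\<^sup>2 + b\<^sup>2\<close>.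
\<close>

lemma nn_integral_gaussian_form_le:
  fixes M :: "real \<Rightarrow> real"
  assumes [measurable]: "M \<in> borel_measurable borel" and n: "0 < n" and M: "\<And>t. 0 \<le> M t"
  shows "(\<integral>\<^sup>+p. ennreal (M (fst p) * M (snd p) * normal_density 0 (1 / n) (fst p - snd p)) \<partial>(lborel \<Otimes>\<^sub>M lborel))
    \<le> (\<integral>\<^sup>+t. ennreal ((M t)\<^sup>2) \<partial>lborel)"
proof -
  define k where "k = normal_density 0 (1 / n)"
  have [measurable]: "k \<in> borel_measurable borel" unfolding k_def by simp
  have k0: "0 \<le> k s" for s unfolding k_def by simp
  have kint: "(\<integral>\<^sup>+s. ennreal (k s) \<partial>lborel) = 1"
    unfolding k_def using n by (subst nn_integral_eq_integral) auto
  have k1: "(\<integral>\<^sup>+s. ennreal (k (t - s)) \<partial>lborel) = 1" for t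
    using nn_integral_real_affine[of "\<lambda>s. ennreal (k s)" "-1" t] kint by simp
  have k2: "(\<integral>\<^sup>+t. ennreal (k (t - s)) \<partial>lborel) = 1" for s
    using nn_integral_real_affine[of "\<lambda>s. ennreal (k s)" "1" "- s"] kint by simp
  define I where "I = (\<integral>\<^sup>+t. ennreal ((M t)\<^sup>2) \<partial>lborel)"
  have A: "(\<integral>\<^sup>+p. ennreal ((M (fst p))\<^sup>2 * k (fst p - snd p)) \<partial>(lborel \<Otimes>\<^sub>M lborel)) = I"
  proof -
    have "(\<integral>\<^sup>+p. ennreal ((M (fst p))\<^sup>2 * k (fst p - snd p)) \<partial>(lborel \<Otimes>\<^sub>M lborel))
        = (\<integral>\<^sup>+t. \<integral>\<^sup>+s. ennreal ((M t)\<^sup>2 * k (t - s)) \<partial>lborel \<partial>lborel)"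
      by (subst lborel.nn_integral_fst[symmetric]) auto
    also have "\<dots> = (\<integral>\<^sup>+t. ennreal ((M t)\<^sup>2) * (\<integral>\<^sup>+s. ennreal (k (t - s)) \<partial>lborel) \<partial>lborel)"
      by (simp add: ennreal_mult k0 nn_integral_cmult)
    finally show ?thesis by (simp add: k1 I_def)
  qed
  have B: "(\<integral>\<^sup>+p. ennreal ((M (snd p))\<^sup>2 * k (fst p - snd p)) \<partial>(lborel \<Otimes>\<^sub>M lborel)) = I"
  proof -
    have "(\<integral>\<^sup>+p. ennreal ((M (snd p))\<^sup>2 * k (fst p - snd p)) \<partial>(lborel \<Otimes>\<^sub>M lborel))
        = (\<integral>\<^sup>+s. \<integral>\<^sup>+t. ennreal ((M s)\<^sup>2 * k (t - s)) \<partial>lborel \<partial>lborel)"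
      by (subst lborel_pair.nn_integral_snd[symmetric]) auto
    also have "\<dots> = (\<integral>\<^sup>+s. ennreal ((M s)\<^sup>2) * (\<integral>\<^sup>+t. ennreal (k (t - s)) \<partial>lborel) \<partial>lborel)"
      by (simp add: ennreal_mult k0 nn_integral_cmult)
    finally show ?thesis by (simp add: k2 I_def)
  qed
  have "2 * (\<integral>\<^sup>+p. ennreal (M (fst p) * M (snd p) * k (fst p - snd p)) \<partial>(lborel \<Otimes>\<^sub>M lborel))
      = (\<integral>\<^sup>+p. 2 * ennreal (M (fst p) * M (snd p) * k (fst p - snd p)) \<partial>(lborel \<Otimes>\<^sub>M lborel))"
    by (subst nn_integral_cmult) auto
  also have "\<dots> \<le> (\<integral>\<^sup>+p. ennreal ((M (fst p))\<^sup>2 * k (fst p - snd p))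
          + ennreal ((M (snd p))\<^sup>2 * k (fst p - snd p)) \<partial>(lborel \<Otimes>\<^sub>M lborel))"
  proof (intro nn_integral_mono)
    fix p :: "real \<times> real"
    have "2 * (M (fst p) * M (snd p)) * k (fst p - snd p) \<le> ((M (fst p))\<^sup>2 + (M (snd p))\<^sup>2) * k (fst p - snd p)"
      using sum_squares_bound[of "M (fst p)" "M (snd p)"] by (intro mult_right_mono k0) simp
    hence "ennreal (2 * (M (fst p) * M (snd p) * k (fst p - snd p)))
        \<le> ennreal ((M (fst p))\<^sup>2 * k (fst p - snd p) + (M (snd p))\<^sup>2 * k (fst p - snd p))"
      by (intro ennreal_leI) (simp add: algebra_simps)
    thus "2 * ennreal (M (fst p) * M (snd p) * k (fst p - snd p))
        \<le> ennreal ((M (fst p))\<^sup>2 * k (fst p - snd p)) + ennreal ((M (snd p))\<^sup>2 * k (fst p - snd p))"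
      using M k0 by (simp add: ennreal_mult')
  qed
  also have "\<dots> = 2 * I"
    by (subst nn_integral_add) (auto simp: A B mult_2)
  finally show ?thesis
    unfolding k_def[symmetric] I_def[symmetric]
    by (simp add: ennreal_mult_le_mult_iff)
qed

text \<open>
  Expanding \<open>\<parallel>h(\<eta>)\<parallel>\<^sup>2\<close> for \<open>h(\<eta>) = \<integral> e\<^sup>i\<^sup>\<eta>\<^sup>t g(t) dt\<close> gives a double integral of the scalar function
  \<open>\<langle>g(t), g(s)\<rangle>\<close>. Against a Gaussian weight in \<open>\<eta>\<close>, Fubini's theorem turns it into a quadratic form with a
  Gaussian kernel, which is bounded independently of the width; then the weights increase to 1.
\<close>

theorem plancherel_inequality:
  fixes g :: "real \<Rightarrow> 'h::complex_hilbert_space"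
  assumes dom: "dominated {0<..} g m" and m2: "set_integrable lborel {0<..} (\<lambda>t. (m t)\<^sup>2)"
  shows "(\<lambda>\<eta>. norm (wint {0<..} (\<lambda>t. exp (\<i> * complex_of_real (\<eta> * t)) *\<^sub>C g t))) \<in> borel_measurable borel"
    and "(\<integral>\<^sup>+\<eta>. ennreal ((norm (wint {0<..} (\<lambda>t. exp (\<i> * complex_of_real (\<eta> * t)) *\<^sub>C g t)))\<^sup>2) \<partial>lborel)
    \<le> ennreal (2 * pi * (LINT t:{0<..}|lborel. (m t)\<^sup>2))"
proof -
  define h where "h \<eta> = wint {0<..} (\<lambda>t. exp (\<i> * complex_of_real (\<eta> * t)) *\<^sub>C g t)" for \<eta>
  define M where "M t = indicator {0<..} t *\<^sub>R m t" for t
  define a where "a p = indicator ({0<..} \<times> {0<..}) p *\<^sub>R cinner (g (fst p)) (g (snd p))" for p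
  have cont: "continuous_on {0<..} g" and bnd: "\<And>t. 0 < t \<Longrightarrow> norm (g t) \<le> m t"
    and M_int: "integrable lborel M"
    using dom unfolding dominated_def set_integrable_def M_def by auto
  have M_meas [measurable]: "M \<in> borel_measurable borel"
    using borel_measurable_integrable[OF M_int] by simp
  have M0: "0 \<le> M t" for t
    unfolding M_def using order_trans[OF norm_ge_zero bnd[of t]] by (auto simp: indicator_def)
  have M2: "(\<integral>\<^sup>+t. ennreal ((M t)\<^sup>2) \<partial>lborel) = ennreal (LINT t:{0<..}|lborel. (m t)\<^sup>2)"
  proof -
    have "(M t)\<^sup>2 = indicator {0<..} t *\<^sub>R (m t)\<^sup>2" for t unfolding M_def by (simp add: indicator_def)
    thus ?thesis
      using m2 unfolding set_integrable_def set_lebesgue_integral_def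
      by (subst nn_integral_eq_integral) (auto intro!: AE_I2)
  qed
  have dom': "dominated {0<..} (\<lambda>t. exp (\<i> * complex_of_real (\<eta> * t)) *\<^sub>C g t) m" for \<eta>
    using dom unfolding dominated_def by (auto intro!: continuous_intros simp: norm_scaleC)
  have a_meas [measurable]: "a \<in> borel_measurable (borel \<Otimes>\<^sub>M borel)"
    unfolding a_def borel_prod
  proof (rule borel_measurable_continuous_on_indicator)
    show "continuous_on ({0<..} \<times> {0<..}) (\<lambda>p. cinner (g (fst p)) (g (snd p)))"
      by (intro continuous_intros continuous_on_compose2[OF cont]) auto
    show "{0<..} \<times> {0<..} \<in> sets (borel :: (real \<times> real) measure)"
      by (intro borel_open open_Times) auto
  qed
  have a_le: "norm (a p) \<le> M (fst p) * M (snd p)" for p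
  proof (cases "p \<in> {0<..} \<times> {0<..}")
    case True
    hence "norm (cinner (g (fst p)) (g (snd p))) \<le> m (fst p) * m (snd p)"
      using bnd by (intro order_trans[OF cinner_cauchy_schwarz] mult_mono order_trans[OF norm_ge_zero bnd]) auto
    thus ?thesis using True by (auto simp: a_def M_def)
  next
    case False
    thus ?thesis using M0 by (simp add: a_def)
  qed
  have MM_int: "integrable (lborel \<Otimes>\<^sub>M lborel) (\<lambda>p. M (fst p) * M (snd p))"
    by (rule lborel_pair.Fubini_integrable) (use M_int M0 in \<open>auto simp: abs_mult\<close>)
  have a_int: "integrable (lborel \<Otimes>\<^sub>M lborel) a"
    by (rule Bochner_Integration.integrable_bound[OF MM_int])
      (use a_le M0 in \<open>auto intro!: AE_I2 simp: abs_mult\<close>)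
  have h_sq: "complex_of_real ((norm (h \<eta>))\<^sup>2)
      = (LINT p|(lborel \<Otimes>\<^sub>M lborel). exp (\<i> * complex_of_real (\<eta> * (fst p - snd p))) * a p)" for \<eta>
  proof -
    define e where "e t = exp (\<i> * complex_of_real (\<eta> * t))" for t
    have cnj_e: "cnj (e t) = e (- t)" for t
      unfolding e_def by (simp add: exp_cnj)
    have h_inner: "cinner (h \<eta>) y = (LINT s:{0<..}|lborel. e s * cinner (g s) y)" for y
      unfolding h_def cinner_wint[OF dom'] e_def by (simp only: cinner_scaleC_left)
    have inner: "cinner (g t) (h \<eta>) = (LINT s:{0<..}|lborel. e (- s) * cinner (g t) (g s))" for t
    proof -
      have "cnj (cinner (h \<eta>) (g t)) = (LINT s:{0<..}|lborel. cnj (e s * cinner (g s) (g t)))"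
        unfolding h_inner set_lebesgue_integral_def by (simp flip: Bochner_Integration.integral_cnj)
      thus ?thesis
        unfolding cinner_commute[of "g t" "h \<eta>"] by (simp add: cnj_e flip: cinner_commute[of "g t"])
    qed
    have "complex_of_real ((norm (h \<eta>))\<^sup>2) = cinner (h \<eta>) (h \<eta>)"
      by (rule power2_norm_eq_cinner)
    also have "\<dots> = (LINT t:{0<..}|lborel. e t * cinner (g t) (h \<eta>))"
      by (rule h_inner)
    also have "\<dots> = (LINT t|lborel. LINT s|lborel. e (t - s) * a (t, s))"
    proof -
      have 1: "(indicator {0<..} t *\<^sub>R e t) * (indicator {0<..} s *\<^sub>R (e (- s) * cinner (g t) (g s)))
          = e (t - s) * a (t, s)" for t s
        by (auto simp: a_def indicator_def e_def algebra_simps simp flip: exp_add)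
      have 2: "indicator {0<..} t *\<^sub>R (e t * (LINT s:{0<..}|lborel. e (- s) * cinner (g t) (g s)))
          = (LINT s|lborel. e (t - s) * a (t, s))" for t
        unfolding set_lebesgue_integral_def 1[symmetric]
        by (subst integral_mult_right_zero) (simp only: mult_scaleR_left)
      show ?thesis
        unfolding inner 2[symmetric] by (simp only: set_lebesgue_integral_def)
    qed
    also have "\<dots> = (LINT p|(lborel \<Otimes>\<^sub>M lborel). e (fst p - snd p) * a p)"
    proof -
      have "integrable (lborel \<Otimes>\<^sub>M lborel) (\<lambda>p. e (fst p - snd p) * a p)"
        by (rule Bochner_Integration.integrable_bound[OF a_int])
          (auto simp: e_def norm_mult intro!: AE_I2)
      from lborel_pair.integral_fst'[OF this] show ?thesis by simp
    qed
    finally show ?thesis unfolding e_def .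
  qed
  \<comment> \<open>these weights increase to 1, and their Fourier transforms are nonnegative of integral \<open>2 \<pi>\<close>\<close>
  define w where "w n \<eta> = exp (- (\<eta> / n)\<^sup>2 / 2)" for n \<eta> :: real
  have w_int: "integrable lborel (w n)" if "0 < n" for n
  proof -
    have "w n \<eta> = sqrt (2 * pi * n\<^sup>2) * normal_density 0 n \<eta>" for \<eta>
      unfolding w_def normal_density_def using that by (simp add: power_divide)
    hence "w n = (\<lambda>\<eta>. sqrt (2 * pi * n\<^sup>2) * normal_density 0 n \<eta>)" by auto
    thus ?thesis using that by simp
  qed
  have [measurable]: "w n \<in> borel_measurable borel" for n unfolding w_def[abs_def] by measurable
  interpret P: pair_sigma_finite lborel "lborel \<Otimes>\<^sub>M lborel :: (real \<times> real) measure" ..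
  have weighted: "integrable lborel (\<lambda>\<eta>. w n \<eta> * (norm (h \<eta>))\<^sup>2) \<and>
      (\<integral>\<^sup>+\<eta>. ennreal (w n \<eta> * (norm (h \<eta>))\<^sup>2) \<partial>lborel) \<le> ennreal (2 * pi * (LINT t:{0<..}|lborel. (m t)\<^sup>2))"
    if n: "0 < n" for n
  proof -
    define F where "F = (\<lambda>z :: real \<times> real \<times> real. complex_of_real (w n (fst z)) *
      (exp (\<i> * complex_of_real (fst z * (fst (snd z) - snd (snd z)))) * a (snd z)))"
    have F_meas: "F \<in> borel_measurable (lborel \<Otimes>\<^sub>M (lborel \<Otimes>\<^sub>M lborel))"
      unfolding F_def by measurable
    have F_int: "integrable (lborel \<Otimes>\<^sub>M (lborel \<Otimes>\<^sub>M lborel)) F"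
    proof (rule P.Fubini_integrable[OF F_meas])
      have "(LINT p|(lborel \<Otimes>\<^sub>M lborel). norm (F (\<eta>, p))) = w n \<eta> * (LINT p|(lborel \<Otimes>\<^sub>M lborel). norm (a p))" for \<eta>
        unfolding F_def by (simp add: norm_mult w_def)
      thus "integrable lborel (\<lambda>\<eta>. LINT p|(lborel \<Otimes>\<^sub>M lborel). norm (F (\<eta>, p)))"
        using w_int[OF n] by simp
      show "AE \<eta> in lborel. integrable (lborel \<Otimes>\<^sub>M lborel) (\<lambda>p. F (\<eta>, p))"
      proof (intro AE_I2)
        fix \<eta> :: real
        have "integrable (lborel \<Otimes>\<^sub>M lborel)
            (\<lambda>p. exp (\<i> * complex_of_real (\<eta> * (fst p - snd p))) * a p)"
          by (rule Bochner_Integration.integrable_bound[OF a_int]) (auto simp: norm_mult intro!: AE_I2)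
        thus "integrable (lborel \<Otimes>\<^sub>M lborel) (\<lambda>p. F (\<eta>, p))"
          unfolding F_def by simp
      qed
    qed
    have F1: "(LINT p|(lborel \<Otimes>\<^sub>M lborel). F (\<eta>, p)) = complex_of_real (w n \<eta> * (norm (h \<eta>))\<^sup>2)" for \<eta>
      unfolding F_def fst_conv snd_conv of_real_mult h_sq by (rule integral_mult_right_zero)
    have int: "integrable lborel (\<lambda>\<eta>. w n \<eta> * (norm (h \<eta>))\<^sup>2)"
      using P.integrable_fst'[OF F_int] unfolding F1 complex_of_real_integrable_eq .
    have F2: "(LINT \<eta>|lborel. F (\<eta>, p)) = complex_of_real (2 * pi * normal_density 0 (1 / n) (fst p - snd p)) * a p" for p
    proof -
      have "(LINT \<eta>|lborel. F (\<eta>, p)) = (LINT \<eta>|lborel. complex_of_real (w n \<eta>) *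
          exp (\<i> * complex_of_real (\<eta> * (fst p - snd p)))) * a p"
        unfolding F_def by (simp add: mult.assoc[symmetric])
      thus ?thesis
        unfolding w_def gaussian_fourier_integral[OF n] .
    qed
    have F2_int: "integrable (lborel \<Otimes>\<^sub>M lborel)
        (\<lambda>p. complex_of_real (2 * pi * normal_density 0 (1 / n) (fst p - snd p)) * a p)"
      using P.integrable_snd[of "\<lambda>\<eta> p. F (\<eta>, p)"] F_int unfolding F2 by simp
    have "complex_of_real (LINT \<eta>|lborel. w n \<eta> * (norm (h \<eta>))\<^sup>2)
        = (LINT \<eta>|lborel. LINT p|(lborel \<Otimes>\<^sub>M lborel). F (\<eta>, p))"
      unfolding F1 by (rule integral_complex_of_real[symmetric])
    also have "\<dots> = (LINT p|(lborel \<Otimes>\<^sub>M lborel). LINT \<eta>|lborel. F (\<eta>, p))"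
      using P.Fubini_integral[of "\<lambda>\<eta> p. F (\<eta>, p)"] F_int by simp
    also have "\<dots> = (LINT p|(lborel \<Otimes>\<^sub>M lborel). complex_of_real (2 * pi * normal_density 0 (1 / n) (fst p - snd p)) * a p)"
      unfolding F2 ..
    finally have eq: "complex_of_real (LINT \<eta>|lborel. w n \<eta> * (norm (h \<eta>))\<^sup>2)
       = (LINT p|(lborel \<Otimes>\<^sub>M lborel). complex_of_real (2 * pi * normal_density 0 (1 / n) (fst p - snd p)) * a p)" .
    have pos: "0 \<le> (LINT \<eta>|lborel. w n \<eta> * (norm (h \<eta>))\<^sup>2)"
      by (intro integral_nonneg_AE AE_I2) (simp add: w_def)
    have "(\<integral>\<^sup>+\<eta>. ennreal (w n \<eta> * (norm (h \<eta>))\<^sup>2) \<partial>lborel) = ennreal (LINT \<eta>|lborel. w n \<eta> * (norm (h \<eta>))\<^sup>2)"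
      by (intro nn_integral_eq_integral int AE_I2) (simp add: w_def)
    also have "\<dots> = ennreal (cmod (complex_of_real (LINT \<eta>|lborel. w n \<eta> * (norm (h \<eta>))\<^sup>2)))"
      using pos by simp
    also have "\<dots> \<le> (\<integral>\<^sup>+p. ennreal (cmod (complex_of_real (2 * pi * normal_density 0 (1 / n) (fst p - snd p)) * a p)) \<partial>(lborel \<Otimes>\<^sub>M lborel))"
      unfolding eq by (rule integral_norm_bound_ennreal[OF F2_int])
    also have "\<dots> \<le> (\<integral>\<^sup>+p. ennreal (2 * pi) * ennreal (M (fst p) * M (snd p) * normal_density 0 (1 / n) (fst p - snd p)) \<partial>(lborel \<Otimes>\<^sub>M lborel))"
    proof (intro nn_integral_mono)
      fix p :: "real \<times> real"
      have "cmod (complex_of_real (2 * pi * normal_density 0 (1 / n) (fst p - snd p)) * a p)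
          = 2 * pi * normal_density 0 (1 / n) (fst p - snd p) * norm (a p)"
        by (simp add: norm_mult)
      also have "\<dots> \<le> 2 * pi * normal_density 0 (1 / n) (fst p - snd p) * (M (fst p) * M (snd p))"
        by (intro mult_left_mono a_le) simp
      also have "\<dots> = 2 * pi * (M (fst p) * M (snd p) * normal_density 0 (1 / n) (fst p - snd p))" by simp
      finally show "ennreal (cmod (complex_of_real (2 * pi * normal_density 0 (1 / n) (fst p - snd p)) * a p))
          \<le> ennreal (2 * pi) * ennreal (M (fst p) * M (snd p) * normal_density 0 (1 / n) (fst p - snd p))"
        by (simp add: ennreal_mult'[symmetric] ennreal_leI)
    qed
    also have "\<dots> = ennreal (2 * pi) * (\<integral>\<^sup>+p. ennreal (M (fst p) * M (snd p) * normal_density 0 (1 / n) (fst p - snd p)) \<partial>(lborel \<Otimes>\<^sub>M lborel))"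
      by (rule nn_integral_cmult) measurable
    also have "\<dots> \<le> ennreal (2 * pi) * (\<integral>\<^sup>+t. ennreal ((M t)\<^sup>2) \<partial>lborel)"
      by (intro mult_left_mono nn_integral_gaussian_form_le n M0) auto
    also have "\<dots> = ennreal (2 * pi * (LINT t:{0<..}|lborel. (m t)\<^sup>2))"
      unfolding M2 by (simp add: ennreal_mult')
    finally show ?thesis using int by blast
  qed
  have H_meas: "(\<lambda>\<eta>. (norm (h \<eta>))\<^sup>2) \<in> borel_measurable borel"
  proof -
    have "(\<lambda>\<eta>. (w 1 \<eta> * (norm (h \<eta>))\<^sup>2) / w 1 \<eta>) \<in> borel_measurable borel"
      using weighted[of 1] by (intro borel_measurable_divide) (auto dest: borel_measurable_integrable)
    thus ?thesis by (simp add: w_def)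
  qed
  have "(\<lambda>n. \<integral>\<^sup>+\<eta>. ennreal (w (real (Suc n)) \<eta> * (norm (h \<eta>))\<^sup>2) \<partial>lborel) \<longlonglongrightarrow>
      (\<integral>\<^sup>+\<eta>. ennreal ((norm (h \<eta>))\<^sup>2) \<partial>lborel)"
  proof (rule nn_integral_LIMSEQ)
    show "incseq (\<lambda>n \<eta>. ennreal (w (real (Suc n)) \<eta> * (norm (h \<eta>))\<^sup>2))"
    proof (intro incseq_SucI le_funI ennreal_leI mult_right_mono)
      fix n :: nat and \<eta> :: real
      have "\<bar>\<eta> / real (Suc (Suc n))\<bar> \<le> \<bar>\<eta> / real (Suc n)\<bar>"
        by (simp add: abs_divide frac_le)
      hence "(\<eta> / real (Suc (Suc n)))\<^sup>2 \<le> (\<eta> / real (Suc n))\<^sup>2"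
        unfolding abs_le_square_iff .
      thus "w (real (Suc n)) \<eta> \<le> w (real (Suc (Suc n))) \<eta>"
        unfolding w_def by simp
    qed simp
    show "(\<lambda>\<eta>. ennreal (w (real (Suc n)) \<eta> * (norm (h \<eta>))\<^sup>2)) \<in> borel_measurable lborel" for n
      using H_meas by measurable
    show "(\<lambda>n. ennreal (w (real (Suc n)) \<eta> * (norm (h \<eta>))\<^sup>2)) \<longlonglongrightarrow> ennreal ((norm (h \<eta>))\<^sup>2)" for \<eta>
    proof -
      have "(\<lambda>n. \<eta> * (1 / real (Suc n))) \<longlonglongrightarrow> \<eta> * 0"
        by (intro tendsto_intros LIMSEQ_Suc lim_1_over_n)
      hence "(\<lambda>n. exp (- (\<eta> / real (Suc n))\<^sup>2 / 2) * (norm (h \<eta>))\<^sup>2) \<longlonglongrightarrow> exp (- 0\<^sup>2 / 2) * (norm (h \<eta>))\<^sup>2"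
        by (intro tendsto_intros) auto
      thus ?thesis unfolding w_def by (intro tendsto_ennrealI) simp
    qed
  qed
  thus "(\<integral>\<^sup>+\<eta>. ennreal ((norm (wint {0<..} (\<lambda>t. exp (\<i> * complex_of_real (\<eta> * t)) *\<^sub>C g t)))\<^sup>2) \<partial>lborel)
    \<le> ennreal (2 * pi * (LINT t:{0<..}|lborel. (m t)\<^sup>2))"
    unfolding h_def[symmetric]
    by (rule LIMSEQ_le_const2) (use weighted in auto)
  have "(\<lambda>\<eta>. sqrt ((norm (h \<eta>))\<^sup>2)) \<in> borel_measurable borel"
    using H_meas by measurable
  thus "(\<lambda>\<eta>. norm (wint {0<..} (\<lambda>t. exp (\<i> * complex_of_real (\<eta> * t)) *\<^sub>C g t))) \<in> borel_measurable borel"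
    by (simp add: h_def)
qed

section \<open>Bounded differentiable semigroups and their resolvents\<close>

lemma lint_exp_Ioi:
  fixes a :: real
  assumes "0 < a"
  shows "set_integrable lborel {0<..} (\<lambda>t. exp (- a * t))"
    and "(LINT t:{0<..}|lborel. exp (- a * t)) = 1 / a"
proof -
  have "(\<integral>\<^sup>+t. ennreal (exp (- a * t)) * indicator {0..} t \<partial>lborel) = ennreal (0 - (- exp (- a * 0) / a))"
  proof (rule nn_integral_FTC_atLeast)
    show "((\<lambda>t. - exp (- a * t) / a) has_real_derivative exp (- a * t)) (at t)" for t
      using assms by (auto intro!: derivative_eq_intros)
    have "((\<lambda>t. exp (- a * t)) \<longlongrightarrow> 0) at_top"
      using assms
      by (intro filterlim_compose[OF exp_at_bot] filterlim_tendsto_neg_mult_at_bot[OF tendsto_const] filterlim_ident) auto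
    from tendsto_divide[OF tendsto_minus[OF this] tendsto_const[of a]]
    show "((\<lambda>t. - exp (- a * t) / a) \<longlongrightarrow> 0) at_top" using assms by simp
  qed auto
  also have "(\<integral>\<^sup>+t. ennreal (exp (- a * t)) * indicator {0..} t \<partial>lborel)
      = (\<integral>\<^sup>+t. ennreal (indicator {0<..} t *\<^sub>R exp (- a * t)) \<partial>lborel)"
    by (intro nn_integral_cong_AE) (use AE_lborel_singleton[of "0::real"] in \<open>eventually_elim, auto simp: indicator_def\<close>)
  finally have "has_bochner_integral lborel (\<lambda>t. indicator {0<..} t *\<^sub>R exp (- a * t)) (1 / a)"
    using assms by (intro has_bochner_integral_nn_integral) (auto simp: indicator_def)
  thus "set_integrable lborel {0<..} (\<lambda>t. exp (- a * t))"
    and "(LINT t:{0<..}|lborel. exp (- a * t)) = 1 / a"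
    unfolding set_integrable_def set_lebesgue_integral_def has_bochner_integral_iff by auto
qed

text \<open>
  A semigroup bounded by \<open>K\<close> and differentiable on \<open>(0, \<infinity>)\<close>, with generator \<open>- A\<close>.
\<close>

locale bdd_diff_semigroup =
  fixes T :: "real \<Rightarrow> 'h::complex_hilbert_space \<Rightarrow> 'h" and A :: "'h op" and K :: real
  assumes c0: "c0_semigroup T"
    and gen: "op_uminus A = generator T"
    and T_norm: "\<And>t x. 0 \<le> t \<Longrightarrow> norm (T t x) \<le> K * norm x"
    and K_ge_1: "1 \<le> K"
    and T_differentiable: "\<And>t x. 0 < t \<Longrightarrow> (\<lambda>s. T s x) differentiable (at t)"
begin

lemma T_clin: "0 \<le> t \<Longrightarrow> bounded_clinear (T t)"
  and T_add: "0 \<le> s \<Longrightarrow> 0 \<le> t \<Longrightarrow> T (s + t) x = T s (T t x)"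
  and T_lim0: "((\<lambda>t. T t x) \<longlongrightarrow> x) (at_right 0)"
  using c0 unfolding c0_semigroup_def by auto

lemma T_commute: "0 \<le> s \<Longrightarrow> 0 \<le> t \<Longrightarrow> T s (T t x) = T t (T s x)"
  using T_add[of s t x] T_add[of t s x] by (simp add: add.commute)

lemma T_continuous: "continuous_on {0<..} (\<lambda>t. T t x)"
  by (intro continuous_at_imp_continuous_on ballI differentiable_imp_continuous_within T_differentiable) simp

lemma A_iff: "(x, y) \<in> A \<longleftrightarrow> ((\<lambda>h. (T h x - x) /\<^sub>R h) \<longlongrightarrow> - y) (at_right 0)"
proof -
  have "(x, y) \<in> A \<longleftrightarrow> (x, - y) \<in> op_uminus A" unfolding op_uminus_def by auto
  thus ?thesis unfolding gen generator_def by simp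
qed

lemma A_unique: "(x, y) \<in> A \<Longrightarrow> (x, y') \<in> A \<Longrightarrow> y = y'"
  unfolding A_iff using tendsto_unique[OF trivial_limit_at_right_real] by fastforce

lemma A_bounded_clinear_commute:
  assumes "bounded_clinear B" "\<And>t x. 0 < t \<Longrightarrow> B (T t x) = T t (B x)" "(x, y) \<in> A"
  shows "(B x, B y) \<in> A"
proof -
  have "((\<lambda>h. B ((T h x - x) /\<^sub>R h)) \<longlongrightarrow> B (- y)) (at_right 0)"
    using assms(3) unfolding A_iff
    by (rule bounded_linear.tendsto[OF bounded_clinear_imp_bounded_linear[OF assms(1)]])
  moreover have "\<forall>\<^sub>F h in at_right 0. B ((T h x - x) /\<^sub>R h) = (T h (B x) - B x) /\<^sub>R h"
    using eventually_at_right_less[of 0]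
    by eventually_elim
      (simp add: assms(2) bounded_clinear_scaleR[OF assms(1)] bounded_clinear_diff[OF assms(1)])
  ultimately show ?thesis
    unfolding A_iff bounded_clinear_minus[OF assms(1)] by (simp add: tendsto_cong)
qed

lemma A_T: "(x, y) \<in> A \<Longrightarrow> 0 \<le> s \<Longrightarrow> (T s x, T s y) \<in> A"
  by (rule A_bounded_clinear_commute[OF T_clin]) (use T_commute in \<open>force+\<close>)

lemma T_in_domain:
  assumes "0 < t"
  obtains v where "(T t x, v) \<in> A"
proof -
  obtain D where "((\<lambda>s. T s x) has_vector_derivative D) (at t)"
    using T_differentiable[OF assms] vector_derivative_works by blast
  hence "((\<lambda>h. norm (T (t + h) x - T t x - h *\<^sub>R D) / norm h) \<longlongrightarrow> 0) (at 0)"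
    unfolding has_vector_derivative_def has_derivative_at by blast
  hence lim: "((\<lambda>h. norm (T (t + h) x - T t x - h *\<^sub>R D) / norm h) \<longlongrightarrow> 0) (at_right 0)"
    by (rule tendsto_mono[OF at_le[OF subset_UNIV]])
  have "((\<lambda>h. (T h (T t x) - T t x) /\<^sub>R h - D) \<longlongrightarrow> 0) (at_right 0)"
  proof (rule Lim_null_comparison[OF _ lim])
    show "\<forall>\<^sub>F h in at_right 0. norm ((T h (T t x) - T t x) /\<^sub>R h - D)
        \<le> norm (T (t + h) x - T t x - h *\<^sub>R D) / norm h"
      using eventually_at_right_less[of 0]
    proof eventually_elim
      case (elim h)
      have "(T h (T t x) - T t x) /\<^sub>R h - D = (T (t + h) x - T t x - h *\<^sub>R D) /\<^sub>R h"
        using elim assms T_add[of h t x] by (simp add: algebra_simps)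
      thus ?case by (simp add: divide_inverse mult.commute)
    qed
  qed
  hence "(T t x, - D) \<in> A"
    unfolding A_iff by (simp add: LIM_zero_iff)
  thus ?thesis by (rule that)
qed

text \<open>The resolvent \<open>(z + A)\<inverse>\<close>, as the Laplace transform of the semigroup; meaningful for \<open>Re z > 0\<close>.\<close>

definition R :: "complex \<Rightarrow> 'h \<Rightarrow> 'h" where
  "R z x = wint {0<..} (\<lambda>t. exp (- z * complex_of_real t) *\<^sub>C T t x)"

lemma dominated_R:
  assumes "0 < Re z"
  shows "dominated {0<..} (\<lambda>t. exp (- z * complex_of_real t) *\<^sub>C T t x)
    (\<lambda>t. exp (- Re z * t) * (K * norm x))"
proof -
  have "norm (exp (- z * complex_of_real t) *\<^sub>C T t x) \<le> exp (- Re z * t) * (K * norm x)" if "0 < t" for t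
    using T_norm[of t x] that by (simp add: norm_scaleC)
  moreover have "set_integrable lborel {0<..} (\<lambda>t. exp (- Re z * t) * (K * norm x))"
    using lint_exp_Ioi(1)[OF assms] by (intro set_integrable_mult_left) auto
  ultimately show ?thesis
    unfolding dominated_def by (auto intro!: continuous_intros T_continuous)
qed

lemma R_norm:
  assumes "0 < Re z"
  shows "norm (R z x) \<le> K / Re z * norm x"
proof -
  have "norm (R z x) \<le> (LINT t:{0<..}|lborel. exp (- Re z * t) * (K * norm x))"
    unfolding R_def by (rule norm_wint_le[OF dominated_R[OF assms]])
  also have "\<dots> = 1 / Re z * (K * norm x)"
    unfolding set_integral_mult_left lint_exp_Ioi(2)[OF assms] ..
  finally show ?thesis by simp
qed

lemma R_commute:
  assumes "bounded_clinear B" "\<And>t x. 0 < t \<Longrightarrow> B (T t x) = T t (B x)" "0 < Re z"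
  shows "B (R z x) = R z (B x)"
  unfolding R_def bounded_clinear_wint[OF assms(1) dominated_R[OF assms(3)]]
  by (rule wint_cong) (simp add: assms(2) bounded_clinear_scaleC[OF assms(1)])

lemma R_clin:
  assumes "0 < Re z"
  shows "bounded_clinear (R z)"
proof (rule bounded_clinearI[OF _ _ R_norm[OF assms]])
  show "R z (x + y) = R z x + R z y" for x y
    unfolding R_def wint_add[OF dominated_R[OF assms] dominated_R[OF assms], symmetric]
    by (rule wint_cong) (simp add: bounded_clinear_add[OF T_clin] scaleC_add_right)
  show "R z (c *\<^sub>C x) = c *\<^sub>C R z x" for c x
    unfolding R_def scaleC_wint[OF dominated_R[OF assms]]
    by (rule wint_cong) (simp add: bounded_clinear_scaleC[OF T_clin] scaleC_scaleC mult.commute)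
qed

lemma R_T: "0 < Re z \<Longrightarrow> 0 \<le> s \<Longrightarrow> T s (R z x) = R z (T s x)"
  by (rule R_commute[OF T_clin]) (use T_commute in \<open>force+\<close>)

lemma R_R: "0 < Re z \<Longrightarrow> 0 < Re w \<Longrightarrow> R w (R z x) = R z (R w x)"
  by (rule R_commute[OF R_clin]) (simp_all add: R_T)

lemma T_R_eq:
  assumes "0 < Re z" "0 < h"
  shows "T h (R z x) = exp (z * complex_of_real h) *\<^sub>C
    (R z x - wint {0<..h} (\<lambda>t. exp (- z * complex_of_real t) *\<^sub>C T t x))"
proof -
  define g where "g t = exp (- z * complex_of_real t) *\<^sub>C T t x" for t
  note dom = dominated_R[OF assms(1), of x, folded g_def]
  define B where "B y = exp (- z * complex_of_real h) *\<^sub>C T h y" for y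
  have B: "bounded_clinear B"
    unfolding B_def using assms(2) T_norm[of h]
    by (intro bounded_clinearI[where M = "cmod (exp (- z * complex_of_real h)) * K"])
      (auto simp: norm_scaleC bounded_clinear_add[OF T_clin] bounded_clinear_scaleC[OF T_clin]
        scaleC_add_right scaleC_scaleC mult_ac intro!: mult_left_mono)
  have "B (R z x) = wint {0<..} (\<lambda>t. B (g t))"
    unfolding R_def g_def[symmetric] by (rule bounded_clinear_wint[OF B dom])
  also have "\<dots> = wint {0<..} (\<lambda>t. g (t + h))"
  proof (rule wint_cong)
    fix t :: real assume "t \<in> {0<..}"
    thus "B (g t) = g (t + h)"
      using assms(2) T_add[of h t x]
      by (simp add: B_def g_def bounded_clinear_scaleC[OF T_clin] scaleC_scaleC algebra_simps flip: exp_add)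
  qed
  also have "\<dots> = wint {h<..} g" by (rule wint_shift)
  also have "\<dots> = R z x - wint {0<..h} g"
  proof -
    have "{0<..} = {0<..h} \<union> {h<..}" using assms by auto
    moreover have "wint ({0<..h} \<union> {h<..}) g = wint {0<..h} g + wint {h<..} g"
      by (rule wint_Un[OF dominated_subset[OF dom]]) (use assms in auto)
    ultimately show ?thesis unfolding R_def g_def[symmetric] by simp
  qed
  finally have "exp (z * complex_of_real h) *\<^sub>C B (R z x) = exp (z * complex_of_real h) *\<^sub>C (R z x - wint {0<..h} g)"
    by simp
  thus ?thesis unfolding B_def g_def by (simp add: scaleC_scaleC flip: exp_add)
qed

lemma R_in_domain:
  assumes "0 < Re z"
  shows "(R z x, x - z *\<^sub>C R z x) \<in> A"
proof -
  define g where "g t = exp (- z * complex_of_real t) *\<^sub>C T t x" for t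
  note dom = dominated_R[OF assms, of x, folded g_def]
  have lim_of_real: "((\<lambda>t. complex_of_real t) \<longlongrightarrow> 0) (at_right 0)"
    using tendsto_of_real[OF tendsto_ident_at, of 0 "{0<..}"] by simp
  have exp_lim: "((\<lambda>h. exp (c * complex_of_real h)) \<longlongrightarrow> 1) (at_right 0)" for c
    using tendsto_exp[OF tendsto_mult[OF tendsto_const[of c] lim_of_real]] by simp
  have quot_lim: "((\<lambda>h. (exp (z * complex_of_real h) - 1) / complex_of_real h) \<longlongrightarrow> z) (at_right 0)"
  proof -
    have "((\<lambda>w. exp (z * w)) has_field_derivative z) (at 0)"
      by (auto intro!: derivative_eq_intros)
    hence "((\<lambda>w. (exp (z * w) - 1) / w) \<longlongrightarrow> z) (at 0)"
      by (simp add: DERIV_def)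
    moreover have "filterlim complex_of_real (at 0) (at_right 0)"
      using lim_of_real eventually_at_right_less[of 0]
      by (auto simp: filterlim_at elim: eventually_mono)
    ultimately show ?thesis by (rule filterlim_compose)
  qed
  have g_lim: "(g \<longlongrightarrow> x) (at_right 0)"
    using bounded_bilinear.tendsto[OF bounded_bilinear_scaleC exp_lim[of "- z"] T_lim0[of x]]
    unfolding g_def by simp
  have W_lim: "((\<lambda>h. wint {0<..h} g /\<^sub>R h) \<longlongrightarrow> x) (at_right 0)"
  proof (rule tendstoI)
    fix e :: real assume "0 < e"
    hence "\<forall>\<^sub>F t in at_right 0. dist (g t) x < e / 2"
      using g_lim by (intro tendstoD) auto
    then obtain b where b: "b > 0" "\<And>t. 0 < t \<Longrightarrow> t < b \<Longrightarrow> dist (g t) x < e / 2"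
      unfolding eventually_at_right_field by auto
    have "dist (wint {0<..h} g /\<^sub>R h) x < e" if h: "0 < h" "h < b" for h
    proof -
      have "norm (wint {0<..h} g - (h - 0) *\<^sub>R x) \<le> e / 2 * (h - 0)"
      proof (rule wint_const_approx[OF dominated_subset[OF dom]])
        show "norm (g t - x) \<le> e / 2" if "0 < t" "t \<le> h" for t
          using b(2)[of t] that h by (simp add: dist_norm)
      qed (use h in auto)
      hence "norm (wint {0<..h} g - (h - 0) *\<^sub>R x) / h \<le> e / 2"
        using h by (simp add: pos_divide_le_eq)
      moreover have "wint {0<..h} g /\<^sub>R h - x = (wint {0<..h} g - (h - 0) *\<^sub>R x) /\<^sub>R h"
        using h by (simp add: scaleR_diff_right)
      hence "norm (wint {0<..h} g /\<^sub>R h - x) = norm (wint {0<..h} g - (h - 0) *\<^sub>R x) / h"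
        using h by (simp add: divide_inverse_commute)
      ultimately have "norm (wint {0<..h} g /\<^sub>R h - x) \<le> e / 2" by (simp only:)
      thus ?thesis using \<open>0 < e\<close> by (simp add: dist_norm)
    qed
    thus "\<forall>\<^sub>F h in at_right 0. dist (wint {0<..h} g /\<^sub>R h) x < e"
      unfolding eventually_at_right_field using b(1) by blast
  qed
  have "((\<lambda>h. ((exp (z * complex_of_real h) - 1) / complex_of_real h) *\<^sub>C R z x
        - exp (z * complex_of_real h) *\<^sub>C (wint {0<..h} g /\<^sub>R h)) \<longlongrightarrow> z *\<^sub>C R z x - 1 *\<^sub>C x) (at_right 0)"
    by (intro tendsto_diff bounded_bilinear.tendsto[OF bounded_bilinear_scaleC] quot_lim exp_lim W_lim tendsto_const)
  moreover have "\<forall>\<^sub>F h in at_right 0.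
      ((exp (z * complex_of_real h) - 1) / complex_of_real h) *\<^sub>C R z x
        - exp (z * complex_of_real h) *\<^sub>C (wint {0<..h} g /\<^sub>R h) = (T h (R z x) - R z x) /\<^sub>R h"
    using eventually_at_right_less[of 0]
  proof eventually_elim
    case (elim h)
    have "(T h (R z x) - R z x) /\<^sub>R h = complex_of_real (inverse h) *\<^sub>C
        ((exp (z * complex_of_real h) - 1) *\<^sub>C R z x - exp (z * complex_of_real h) *\<^sub>C wint {0<..h} g)"
      unfolding T_R_eq[OF assms elim] g_def[symmetric]
      by (simp add: scaleR_scaleC scaleC_diff_right scaleC_diff_left)
    thus ?case
      by (simp add: scaleR_scaleC scaleC_diff_right scaleC_scaleC divide_inverse mult.commute)
  qed
  ultimately show ?thesis
    unfolding A_iff by (simp add: tendsto_cong)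
qed

text \<open>
  Being a weak integral over multiples of the \<open>T(t)\<close>, the resolvent commutes with the difference quotients of
  the semigroup, hence with \<open>A\<close>; therefore the right inverse \<open>R z\<close> of \<open>z + A\<close> is also a left inverse.
\<close>

lemma R_left_inverse:
  assumes "0 < Re z" "(y, v) \<in> A"
  shows "R z (z *\<^sub>C y + v) = y"
proof -
  have "(R z y, R z v) \<in> A"
    by (rule A_bounded_clinear_commute[OF R_clin[OF assms(1)] _ assms(2)]) (simp add: R_T assms(1))
  hence "R z v = y - z *\<^sub>C R z y" using A_unique R_in_domain[OF assms(1)] by blast
  thus ?thesis
    by (simp add: bounded_clinear_add[OF R_clin] bounded_clinear_scaleC[OF R_clin] assms(1))
qed

lemma shift_inv_eq_R:
  assumes "0 < Re z"
  shows "shift_inv A z x = R z x"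
  unfolding shift_inv_def
proof (rule the_equality)
  show "(R z x, x - z *\<^sub>C R z x) \<in> A" by (rule R_in_domain[OF assms])
  show "y = R z x" if "(y, x - z *\<^sub>C y) \<in> A" for y
    using R_left_inverse[OF assms that] by simp
qed

lemma resolvent_identity:
  assumes "0 < Re z" "0 < Re w"
  shows "R z x - R w x = (w - z) *\<^sub>C R z (R w x)"
proof -
  have "R z (z *\<^sub>C R w x + (x - w *\<^sub>C R w x)) = R w x"
    by (rule R_left_inverse[OF assms(1) R_in_domain[OF assms(2)]])
  thus ?thesis
    by (simp add: bounded_clinear_add[OF R_clin] bounded_clinear_diff[OF R_clin]
        bounded_clinear_scaleC[OF R_clin] assms scaleC_diff_left algebra_simps)
qed

lemma R_continuous: "continuous_on {z. 0 < Re z} (\<lambda>z. R z x)"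
  unfolding continuous_on_def
proof
  fix w assume "w \<in> {z. 0 < Re z}"
  hence w: "0 < Re w" by simp
  have "((\<lambda>z. cmod (w - z) * (K / Re z * norm (R w x))) \<longlongrightarrow> cmod (w - w) * (K / Re w * norm (R w x)))
      (at w within {z. 0 < Re z})"
    using w by (intro tendsto_intros) auto
  hence lim: "((\<lambda>z. cmod (w - z) * (K / Re z * norm (R w x))) \<longlongrightarrow> 0) (at w within {z. 0 < Re z})" by simp
  have "((\<lambda>z. R z x - R w x) \<longlongrightarrow> 0) (at w within {z. 0 < Re z})"
  proof (rule Lim_null_comparison[OF _ lim])
    show "\<forall>\<^sub>F z in at w within {z. 0 < Re z}. norm (R z x - R w x) \<le> cmod (w - z) * (K / Re z * norm (R w x))"
    proof -
      have "norm (R z x - R w x) \<le> cmod (w - z) * (K / Re z * norm (R w x))" if "0 < Re z" for z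
        unfolding resolvent_identity[OF that w] norm_scaleC
        by (intro mult_left_mono R_norm that) simp
      thus ?thesis unfolding eventually_at_filter by (intro always_eventually) simp
    qed
  qed
  thus "((\<lambda>z. R z x) \<longlongrightarrow> R w x) (at w within {z. 0 < Re z})" by (simp add: LIM_zero_iff)
qed

text \<open>
  A quantitative form of continuity on the domain; the vector \<open>u\<close> is written as \<open>R 1 (u + v)\<close>.
\<close>

lemma T_minus_id_norm:
  assumes "(u, v) \<in> A" "0 < h"
  shows "norm (T h u - u) \<le> (exp h - 1 + exp h * (h * K)) * (norm u + norm v)"
proof -
  define g where "g t = exp (- 1 * complex_of_real t) *\<^sub>C T t (u + v)" for t
  have u: "R 1 (u + v) = u" using R_left_inverse[of 1 u v] assms by simp
  have dom: "dominated {0<..h} g (\<lambda>t. exp (- Re 1 * t) * (K * norm (u + v)))"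
    unfolding g_def by (rule dominated_subset[OF dominated_R]) auto
  have "norm (wint {0<..h} g) \<le> (LINT t:{0<..h}|lborel. K * norm (u + v))"
  proof (rule norm_wint_le[OF dominated_mono[OF dom]])
    show "norm (g t) \<le> K * norm (u + v)" if "t \<in> {0<..h}" for t
    proof -
      have "norm (g t) = exp (- t) * norm (T t (u + v))"
        unfolding g_def by (simp add: norm_scaleC)
      also have "\<dots> \<le> 1 * (K * norm (u + v))"
        using that T_norm[of t] by (intro mult_mono) auto
      finally show ?thesis by simp
    qed
  qed (rule set_integrable_const)
  also have "\<dots> = h * K * norm (u + v)"
    using assms by (simp add: set_lebesgue_integral_def)
  finally have W: "norm (wint {0<..h} g) \<le> h * K * norm (u + v)" .
  have "T h u - u = (exp h - 1) *\<^sub>R u - exp h *\<^sub>R wint {0<..h} g"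
    using T_R_eq[of 1 h "u + v"] assms(2)
    unfolding u g_def[symmetric] mult_1 exp_of_real scaleC_of_real
    by (simp add: algebra_simps)
  also have "norm \<dots> \<le> (exp h - 1) * norm u + exp h * (h * K * norm (u + v))"
    using assms(2) W by (intro order_trans[OF norm_triangle_ineq4] add_mono) (auto intro!: mult_left_mono)
  also have "\<dots> \<le> (exp h - 1) * (norm u + norm v) + exp h * (h * K * (norm u + norm v))"
    using assms(2) K_ge_1 by (intro add_mono mult_left_mono norm_triangle_ineq) auto
  finally show ?thesis by (simp add: algebra_simps)
qed

end

section \<open>Two scalar integrals\<close>

lemma nonneg_has_integral_lborel:
  fixes f :: "real \<Rightarrow> real"
  assumes "f \<in> borel_measurable borel" "S \<in> sets borel" "\<And>x. x \<in> S \<Longrightarrow> 0 \<le> f x" "(f has_integral I) S"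
  shows "set_integrable lborel S f" "(LINT x:S|lborel. f x) = I"
proof -
  have abs: "set_integrable lebesgue S f"
    using assms(3,4) by (intro nonnegative_absolutely_integrable_1) (auto simp: integrable_on_def)
  have meas: "(\<lambda>x. indicator S x *\<^sub>R f x) \<in> borel_measurable lborel"
    using assms(1,2) by measurable
  show "set_integrable lborel S f"
    using abs meas unfolding set_integrable_def by (simp add: integrable_completion)
  have "(LINT x:S|lborel. f x) = (LINT x:S|lebesgue. f x)"
    using meas unfolding set_lebesgue_integral_def by (simp add: integral_completion)
  thus "(LINT x:S|lborel. f x) = I"
    using set_lebesgue_integral_eq_integral(2)[OF abs] integral_unique[OF assms(4)] by simp
qed

lemma set_integral_Ici_Ioi:
  fixes f :: "real \<Rightarrow> real"
  assumes "f 0 = 0"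
  shows "set_integrable lborel {0<..} f \<longleftrightarrow> set_integrable lborel {0..} f"
    and "(LINT x:{0<..}|lborel. f x) = (LINT x:{0..}|lborel. f x)"
proof -
  have eq: "indicator {0<..} x *\<^sub>R f x = indicator {0..} x *\<^sub>R f x" for x
    using assms by (cases "x = 0") (auto simp: indicator_def)
  show "set_integrable lborel {0<..} f \<longleftrightarrow> set_integrable lborel {0..} f"
    and "(LINT x:{0<..}|lborel. f x) = (LINT x:{0..}|lborel. f x)"
    unfolding set_integrable_def set_lebesgue_integral_def eq by (rule refl)+
qed

lemma lint_powr_min:
  fixes \<alpha> \<delta> :: real
  assumes "0 < \<alpha>" "\<alpha> < 1" "0 < \<delta>"
  shows "set_integrable lborel {0<..} (\<lambda>r. r powr (\<alpha> - 1) * min 1 (\<delta> / r))"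
    and "(LINT r:{0<..}|lborel. r powr (\<alpha> - 1) * min 1 (\<delta> / r)) = \<delta> powr \<alpha> * (1 / \<alpha> + 1 / (1 - \<alpha>))"
proof -
  define f where "f r = r powr (\<alpha> - 1) * min 1 (\<delta> / r)" for r
  have "((\<lambda>r. r powr (\<alpha> - 1)) has_integral (\<delta> powr (\<alpha> - 1 + 1) / (\<alpha> - 1 + 1))) {0..\<delta>}"
    using assms by (intro has_integral_powr_from_0) auto
  hence "((\<lambda>r. r powr (\<alpha> - 1)) has_integral (\<delta> powr \<alpha> / \<alpha>)) {0..\<delta>}" by simp
  hence 1: "(f has_integral (\<delta> powr \<alpha> / \<alpha>)) {0..\<delta>}"
  proof (rule has_integral_eq[rotated])
    fix r assume r: "r \<in> {0..\<delta>}"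
    show "r powr (\<alpha> - 1) = f r"
    proof (cases "r = 0")
      case False
      hence "1 \<le> \<delta> / r" using r by (simp add: le_divide_eq)
      thus ?thesis by (simp add: f_def min_def)
    qed (simp add: f_def)
  qed
  have "((\<lambda>r. \<delta> * r powr (\<alpha> - 2)) has_integral (\<delta> * (- (\<delta> powr (\<alpha> - 2 + 1)) / (\<alpha> - 2 + 1)))) {\<delta>..}"
    using assms by (intro has_integral_mult_right has_integral_powr_to_inf) auto
  moreover have "\<delta> * (- (\<delta> powr (\<alpha> - 2 + 1)) / (\<alpha> - 2 + 1)) = \<delta> powr \<alpha> / (1 - \<alpha>)"
  proof -
    have "\<delta> * \<delta> powr (\<alpha> - 1) = \<delta> powr \<alpha>"
      using assms by (simp add: powr_diff)
    moreover have "- x / (\<alpha> - 2 + 1) = x / (1 - \<alpha>)" for x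
    proof -
      have "\<alpha> - 2 + 1 = - (1 - \<alpha>)" by simp
      thus ?thesis by (simp only: minus_divide_left[symmetric] minus_divide_right[symmetric] minus_minus)
    qed
    ultimately show ?thesis by simp
  qed
  ultimately have "((\<lambda>r. \<delta> * r powr (\<alpha> - 2)) has_integral (\<delta> powr \<alpha> / (1 - \<alpha>))) {\<delta>..}" by simp
  hence 2: "(f has_integral (\<delta> powr \<alpha> / (1 - \<alpha>))) {\<delta>..}"
  proof (rule has_integral_eq[rotated])
    fix r assume "r \<in> {\<delta>..}"
    hence r: "0 < r" "\<delta> \<le> r" using assms by auto
    have "r powr (\<alpha> - 1) = r powr (\<alpha> - 2) * r"
      using r powr_add[of r "\<alpha> - 2" 1] by simp
    thus "\<delta> * r powr (\<alpha> - 2) = f r" using r by (simp add: f_def min_def)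
  qed
  have "(f has_integral (\<delta> powr \<alpha> / \<alpha> + \<delta> powr \<alpha> / (1 - \<alpha>))) ({0..\<delta>} \<union> {\<delta>..})"
  proof (rule has_integral_Un[OF 1 2])
    have "{0..\<delta>} \<inter> {\<delta>..} = {\<delta>}" using assms by auto
    thus "negligible ({0..\<delta>} \<inter> {\<delta>..})" by simp
  qed
  moreover have "{0..\<delta>} \<union> {\<delta>..} = {0..}" using assms by auto
  ultimately have 3: "(f has_integral (\<delta> powr \<alpha> / \<alpha> + \<delta> powr \<alpha> / (1 - \<alpha>))) {0..}" by simp
  have meas: "f \<in> borel_measurable borel" unfolding f_def by measurable
  have nn: "0 \<le> f x" if "x \<in> {0..}" for x using that assms by (auto simp: f_def min_def)
  have f0: "f 0 = 0" by (simp add: f_def)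
  note L = nonneg_has_integral_lborel[OF meas _ nn 3]
  show "set_integrable lborel {0<..} (\<lambda>r. r powr (\<alpha> - 1) * min 1 (\<delta> / r))"
    unfolding f_def[symmetric] set_integral_Ici_Ioi(1)[of f, OF f0] by (rule L(1)) auto
  show "(LINT r:{0<..}|lborel. r powr (\<alpha> - 1) * min 1 (\<delta> / r)) = \<delta> powr \<alpha> * (1 / \<alpha> + 1 / (1 - \<alpha>))"
    unfolding f_def[symmetric] set_integral_Ici_Ioi(2)[of f, OF f0] using L(2) by (simp add: distrib_left)
qed

lemma lint_powr_exp:
  fixes a p :: real
  assumes "0 < a" "p < 1"
  shows "set_integrable lborel {0<..} (\<lambda>t. t powr (- p) * exp (- a * t))"
    and "(LINT t:{0<..}|lborel. t powr (- p) * exp (- a * t)) = a powr (p - 1) * Gamma (1 - p)"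
proof -
  define f where "f t = t powr (- p) / exp t" for t :: real
  have G: "(f has_integral Gamma (1 - p)) {0..}"
    using Gamma_integral_real[of "1 - p"] assms unfolding f_def by simp
  have meas: "f \<in> borel_measurable borel" unfolding f_def by measurable
  have f0: "f 0 = 0" by (simp add: f_def)
  have L: "set_integrable lborel {0<..} f" "(LINT t:{0<..}|lborel. f t) = Gamma (1 - p)"
    unfolding set_integral_Ici_Ioi[of f, OF f0]
    by (rule nonneg_has_integral_lborel[OF meas _ _ G]; simp add: f_def)+
  have eq: "indicator {0<..} (0 + a * t) *\<^sub>R f (0 + a * t)
      = a powr (- p) * (indicator {0<..} t *\<^sub>R (t powr (- p) * exp (- a * t)))" for t
    using assms by (auto simp: f_def indicator_def zero_less_mult_iff powr_mult exp_minus field_simps)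
  have eq': "indicator {0<..} t *\<^sub>R (t powr (- p) * exp (- a * t))
      = a powr p * (indicator {0<..} (0 + a * t) *\<^sub>R f (0 + a * t))" for t
    unfolding eq using assms by (simp add: powr_minus)
  show "set_integrable lborel {0<..} (\<lambda>t. t powr (- p) * exp (- a * t))"
    unfolding set_integrable_def eq'
    using lborel_integrable_real_affine[OF L(1)[unfolded set_integrable_def], of a 0] assms by simp
  have "(LINT t:{0<..}|lborel. t powr (- p) * exp (- a * t))
      = a powr p * (LINT t|lborel. indicator {0<..} (0 + a * t) *\<^sub>R f (0 + a * t))"
    unfolding set_lebesgue_integral_def eq' by simp
  also have "(LINT t|lborel. indicator {0<..} (0 + a * t) *\<^sub>R f (0 + a * t)) = Gamma (1 - p) / a"
    using lborel_integral_real_affine[of a "\<lambda>t. indicator {0<..} t *\<^sub>R f t" 0] L(2) assms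
    unfolding set_lebesgue_integral_def by (simp add: eq_divide_eq mult.commute)
  also have "a powr p * (Gamma (1 - p) / a) = a powr (p - 1) * Gamma (1 - p)"
    using assms by (simp add: powr_diff)
  finally show "(LINT t:{0<..}|lborel. t powr (- p) * exp (- a * t)) = a powr (p - 1) * Gamma (1 - p)" .
qed

section \<open>Fractional powers\<close>

context bdd_diff_semigroup
begin

lemma R_1_injective: "R 1 x = R 1 y \<Longrightarrow> x = y"
  using A_unique[of "R 1 x"] R_in_domain[of 1 x] R_in_domain[of 1 y] by fastforce

text \<open>
  On the domain of \<open>A\<close>, the Balakrishnan operator of exponent \<open>\<alpha>\<close> is \<open>x \<mapsto> balakrishnan_reg \<alpha> (x + A x)\<close>,
  where \<open>balakrishnan_reg \<alpha>\<close> is everywhere defined and bounded: it is \<open>A\<^sup>\<alpha> (1 + A)\<inverse>\<close>.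
\<close>

definition balakrishnan_reg :: "real \<Rightarrow> 'h \<Rightarrow> 'h" where
  "balakrishnan_reg \<alpha> x = (sin (pi * \<alpha>) / pi) *\<^sub>R
     wint {0<..} (\<lambda>r. r powr (\<alpha> - 1) *\<^sub>R R (complex_of_real r) (x - R 1 x))"

lemma R_real_continuous: "continuous_on {0<..} (\<lambda>r. R (complex_of_real r) v)"
  by (rule continuous_on_compose2[OF R_continuous]) (auto intro!: continuous_intros)

lemma dominated_balakrishnan:
  assumes "0 < \<alpha>" "\<alpha> < 1" "0 < \<delta>"
    and "\<And>r. 0 < r \<Longrightarrow> norm (R (complex_of_real r) v) \<le> a * min 1 (\<delta> / r)"
  shows "dominated {0<..} (\<lambda>r. r powr (\<alpha> - 1) *\<^sub>R R (complex_of_real r) v)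
      (\<lambda>r. a * (r powr (\<alpha> - 1) * min 1 (\<delta> / r)))"
    and "norm (wint {0<..} (\<lambda>r. r powr (\<alpha> - 1) *\<^sub>R R (complex_of_real r) v))
      \<le> a * (\<delta> powr \<alpha> * (1 / \<alpha> + 1 / (1 - \<alpha>)))"
proof -
  have "norm (r powr (\<alpha> - 1) *\<^sub>R R (complex_of_real r) v) \<le> a * (r powr (\<alpha> - 1) * min 1 (\<delta> / r))"
    if "0 < r" for r
    using mult_left_mono[OF assms(4)[OF that], of "r powr (\<alpha> - 1)"] by (simp add: mult_ac)
  moreover have "set_integrable lborel {0<..} (\<lambda>r. a * (r powr (\<alpha> - 1) * min 1 (\<delta> / r)))"
    using lint_powr_min(1)[OF assms(1-3)] by (intro set_integrable_mult_right) auto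
  ultimately show dom: "dominated {0<..} (\<lambda>r. r powr (\<alpha> - 1) *\<^sub>R R (complex_of_real r) v)
      (\<lambda>r. a * (r powr (\<alpha> - 1) * min 1 (\<delta> / r)))"
    unfolding dominated_def by (auto intro!: continuous_intros R_real_continuous)
  show "norm (wint {0<..} (\<lambda>r. r powr (\<alpha> - 1) *\<^sub>R R (complex_of_real r) v))
      \<le> a * (\<delta> powr \<alpha> * (1 / \<alpha> + 1 / (1 - \<alpha>)))"
    using norm_wint_le[OF dom] unfolding set_integral_mult_right lint_powr_min(2)[OF assms(1-3)] .
qed

lemma norm_R_A_le:
  assumes "(u, v) \<in> A" "0 < r"
  shows "norm (R (complex_of_real r) v) \<le> (1 + K) * norm u"
    and "norm (R (complex_of_real r) v) \<le> K * norm v / r"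
proof -
  have r: "0 < Re (complex_of_real r)" using assms by simp
  have "R (complex_of_real r) v = u - r *\<^sub>R R (complex_of_real r) u"
    using R_left_inverse[OF r assms(1)]
    unfolding bounded_clinear_add[OF R_clin[OF r]] bounded_clinear_scaleC[OF R_clin[OF r]]
    unfolding scaleC_of_real by (simp add: algebra_simps)
  also have "norm \<dots> \<le> norm u + r * norm (R (complex_of_real r) u)"
    using assms(2) by (intro order_trans[OF norm_triangle_ineq4]) simp
  also have "r * norm (R (complex_of_real r) u) \<le> r * (K / r * norm u)"
    using R_norm[OF r, of u] assms(2) by (intro mult_left_mono) auto
  finally show "norm (R (complex_of_real r) v) \<le> (1 + K) * norm u"
    using assms(2) by (simp add: algebra_simps)
  show "norm (R (complex_of_real r) v) \<le> K * norm v / r"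
    using R_norm[OF r, of v] by simp
qed

context
  fixes \<alpha> :: real
  assumes \<alpha>: "0 < \<alpha>" "\<alpha> < 1"
begin

lemma balakrishnan_reg_dom:
  "dominated {0<..} (\<lambda>r. r powr (\<alpha> - 1) *\<^sub>R R (complex_of_real r) (x - R 1 x))
     (\<lambda>r. K * (1 + K) * norm x * (r powr (\<alpha> - 1) * min 1 (1 / r)))"
  and balakrishnan_reg_norm: "norm (balakrishnan_reg \<alpha> x)
     \<le> \<bar>sin (pi * \<alpha>) / pi\<bar> * (K * (1 + K) * (1 / \<alpha> + 1 / (1 - \<alpha>))) * norm x"
proof -
  have A: "(R 1 x, x - R 1 x) \<in> A" using R_in_domain[of 1 x] by simp
  have n1: "norm (R 1 x) \<le> K * norm x" using R_norm[of 1 x] by simp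
  have n2: "norm (x - R 1 x) \<le> (1 + K) * norm x"
    using norm_triangle_ineq4[of x "R 1 x"] n1 by (simp add: algebra_simps)
  have bound: "norm (R (complex_of_real r) (x - R 1 x)) \<le> K * (1 + K) * norm x * min 1 (1 / r)"
    if r: "0 < r" for r
  proof -
    have "norm (R (complex_of_real r) (x - R 1 x)) \<le> (1 + K) * (K * norm x)"
      using norm_R_A_le(1)[OF A r] n1 K_ge_1 by (intro order_trans[OF norm_R_A_le(1)[OF A r]] mult_left_mono) auto
    moreover have "norm (R (complex_of_real r) (x - R 1 x)) \<le> K * ((1 + K) * norm x) / r"
      using n2 r K_ge_1
      by (intro order_trans[OF norm_R_A_le(2)[OF A r]] divide_right_mono mult_left_mono) auto
    ultimately show ?thesis by (simp add: min_def mult_ac)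
  qed
  note B = dominated_balakrishnan[OF \<alpha> zero_less_one bound]
  show "dominated {0<..} (\<lambda>r. r powr (\<alpha> - 1) *\<^sub>R R (complex_of_real r) (x - R 1 x))
     (\<lambda>r. K * (1 + K) * norm x * (r powr (\<alpha> - 1) * min 1 (1 / r)))"
    by (rule B(1))
  have "norm (balakrishnan_reg \<alpha> x) \<le> \<bar>sin (pi * \<alpha>) / pi\<bar> *
      (K * (1 + K) * norm x * (1 powr \<alpha> * (1 / \<alpha> + 1 / (1 - \<alpha>))))"
    unfolding balakrishnan_reg_def norm_scaleR by (intro mult_left_mono B(2) abs_ge_zero)
  thus "norm (balakrishnan_reg \<alpha> x)
     \<le> \<bar>sin (pi * \<alpha>) / pi\<bar> * (K * (1 + K) * (1 / \<alpha> + 1 / (1 - \<alpha>))) * norm x"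
    by (simp add: mult_ac)
qed

lemma balakrishnan_reg_clin: "bounded_clinear (balakrishnan_reg \<alpha>)"
proof (rule bounded_clinearI[OF _ _ balakrishnan_reg_norm])
  have R: "bounded_clinear (R (complex_of_real r))" if "r \<in> {0<..}" for r
    using that by (intro R_clin) simp
  have R1: "bounded_clinear (R 1)" by (intro R_clin) simp
  show "balakrishnan_reg \<alpha> (x + y) = balakrishnan_reg \<alpha> x + balakrishnan_reg \<alpha> y" for x y
    unfolding balakrishnan_reg_def scaleR_add_right[symmetric]
      wint_add[OF balakrishnan_reg_dom balakrishnan_reg_dom, symmetric]
    by (intro arg_cong2[where f = scaleR] refl wint_cong)
      (simp add: bounded_clinear_add[OF R] bounded_clinear_add[OF R1] bounded_clinear_diff[OF R]
        scaleR_add_right scaleR_diff_right)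
  show "balakrishnan_reg \<alpha> (c *\<^sub>C x) = c *\<^sub>C balakrishnan_reg \<alpha> x" for c x
  proof -
    have "c *\<^sub>C balakrishnan_reg \<alpha> x = (sin (pi * \<alpha>) / pi) *\<^sub>R
        (c *\<^sub>C wint {0<..} (\<lambda>r. r powr (\<alpha> - 1) *\<^sub>R R (complex_of_real r) (x - R 1 x)))"
      unfolding balakrishnan_reg_def by (simp add: scaleR_scaleC scaleC_scaleC mult.commute)
    also have "\<dots> = balakrishnan_reg \<alpha> (c *\<^sub>C x)"
      unfolding balakrishnan_reg_def scaleC_wint[OF balakrishnan_reg_dom]
      by (intro arg_cong2[where f = scaleR] refl wint_cong)
        (simp add: bounded_clinear_scaleC[OF R1] bounded_clinear_scaleC[OF R, symmetric]
          scaleC_diff_right[symmetric] scaleR_scaleC scaleC_scaleC mult.commute)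
    finally show ?thesis ..
  qed
qed

lemma balakrishnan_reg_commute:
  assumes "bounded_clinear B" "\<And>t x. 0 < t \<Longrightarrow> B (T t x) = T t (B x)"
  shows "B (balakrishnan_reg \<alpha> x) = balakrishnan_reg \<alpha> (B x)"
  unfolding balakrishnan_reg_def bounded_clinear_scaleR[OF assms(1)]
    bounded_clinear_wint[OF assms(1) balakrishnan_reg_dom]
  by (intro arg_cong2[where f = scaleR] refl wint_cong)
    (simp add: bounded_clinear_scaleR[OF assms(1)] R_commute[OF assms] bounded_clinear_diff[OF assms(1)])

lemma balakrishnan_reg_T: "0 \<le> t \<Longrightarrow> T t (balakrishnan_reg \<alpha> x) = balakrishnan_reg \<alpha> (T t x)"
  by (rule balakrishnan_reg_commute[OF T_clin]) (use T_commute in \<open>force+\<close>)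

lemma balakrishnan_reg_R: "0 < Re z \<Longrightarrow> R z (balakrishnan_reg \<alpha> x) = balakrishnan_reg \<alpha> (R z x)"
  by (rule balakrishnan_reg_commute[OF R_clin]) (simp_all add: R_T)

lemma balakrishnan_reg_domain:
  assumes "(x, y) \<in> A"
  shows "balakrishnan_reg \<alpha> (x + y) = (sin (pi * \<alpha>) / pi) *\<^sub>R
    wint {0<..} (\<lambda>r. r powr (\<alpha> - 1) *\<^sub>R R (complex_of_real r) y)"
  using R_left_inverse[OF _ assms, of 1] unfolding balakrishnan_reg_def by simp

lemma balakrishnan_eq: "balakrishnan A \<alpha> = {(x, balakrishnan_reg \<alpha> (x + y)) | x y. (x, y) \<in> A}"
proof -
  have "(sin (pi * \<alpha>) / pi) *\<^sub>R integral {0<..} (\<lambda>r::real. r powr (\<alpha> - 1) *\<^sub>R shift_inv A (complex_of_real r) y)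
      = balakrishnan_reg \<alpha> (x + y)" if "(x, y) \<in> A" for x y
  proof -
    have "R 1 (x + y) = x" using R_left_inverse[OF _ that, of 1] by simp
    hence "((\<lambda>r. r powr (\<alpha> - 1) *\<^sub>R R (complex_of_real r) y) has_integral
        wint {0<..} (\<lambda>r. r powr (\<alpha> - 1) *\<^sub>R R (complex_of_real r) y)) {0<..}"
      using has_integral_wint[OF balakrishnan_reg_dom[of "x + y"]] by simp
    hence "((\<lambda>r. r powr (\<alpha> - 1) *\<^sub>R shift_inv A (complex_of_real r) y) has_integral
        wint {0<..} (\<lambda>r. r powr (\<alpha> - 1) *\<^sub>R R (complex_of_real r) y)) {0<..}"
      by (rule has_integral_eq[rotated]) (simp add: shift_inv_eq_R)
    thus ?thesis
      unfolding balakrishnan_reg_domain[OF that] by (simp add: integral_unique)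
  qed
  hence "p = (x, (sin (pi * \<alpha>) / pi) *\<^sub>R
        integral {0<..} (\<lambda>r::real. r powr (\<alpha> - 1) *\<^sub>R shift_inv A (complex_of_real r) y)) \<and> (x, y) \<in> A
      \<longleftrightarrow> p = (x, balakrishnan_reg \<alpha> (x + y)) \<and> (x, y) \<in> A" for p x y
    by auto
  thus ?thesis unfolding balakrishnan_def by (simp only:)
qed

text \<open>
  Applying the injective bounded operator \<open>(1 + A)\<inverse>\<close> to the second component of the graph of \<open>A\<^sup>\<alpha>\<close>
  turns the closure of the Balakrishnan operator into an equation between bounded operators.
\<close>

lemma frac_power_iff: "(x, w) \<in> frac_power A \<alpha> \<longleftrightarrow> R 1 w = balakrishnan_reg \<alpha> x"
proof
  have cont: "continuous_on UNIV (R 1)" "continuous_on UNIV (balakrishnan_reg \<alpha>)"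
    using bounded_clinear_imp_bounded_linear[OF balakrishnan_reg_clin]
      bounded_clinear_imp_bounded_linear[OF R_clin[of 1]]
    by (auto intro: linear_continuous_on)
  have "closed {p. R 1 (snd p) = balakrishnan_reg \<alpha> (fst p)}"
    by (intro closed_Collect_eq continuous_on_compose2[OF cont(1)] continuous_on_compose2[OF cont(2)]
        continuous_intros) auto
  moreover have "balakrishnan A \<alpha> \<subseteq> {p. R 1 (snd p) = balakrishnan_reg \<alpha> (fst p)}"
    using R_left_inverse[of 1] by (auto simp: balakrishnan_eq balakrishnan_reg_R)
  ultimately have "frac_power A \<alpha> \<subseteq> {p. R 1 (snd p) = balakrishnan_reg \<alpha> (fst p)}"
    unfolding frac_power_def by (rule closure_minimal[rotated])
  moreover assume "(x, w) \<in> frac_power A \<alpha>"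
  ultimately show "R 1 w = balakrishnan_reg \<alpha> x" by auto
next
  assume eq: "R 1 w = balakrishnan_reg \<alpha> x"
  \<comment> \<open>by differentiability \<open>T(t)\<close> maps into the domain of \<open>A\<close>; these pairs approximate \<open>(x, w)\<close>\<close>
  have "(T t x, T t w) \<in> balakrishnan A \<alpha>" if t: "0 < t" for t
  proof -
    obtain v where v: "(T t x, v) \<in> A" using T_in_domain[OF t] by blast
    have "R 1 (balakrishnan_reg \<alpha> (T t x + v)) = balakrishnan_reg \<alpha> (T t x)"
      using R_left_inverse[OF _ v, of 1] by (simp add: balakrishnan_reg_R)
    also have "\<dots> = R 1 (T t w)"
      using t by (simp add: balakrishnan_reg_T[symmetric] eq[symmetric] R_T)
    finally have "balakrishnan_reg \<alpha> (T t x + v) = T t w" by (rule R_1_injective)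
    thus ?thesis unfolding balakrishnan_eq using v by force
  qed
  hence "\<forall>\<^sub>F t in at_right 0. (T t x, T t w) \<in> closure (balakrishnan A \<alpha>)"
    by (intro eventually_mono[OF eventually_at_right_less[of 0]]) (blast intro: subsetD[OF closure_subset])
  thus "(x, w) \<in> frac_power A \<alpha>"
    unfolding frac_power_def
    by (rule Lim_in_closed_set[OF closed_closure _ _ tendsto_Pair[OF T_lim0 T_lim0]]) simp
qed

end

end

section \<open>Smoothing estimates\<close>

text \<open>
  The bound on \<open>A T(t)\<close> near 0 extends to all \<open>t > 0\<close> in the form \<open>L (t\<^sup>-\<^sup>1\<^sup>/\<^sup>\<beta> + 1)\<close>, because
  \<open>A T(t) = T(t - s) A T(s)\<close> for \<open>s \<le> t\<close> (see \<open>crandall_pazy_semigroupI\<close> below).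
\<close>

locale crandall_pazy_semigroup = bdd_diff_semigroup T A K
  for T :: "real \<Rightarrow> 'h::complex_hilbert_space \<Rightarrow> 'h" and A K +
  fixes \<beta> L :: real
  assumes \<beta>_pos: "0 < \<beta>" and L_nonneg: "0 \<le> L"
    and A_T_norm: "\<And>t x v. 0 < t \<Longrightarrow> (T t x, v) \<in> A \<Longrightarrow> norm v \<le> L * (t powr (- (1 / \<beta>)) + 1) * norm x"
begin

lemma T_diff_norm:
  assumes "0 < a" "a \<le> s" "s < t"
  shows "norm (T t x - T s x)
    \<le> (exp (t - s) - 1 + exp (t - s) * ((t - s) * K)) * (K + L * (a powr (- (1 / \<beta>)) + 1)) * norm x"
proof -
  obtain v where v: "(T s x, v) \<in> A" using T_in_domain[of s x] assms by auto
  have "s powr (- (1 / \<beta>)) \<le> a powr (- (1 / \<beta>))"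
    using assms \<beta>_pos by (intro powr_mono2') auto
  hence "L * (s powr (- (1 / \<beta>)) + 1) * norm x \<le> L * (a powr (- (1 / \<beta>)) + 1) * norm x"
    using L_nonneg by (intro mult_right_mono mult_left_mono) auto
  hence "norm v \<le> L * (a powr (- (1 / \<beta>)) + 1) * norm x"
    using A_T_norm[OF _ v] assms by auto
  moreover have "norm (T s x) \<le> K * norm x" using T_norm assms by auto
  ultimately have n: "norm (T s x) + norm v \<le> (K + L * (a powr (- (1 / \<beta>)) + 1)) * norm x"
    by (simp add: distrib_right)
  have "T t x - T s x = T (t - s) (T s x) - T s x"
    using T_add[of "t - s" s x] assms by simp
  also have "norm \<dots> \<le> (exp (t - s) - 1 + exp (t - s) * ((t - s) * K)) * (norm (T s x) + norm v)"
    using assms by (intro T_minus_id_norm v) auto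
  also have "\<dots> \<le> (exp (t - s) - 1 + exp (t - s) * ((t - s) * K)) * ((K + L * (a powr (- (1 / \<beta>)) + 1)) * norm x)"
    using assms K_ge_1 by (intro mult_left_mono n add_nonneg_nonneg) auto
  finally show ?thesis by (simp add: mult_ac)
qed

text \<open>
  The preceding bound makes the semigroup continuous in operator norm on \<open>(0, \<infinity>)\<close>, and the operator
  norm is invariant under taking adjoints.
\<close>

lemma adj_T_continuous: "continuous_on {0<..} (\<lambda>t. adj (T t) y)"
  unfolding continuous_on_eq_continuous_at[OF open_greaterThan]
proof
  fix s :: real assume "s \<in> {0<..}"
  hence s: "0 < s" by simp
  define a where "a = s / 2"
  define c where "c h = (exp h - 1 + exp h * (h * K)) * (K + L * (a powr (- (1 / \<beta>)) + 1))" for h :: real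
  have c0: "0 \<le> c h" if "0 \<le> h" for h
    unfolding c_def using that K_ge_1 L_nonneg
    by (intro mult_nonneg_nonneg add_nonneg_nonneg) auto
  have diff: "norm (T t x - T s x) \<le> c \<bar>t - s\<bar> * norm x" if t: "a < t" for t x
  proof -
    consider "t < s" | "t = s" | "s < t" by linarith
    thus ?thesis
    proof cases
      case 1
      thus ?thesis using T_diff_norm[of a t s x] s t by (simp add: c_def a_def norm_minus_commute)
    next
      case 3
      thus ?thesis using T_diff_norm[of a s t x] s t by (simp add: c_def a_def)
    qed (simp add: c_def)
  qed
  have bound: "norm (adj (T t) y - adj (T s) y) \<le> c \<bar>t - s\<bar> * norm y" if "a < t" for t
    using s that by (intro adj_diff_norm_le T_clin diff c0) (auto simp: a_def)
  have "((\<lambda>t. c \<bar>t - s\<bar> * norm y) \<longlongrightarrow> c \<bar>s - s\<bar> * norm y) (at s)"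
    unfolding c_def by (intro tendsto_intros)
  hence lim: "((\<lambda>t. c \<bar>t - s\<bar> * norm y) \<longlongrightarrow> 0) (at s)" by (simp add: c_def)
  have "\<forall>\<^sub>F t in at s. a < t"
    using s by (intro order_tendstoD(1)[OF tendsto_ident_at]) (simp add: a_def)
  hence "((\<lambda>t. adj (T t) y - adj (T s) y) \<longlongrightarrow> 0) (at s)"
    by (intro Lim_null_comparison[OF _ lim]) (auto elim!: eventually_mono intro: bound)
  thus "isCont (\<lambda>t. adj (T t) y) s"
    unfolding isCont_def by (simp add: LIM_zero_iff)
qed

lemma adj_T_norm: "0 \<le> t \<Longrightarrow> norm (adj (T t) y) \<le> K * norm y"
  using K_ge_1 by (intro adj_norm_le T_clin T_norm) auto

context
  fixes \<alpha> :: real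
  assumes \<alpha>: "0 < \<alpha>" "\<alpha> < 1"
begin

text \<open>\<open>A_pow_T \<alpha> t\<close> is \<open>A\<^sup>\<alpha> T(t)\<close>, and \<open>A_pow_R \<alpha> z\<close> is \<open>A\<^sup>\<alpha> (z + A)\<inverse>\<close>.\<close>

definition A_pow_T :: "real \<Rightarrow> 'h \<Rightarrow> 'h" where
  "A_pow_T t x = balakrishnan_reg \<alpha> (T t x + (THE v. (T t x, v) \<in> A))"

definition A_pow_R :: "complex \<Rightarrow> 'h \<Rightarrow> 'h" where
  "A_pow_R z x = balakrishnan_reg \<alpha> (x + (1 - z) *\<^sub>C R z x)"

lemma A_pow_T_eq:
  assumes "0 < t" "(T t x, v) \<in> A"
  shows "A_pow_T t x = balakrishnan_reg \<alpha> (T t x + v)"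
proof -
  have "(THE v. (T t x, v) \<in> A) = v"
    using assms(2) A_unique by blast
  thus ?thesis unfolding A_pow_T_def by simp
qed

lemma R_A_pow_T:
  assumes "0 < t"
  shows "R 1 (A_pow_T t x) = balakrishnan_reg \<alpha> (T t x)"
proof -
  obtain v where v: "(T t x, v) \<in> A" using T_in_domain[OF assms] by blast
  show ?thesis
    unfolding A_pow_T_eq[OF assms v]
    using R_left_inverse[OF _ v, of 1] \<alpha> by (simp add: balakrishnan_reg_R)
qed

text \<open>
  This is the argument for the moment inequality \<open>\<parallel>A\<^sup>\<alpha> u\<parallel> \<le> C \<parallel>A u\<parallel>\<^sup>\<alpha> \<parallel>u\<parallel>\<^sup>1\<^sup>-\<^sup>\<alpha>\<close> for \<open>u = T(t) x\<close>: the Balakrishnan integral is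
  split at \<open>\<delta> = t\<^sup>-\<^sup>1\<^sup>/\<^sup>\<beta> + 1\<close>.
\<close>

lemma A_pow_T_norm:
  obtains C where "0 \<le> C" "\<And>t x. 0 < t \<Longrightarrow> norm (A_pow_T t x) \<le> C * (t powr (- (\<alpha> / \<beta>)) + 1) * norm x"
proof -
  define c where "c = \<bar>sin (pi * \<alpha>) / pi\<bar> * ((K * (1 + K) + K * L) * (1 / \<alpha> + 1 / (1 - \<alpha>)))"
  have c0: "0 \<le> c"
    unfolding c_def using K_ge_1 L_nonneg \<alpha> by simp
  have "norm (A_pow_T t x) \<le> 2 * c * (t powr (- (\<alpha> / \<beta>)) + 1) * norm x" if t: "0 < t" for t x
  proof -
    obtain v where v: "(T t x, v) \<in> A" using T_in_domain[OF t] by blast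
    define \<delta> where "\<delta> = t powr (- (1 / \<beta>)) + 1"
    define a where "a = (K * (1 + K) + K * L) * norm x"
    have \<delta>: "0 < \<delta>" unfolding \<delta>_def by (simp add: add_nonneg_pos)
    have bound: "norm (R (complex_of_real r) v) \<le> a * min 1 (\<delta> / r)" if r: "0 < r" for r
    proof -
      have "norm (R (complex_of_real r) v) \<le> (1 + K) * (K * norm x)"
        using T_norm[of t x] t K_ge_1
        by (intro order_trans[OF norm_R_A_le(1)[OF v r]] mult_left_mono) auto
      also have "\<dots> \<le> a" unfolding a_def using K_ge_1 L_nonneg by (simp add: algebra_simps)
      finally have 1: "norm (R (complex_of_real r) v) \<le> a" .
      have "norm (R (complex_of_real r) v) \<le> K * (L * \<delta> * norm x) / r"
        using A_T_norm[OF t v] K_ge_1 r unfolding \<delta>_def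
        by (intro order_trans[OF norm_R_A_le(2)[OF v r]] divide_right_mono mult_left_mono) auto
      also have "\<dots> = K * L * norm x * (\<delta> / r)" by simp
      also have "\<dots> \<le> a * (\<delta> / r)"
        unfolding a_def using K_ge_1 \<delta> r by (intro mult_right_mono) auto
      finally show ?thesis using 1 by (auto simp: min_def)
    qed
    have "norm (A_pow_T t x) \<le> \<bar>sin (pi * \<alpha>) / pi\<bar> * (a * (\<delta> powr \<alpha> * (1 / \<alpha> + 1 / (1 - \<alpha>))))"
      unfolding A_pow_T_eq[OF t v] balakrishnan_reg_domain[OF \<alpha> v] norm_scaleR
      by (intro mult_left_mono dominated_balakrishnan(2)[OF \<alpha> \<delta> bound]) auto
    also have "\<dots> = c * norm x * \<delta> powr \<alpha>" unfolding c_def a_def by (simp add: mult_ac)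
    also have "\<dots> \<le> c * norm x * (2 * (t powr (- (\<alpha> / \<beta>)) + 1))"
    proof (intro mult_left_mono)
      define p where "p = t powr (- (1 / \<beta>))"
      have p0: "0 \<le> p" unfolding p_def by simp
      have pow: "p powr \<alpha> = t powr (- (\<alpha> / \<beta>))" unfolding p_def by (simp add: powr_powr)
      have "\<delta> powr \<alpha> \<le> (2 * max p 1) powr \<alpha>"
        unfolding \<delta>_def p_def[symmetric] using p0 \<alpha> by (intro powr_mono2) auto
      also have "\<dots> = 2 powr \<alpha> * max p 1 powr \<alpha>" by (simp add: powr_mult)
      also have "\<dots> \<le> 2 powr 1 * (p powr \<alpha> + 1)"
        using \<alpha> by (intro mult_mono powr_mono) (auto simp: max_def)
      finally show "\<delta> powr \<alpha> \<le> 2 * (t powr (- (\<alpha> / \<beta>)) + 1)" unfolding pow by simp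
    qed (use c0 in simp)
    finally show ?thesis by (simp add: mult_ac)
  qed
  thus ?thesis using c0 by (intro that[of "2 * c"]) auto
qed

lemma A_pow_T_clin:
  assumes "0 < t"
  shows "bounded_clinear (A_pow_T t)"
proof -
  obtain C where C: "0 \<le> C" "\<And>t x. 0 < t \<Longrightarrow> norm (A_pow_T t x) \<le> C * (t powr (- (\<alpha> / \<beta>)) + 1) * norm x"
    using A_pow_T_norm by blast
  have t: "0 \<le> t" using assms by simp
  have R1: "bounded_clinear (R 1)" by (intro R_clin) simp
  show ?thesis
  proof (rule bounded_clinearI[OF _ _ C(2)[OF assms]])
    show "A_pow_T t (x + y) = A_pow_T t x + A_pow_T t y" for x y
      by (rule R_1_injective)
        (simp add: bounded_clinear_add[OF R1] R_A_pow_T[OF assms] bounded_clinear_add[OF T_clin[OF t]]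
          bounded_clinear_add[OF balakrishnan_reg_clin[OF \<alpha>]])
    show "A_pow_T t (c *\<^sub>C x) = c *\<^sub>C A_pow_T t x" for c x
      by (rule R_1_injective)
        (simp add: bounded_clinear_scaleC[OF R1] R_A_pow_T[OF assms] bounded_clinear_scaleC[OF T_clin[OF t]]
          bounded_clinear_scaleC[OF balakrishnan_reg_clin[OF \<alpha>]])
  qed
qed

lemma A_pow_T_add:
  assumes "0 < a" "0 < t"
  shows "A_pow_T (a + t) x = A_pow_T a (T t x)"
  by (rule R_1_injective) (use assms in \<open>simp add: R_A_pow_T T_add\<close>)

lemma A_pow_T_continuous: "continuous_on {0<..} (\<lambda>t. A_pow_T t x)"
  unfolding continuous_on_eq_continuous_at[OF open_greaterThan]
proof
  fix s :: real assume "s \<in> {0<..}"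
  hence s: "0 < s / 2" by simp
  have "continuous_on {s / 2<..} (\<lambda>t. A_pow_T (s / 2) (T (t - s / 2) x))"
    by (intro bounded_linear.continuous_on[OF bounded_clinear_imp_bounded_linear[OF A_pow_T_clin[OF s]]]
        continuous_on_compose2[OF T_continuous] continuous_intros) auto
  hence "continuous_on {s / 2<..} (\<lambda>t. A_pow_T t x)"
    by (rule continuous_on_eq) (use s A_pow_T_add[of "s / 2"] in \<open>simp flip: A_pow_T_add\<close>)
  thus "isCont (\<lambda>t. A_pow_T t x) s"
    using s by (simp add: continuous_on_eq_continuous_at)
qed

lemma R_A_pow_R:
  assumes "0 < Re z"
  shows "R 1 (A_pow_R z x) = balakrishnan_reg \<alpha> (R z x)"
proof -
  have "R 1 (R z x + (x - z *\<^sub>C R z x)) = R z x"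
    using R_left_inverse[OF _ R_in_domain[OF assms], of 1] by simp
  moreover have "x + (1 - z) *\<^sub>C R z x = R z x + (x - z *\<^sub>C R z x)"
    by (simp add: scaleC_diff_left)
  ultimately show ?thesis
    unfolding A_pow_R_def using balakrishnan_reg_R[OF \<alpha>, of 1] by (simp only: one_complex.sel zero_less_one)
qed

lemma A_pow_R_clin:
  assumes "0 < Re z"
  shows "bounded_clinear (A_pow_R z)"
proof -
  note b = balakrishnan_reg_clin[OF \<alpha>]
  define M where "M = onorm (balakrishnan_reg \<alpha>) * (1 + cmod (1 - z) * (K / Re z))"
  show ?thesis
  proof (rule bounded_clinearI[where M = M])
    show "A_pow_R z (x + y) = A_pow_R z x + A_pow_R z y" for x y
      unfolding A_pow_R_def bounded_clinear_add[OF b, symmetric]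
      by (simp add: bounded_clinear_add[OF R_clin[OF assms]] scaleC_add_right add_ac)
    show "A_pow_R z (c *\<^sub>C x) = c *\<^sub>C A_pow_R z x" for c x
      unfolding A_pow_R_def bounded_clinear_scaleC[OF b, symmetric]
      by (simp add: bounded_clinear_scaleC[OF R_clin[OF assms]] scaleC_add_right scaleC_scaleC mult.commute)
    show "norm (A_pow_R z x) \<le> M * norm x" for x
    proof -
      have "norm (x + (1 - z) *\<^sub>C R z x) \<le> norm x + cmod (1 - z) * norm (R z x)"
        by (intro order_trans[OF norm_triangle_ineq]) (simp add: norm_scaleC)
      also have "\<dots> \<le> norm x + cmod (1 - z) * (K / Re z * norm x)"
        by (intro add_left_mono mult_left_mono R_norm assms) simp
      also have "\<dots> = (1 + cmod (1 - z) * (K / Re z)) * norm x" by (simp add: algebra_simps)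
      finally have "onorm (balakrishnan_reg \<alpha>) * norm (x + (1 - z) *\<^sub>C R z x) \<le> M * norm x"
        unfolding M_def mult.assoc using bounded_clinear_onorm_nonneg[OF b] by (intro mult_left_mono)
      thus ?thesis
        unfolding A_pow_R_def by (rule order_trans[OF bounded_clinear_norm[OF b]])
    qed
  qed
qed

lemma A_pow_R_continuous: "continuous_on {z. 0 < Re z} (\<lambda>z. A_pow_R z x)"
  unfolding A_pow_R_def
  by (intro bounded_linear.continuous_on[OF bounded_clinear_imp_bounded_linear[OF balakrishnan_reg_clin[OF \<alpha>]]]
      continuous_intros R_continuous)

lemma A_pow_R_eq_wint:
  assumes z: "0 < Re z"
    and dom: "dominated {0<..} (\<lambda>t. exp (- z * complex_of_real t) *\<^sub>C A_pow_T t x) m"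
  shows "A_pow_R z x = wint {0<..} (\<lambda>t. exp (- z * complex_of_real t) *\<^sub>C A_pow_T t x)"
proof (rule R_1_injective)
  have R1: "bounded_clinear (R 1)" by (intro R_clin) simp
  note b = balakrishnan_reg_clin[OF \<alpha>]
  have "R 1 (wint {0<..} (\<lambda>t. exp (- z * complex_of_real t) *\<^sub>C A_pow_T t x))
      = wint {0<..} (\<lambda>t. balakrishnan_reg \<alpha> (exp (- z * complex_of_real t) *\<^sub>C T t x))"
    unfolding bounded_clinear_wint[OF R1 dom]
    by (rule wint_cong) (simp add: bounded_clinear_scaleC[OF R1] R_A_pow_T bounded_clinear_scaleC[OF b])
  also have "\<dots> = balakrishnan_reg \<alpha> (R z x)"
    unfolding R_def by (rule bounded_clinear_wint[OF b dominated_R[OF z], symmetric])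
  finally show "R 1 (A_pow_R z x) = R 1 (wint {0<..} (\<lambda>t. exp (- z * complex_of_real t) *\<^sub>C A_pow_T t x))"
    by (simp add: R_A_pow_R[OF z])
qed

end

end

section \<open>Integral bounds along vertical lines\<close>

text \<open>
  The constant in the bound below for Laplace transforms on vertical lines. The Gamma value stems from the
  integral of \<open>t\<^sup>-\<^sup>2\<^sup>p e\<^sup>-\<^sup>t\<close> over \<open>t > 0\<close>.
\<close>

definition laplace_const :: "real \<Rightarrow> real" where
  "laplace_const p = 2 * pi * (2 * 2 powr (2 * p - 1) * Gamma (1 - 2 * p) + 1)"

lemma laplace_const_nonneg: "p < 1 / 2 \<Longrightarrow> 0 \<le> laplace_const p"
  using Gamma_real_pos[of "1 - 2 * p"] unfolding laplace_const_def by simp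

lemma dominated_laplace:
  fixes g :: "real \<Rightarrow> 'h::complex_hilbert_space"
  assumes g: "continuous_on {0<..} g" "\<And>t. 0 < t \<Longrightarrow> norm (g t) \<le> B * (t powr (- p) + 1)"
    and p: "p < 1" and z: "0 < Re z"
  shows "dominated {0<..} (\<lambda>t. exp (- z * complex_of_real t) *\<^sub>C g t)
      (\<lambda>t. B * (t powr (- p) * exp (- Re z * t) + exp (- Re z * t)))"
proof -
  have "norm (exp (- z * complex_of_real t) *\<^sub>C g t) \<le> B * (t powr (- p) * exp (- Re z * t) + exp (- Re z * t))"
    if "0 < t" for t
    using mult_left_mono[OF g(2)[OF that], of "exp (- Re z * t)"]
    by (simp add: norm_scaleC algebra_simps)
  moreover have "set_integrable lborel {0<..} (\<lambda>t. B * (t powr (- p) * exp (- Re z * t) + exp (- Re z * t)))"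
    using lint_powr_exp(1)[OF z p] lint_exp_Ioi(1)[OF z]
    by (intro set_integrable_mult_right set_integral_add) auto
  ultimately show ?thesis
    unfolding dominated_def by (auto intro!: continuous_intros g(1))
qed

lemma plancherel_laplace:
  fixes g :: "real \<Rightarrow> 'h::complex_hilbert_space"
  assumes g: "continuous_on {0<..} g" "\<And>t. 0 < t \<Longrightarrow> norm (g t) \<le> B * (t powr (- p) + 1)"
    and p: "p < 1 / 2" and \<xi>: "0 < \<xi>"
  shows "(\<lambda>\<eta>. norm (wint {0<..} (\<lambda>t. exp (- Complex \<xi> (- \<eta>) * complex_of_real t) *\<^sub>C g t))) \<in> borel_measurable borel"
    and "(\<integral>\<^sup>+\<eta>. ennreal ((norm (wint {0<..} (\<lambda>t. exp (- Complex \<xi> (- \<eta>) * complex_of_real t) *\<^sub>C g t)))\<^sup>2) \<partial>lborel)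
      \<le> ennreal (laplace_const p * B\<^sup>2 * (\<xi> powr (2 * p - 1) + 1 / \<xi>))"
proof -
  have p_less_1: "p < 1" using p by simp
  define m where "m t = B * (t powr (- p) * exp (- \<xi> * t) + exp (- \<xi> * t))" for t
  define M where "M t = 2 * B\<^sup>2 * (t powr (- (2 * p)) * exp (- (2 * \<xi>) * t) + exp (- (2 * \<xi>) * t))" for t
  have d: "dominated {0<..} (\<lambda>t. exp (- complex_of_real \<xi> * complex_of_real t) *\<^sub>C g t) m"
    unfolding m_def using dominated_laplace[OF g p_less_1, of "complex_of_real \<xi>"] \<xi> by simp
  have mM: "(m t)\<^sup>2 \<le> M t" for t
  proof -
    have "(t powr (- p) + 1)\<^sup>2 \<le> 2 * ((t powr (- p))\<^sup>2 + 1)"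
      using sum_squares_bound[of "t powr (- p)" 1] by (simp add: power2_sum)
    also have "(t powr (- p))\<^sup>2 = t powr (- (2 * p))"
      by (simp add: power2_eq_square powr_add[symmetric])
    finally have "B\<^sup>2 * (exp (- \<xi> * t))\<^sup>2 * (t powr (- p) + 1)\<^sup>2
        \<le> B\<^sup>2 * (exp (- \<xi> * t))\<^sup>2 * (2 * (t powr (- (2 * p)) + 1))"
      by (intro mult_left_mono) auto
    moreover have "(exp (- \<xi> * t))\<^sup>2 = exp (- (2 * \<xi>) * t)"
      by (simp add: power2_eq_square flip: exp_add)
    moreover have "m t = B * exp (- \<xi> * t) * (t powr (- p) + 1)"
      unfolding m_def by (simp add: algebra_simps)
    ultimately show ?thesis
      unfolding M_def by (simp only: power_mult_distrib) (simp add: algebra_simps)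
  qed
  have M: "set_integrable lborel {0<..} M"
    "(LINT t:{0<..}|lborel. M t) = 2 * B\<^sup>2 * ((2 * \<xi>) powr (2 * p - 1) * Gamma (1 - 2 * p) + 1 / (2 * \<xi>))"
  proof -
    note L = lint_powr_exp[of "2 * \<xi>" "2 * p"] lint_exp_Ioi[of "2 * \<xi>"]
    have 1: "set_integrable lborel {0<..} (\<lambda>t. t powr (- (2 * p)) * exp (- (2 * \<xi>) * t))"
      "set_integrable lborel {0<..} (\<lambda>t. exp (- (2 * \<xi>) * t))"
      using L(1,3) \<xi> p by auto
    show "set_integrable lborel {0<..} M"
      unfolding M_def by (intro set_integrable_mult_right set_integral_add(1) 1)
    show "(LINT t:{0<..}|lborel. M t) = 2 * B\<^sup>2 * ((2 * \<xi>) powr (2 * p - 1) * Gamma (1 - 2 * p) + 1 / (2 * \<xi>))"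
      unfolding M_def set_integral_mult_right set_integral_add(2)[OF 1]
      using L(2,4) \<xi> p by simp
  qed
  have m2: "set_integrable lborel {0<..} (\<lambda>t. (m t)\<^sup>2)"
    by (rule set_integrable_dominated[OF _ _ M(1)])
      (use mM in \<open>auto simp: m_def intro!: continuous_intros\<close>)
  have "(LINT t:{0<..}|lborel. (m t)\<^sup>2) \<le> (LINT t:{0<..}|lborel. M t)"
    by (intro set_integral_mono m2 M(1) mM)
  also have "\<dots> = B\<^sup>2 * (2 * (2 powr (2 * p - 1) * \<xi> powr (2 * p - 1)) * Gamma (1 - 2 * p) + 1 / \<xi>)"
    unfolding M(2) using \<xi> by (simp add: powr_mult algebra_simps)
  finally have "2 * pi * (LINT t:{0<..}|lborel. (m t)\<^sup>2)
      \<le> 2 * pi * (B\<^sup>2 * (2 * (2 powr (2 * p - 1) * \<xi> powr (2 * p - 1)) * Gamma (1 - 2 * p) + 1 / \<xi>))"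
    by (intro mult_left_mono) auto
  also have "\<dots> \<le> laplace_const p * B\<^sup>2 * (\<xi> powr (2 * p - 1) + 1 / \<xi>)"
  proof -
    define G where "G = 2 * 2 powr (2 * p - 1) * Gamma (1 - 2 * p)"
    have "0 \<le> G" unfolding G_def using p Gamma_real_pos[of "1 - 2 * p"] by simp
    hence "G * X + Y \<le> (G + 1) * (X + Y)"
      if "0 \<le> X" "0 \<le> Y" for X Y
      using that by (simp add: algebra_simps)
    from this[of "\<xi> powr (2 * p - 1)" "1 / \<xi>"]
    have "2 * pi * B\<^sup>2 * (G * \<xi> powr (2 * p - 1) + 1 / \<xi>)
        \<le> 2 * pi * B\<^sup>2 * ((G + 1) * (\<xi> powr (2 * p - 1) + 1 / \<xi>))"
      using \<xi> by (intro mult_left_mono) auto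
    moreover have "laplace_const p * B\<^sup>2 = 2 * pi * B\<^sup>2 * (G + 1)"
      unfolding laplace_const_def G_def by (simp add: mult_ac)
    moreover have "2 * (2 powr (2 * p - 1) * \<xi> powr (2 * p - 1)) * Gamma (1 - 2 * p) = G * \<xi> powr (2 * p - 1)"
      unfolding G_def by simp
    ultimately show ?thesis by (simp only: mult.assoc)
  qed
  finally have le: "2 * pi * (LINT t:{0<..}|lborel. (m t)\<^sup>2) \<le> laplace_const p * B\<^sup>2 * (\<xi> powr (2 * p - 1) + 1 / \<xi>)" .
  have eq: "exp (\<i> * complex_of_real (\<eta> * t)) *\<^sub>C exp (- complex_of_real \<xi> * complex_of_real t) *\<^sub>C g t
      = exp (- Complex \<xi> (- \<eta>) * complex_of_real t) *\<^sub>C g t" for \<eta> t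
    unfolding scaleC_scaleC exp_add[symmetric] Complex_eq
    by (intro arg_cong2[where f = scaleC] arg_cong[where f = exp] refl) (simp add: algebra_simps)
  note Pl = plancherel_inequality[OF d m2, unfolded eq]
  show "(\<lambda>\<eta>. norm (wint {0<..} (\<lambda>t. exp (- Complex \<xi> (- \<eta>) * complex_of_real t) *\<^sub>C g t))) \<in> borel_measurable borel"
    by (rule Pl(1))
  show "(\<integral>\<^sup>+\<eta>. ennreal ((norm (wint {0<..} (\<lambda>t. exp (- Complex \<xi> (- \<eta>) * complex_of_real t) *\<^sub>C g t)))\<^sup>2) \<partial>lborel)
    \<le> ennreal (laplace_const p * B\<^sup>2 * (\<xi> powr (2 * p - 1) + 1 / \<xi>))"
    by (rule order_trans[OF Pl(2) ennreal_leI[OF le]])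
qed

lemma powr_le_B0_weight:
  assumes "0 \<le> p" "p \<le> q" "0 < \<xi>"
  shows "\<xi> powr (2 * p) + 1 \<le> 2 * (B0_weight q \<xi>)\<^sup>2"
proof (cases "\<xi> < 1")
  case True
  hence "\<xi> powr (2 * p) \<le> 1" using assms by (intro powr_le1) auto
  thus ?thesis using True by (simp add: B0_weight_def)
next
  case False
  hence "\<xi> powr (2 * p) \<le> \<xi> powr (2 * q)" "1 \<le> \<xi> powr (2 * q)"
    using assms by (auto intro: powr_mono ge_one_powr_ge_zero)
  moreover have "(B0_weight q \<xi>)\<^sup>2 = \<xi> powr (2 * q)"
    using False by (simp add: B0_weight_def power2_eq_square flip: powr_add)
  ultimately show ?thesis by simp
qed

lemma ennreal_le_of_square_le:
  fixes a :: ennreal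
  assumes "a\<^sup>2 \<le> ennreal (b\<^sup>2)" "0 \<le> b"
  shows "a \<le> ennreal b"
proof (cases a)
  case (real r)
  hence "r\<^sup>2 \<le> b\<^sup>2" using assms by (simp add: ennreal_power)
  hence "r \<le> b" using assms(2) by (rule power2_le_imp_le)
  thus ?thesis using real by (simp add: ennreal_leI)
next
  case top
  thus ?thesis using assms(1) by (simp add: power2_eq_square top_unique)
qed

context bdd_diff_semigroup
begin

lemma R_comp_continuous:
  assumes "continuous_on {z. 0 < Re z} F"
  shows "continuous_on {z. 0 < Re z} (\<lambda>z. R z (F z))"
  unfolding continuous_on_def
proof
  fix w assume "w \<in> {z. 0 < Re z}"
  hence w: "0 < Re w" by simp
  let ?F = "at w within {z. 0 < Re z}"
  have F: "((\<lambda>z. F z) \<longlongrightarrow> F w) ?F" and R: "((\<lambda>z. R z (F w)) \<longlongrightarrow> R w (F w)) ?F"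
    using assms R_continuous w unfolding continuous_on_def by auto
  have "((\<lambda>z. K / Re z * norm (F z - F w)) \<longlongrightarrow> K / Re w * norm (F w - F w)) ?F"
    using w by (intro tendsto_intros F) auto
  hence lim: "((\<lambda>z. K / Re z * norm (F z - F w)) \<longlongrightarrow> 0) ?F" by simp
  have "((\<lambda>z. R z (F z - F w)) \<longlongrightarrow> 0) ?F"
  proof (rule Lim_null_comparison[OF _ lim])
    show "\<forall>\<^sub>F z in ?F. norm (R z (F z - F w)) \<le> K / Re z * norm (F z - F w)"
      unfolding eventually_at_filter using R_norm by (intro always_eventually) blast
  qed
  hence "((\<lambda>z. R z (F z - F w) + R z (F w)) \<longlongrightarrow> 0 + R w (F w)) ?F"
    by (rule tendsto_add[OF _ R])
  moreover have "\<forall>\<^sub>F z in ?F. R z (F z - F w) + R z (F w) = R z (F z)"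
    by (auto simp: eventually_at_filter bounded_clinear_diff[OF R_clin] intro!: always_eventually)
  ultimately show "((\<lambda>z. R z (F z)) \<longlongrightarrow> R w (F w)) ?F"
    by (simp add: tendsto_cong)
qed

end

context crandall_pazy_semigroup
begin

lemma adj_R_eq_wint:
  assumes "0 < Re z"
  shows "wint {0<..} (\<lambda>t. exp (- cnj z * complex_of_real t) *\<^sub>C adj (T t) y) = adj (R z) y"
proof (rule wint_eqI)
  fix x
  have "cinner (adj (R z) y) x = cnj (cinner (R z x) y)"
    unfolding cinner_adj'[OF R_clin[OF assms]] by (rule cinner_commute)
  also have "\<dots> = (LINT t:{0<..}|lborel. cnj (cinner (exp (- z * complex_of_real t) *\<^sub>C T t x) y))"
    unfolding R_def cinner_wint[OF dominated_R[OF assms]] set_lebesgue_integral_def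
    by (simp flip: Bochner_Integration.integral_cnj)
  also have "\<dots> = (LINT t:{0<..}|lborel. cinner (exp (- cnj z * complex_of_real t) *\<^sub>C adj (T t) y) x)"
    unfolding set_lebesgue_integral_def
  proof (intro Bochner_Integration.integral_cong refl)
    fix t :: real
    have "cnj (cinner (exp (- z * complex_of_real t) *\<^sub>C T t x) y)
        = cinner (exp (- cnj z * complex_of_real t) *\<^sub>C adj (T t) y) x" if "0 < t"
      using that cinner_commute[of "T t x" y]
      by (simp add: cinner_scaleC_left exp_cnj cinner_adj'[OF T_clin])
    thus "indicator {0<..} t *\<^sub>R cnj (cinner (exp (- z * complex_of_real t) *\<^sub>C T t x) y)
        = indicator {0<..} t *\<^sub>R cinner (exp (- cnj z * complex_of_real t) *\<^sub>C adj (T t) y) x"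
      by (auto simp: indicator_def)
  qed
  finally show "cinner (adj (R z) y) x = (LINT t:{0<..}|lborel. cinner (exp (- cnj z * complex_of_real t) *\<^sub>C adj (T t) y) x)" .
qed

text \<open>
  The Cauchy-Schwarz inequality, with the Plancherel inequality applied to \<open>G(t) x\<close> and to \<open>T(t)\<^sup>* y\<close>.
\<close>

lemma R_comp_vertical_bound:
  assumes p: "0 \<le> p" "p \<le> q" "q < 1 / 2"
    and G_cont: "\<And>x. continuous_on {0<..} (\<lambda>t. G t x)"
    and G_norm: "\<And>t x. 0 < t \<Longrightarrow> norm (G t x) \<le> B * (t powr (- p) + 1) * norm x" and "0 \<le> B"
    and F: "\<And>z x m. 0 < Re z \<Longrightarrow> dominated {0<..} (\<lambda>t. exp (- z * complex_of_real t) *\<^sub>C G t x) m \<Longrightarrow>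
      F z x = wint {0<..} (\<lambda>t. exp (- z * complex_of_real t) *\<^sub>C G t x)"
  shows "\<exists>E\<ge>0. \<forall>\<xi> x y. 0 < \<xi> \<longrightarrow>
    (\<integral>\<^sup>+\<eta>. ennreal (cmod (cinner (R (Complex \<xi> (- \<eta>)) (F (Complex \<xi> (- \<eta>)) x)) y)) \<partial>lborel)
      \<le> ennreal (E * (B0_weight q \<xi> / \<xi>) * norm x * norm y)"
proof -
  have p1: "p < 1" and p2: "p < 1 / 2" and p0: "(0::real) < 1 / 2" using p by simp_all
  define C1 where "C1 = laplace_const p"
  define C2 where "C2 = laplace_const 0"
  have C1: "0 \<le> C1" and C2: "0 \<le> C2"
    unfolding C1_def C2_def by (intro laplace_const_nonneg p2 p0)+
  define E where "E = sqrt (C1 * C2) * B * K"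
  have E0: "0 \<le> E" unfolding E_def using C1 C2 \<open>0 \<le> B\<close> K_ge_1 by simp
  have "(\<integral>\<^sup>+\<eta>. ennreal (cmod (cinner (R (Complex \<xi> (- \<eta>)) (F (Complex \<xi> (- \<eta>)) x)) y)) \<partial>lborel)
      \<le> ennreal (E * (B0_weight q \<xi> / \<xi>) * norm x * norm y)" if \<xi>: "0 < \<xi>" for \<xi> x y
  proof -
    define a where "a \<eta> = norm (F (Complex \<xi> (- \<eta>)) x)" for \<eta>
    define b where "b \<eta> = norm (adj (R (Complex \<xi> (- \<eta>))) y)" for \<eta>
    have G: "norm (G t x) \<le> (B * norm x) * (t powr (- p) + 1)" if "0 < t" for t
      using G_norm[OF that, of x] by (simp add: mult_ac)
    have a_eq: "a = (\<lambda>\<eta>. norm (wint {0<..} (\<lambda>t. exp (- Complex \<xi> (- \<eta>) * complex_of_real t) *\<^sub>C G t x)))"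
    proof
      fix \<eta>
      have z: "0 < Re (Complex \<xi> (- \<eta>))" using \<xi> by simp
      have "dominated {0<..} (\<lambda>t. exp (- Complex \<xi> (- \<eta>) * complex_of_real t) *\<^sub>C G t x)
          (\<lambda>t. B * norm x * (t powr (- p) * exp (- Re (Complex \<xi> (- \<eta>)) * t) + exp (- Re (Complex \<xi> (- \<eta>)) * t)))"
        by (rule dominated_laplace[OF G_cont G p1 z])
      from F[OF z this] show "a \<eta> = norm (wint {0<..} (\<lambda>t. exp (- Complex \<xi> (- \<eta>) * complex_of_real t) *\<^sub>C G t x))"
        unfolding a_def by simp
    qed
    have a_meas: "a \<in> borel_measurable borel"
      unfolding a_eq by (rule plancherel_laplace(1)[OF G_cont G p2 \<xi>])
    have a_int: "(\<integral>\<^sup>+\<eta>. ennreal ((a \<eta>)\<^sup>2) \<partial>lborel) \<le> ennreal (C1 * (B * norm x)\<^sup>2 * (\<xi> powr (2 * p - 1) + 1 / \<xi>))"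
      unfolding a_eq C1_def by (rule plancherel_laplace(2)[OF G_cont G p2 \<xi>])
    \<comment> \<open>the case of exponent 0, where \<open>t powr 0 + 1 = 2\<close>\<close>
    have adj: "norm (adj (T t) y) \<le> (K * norm y / 2) * (t powr (- 0) + 1)" if "0 < t" for t
      using adj_T_norm[of t y] that by simp
    define b' where "b' \<eta> = norm (wint {0<..} (\<lambda>t. exp (- Complex \<xi> (- \<eta>) * complex_of_real t) *\<^sub>C adj (T t) y))" for \<eta>
    \<comment> \<open>taking adjoints conjugates the point on the line, so \<open>\<eta>\<close> has to be reflected\<close>
    have b_eq: "b \<eta> = b' (0 + (-1) * \<eta>)" for \<eta>
    proof -
      have z: "0 < Re (Complex \<xi> (- \<eta>))" using \<xi> by simp
      show ?thesis unfolding b_def b'_def adj_R_eq_wint[OF z, symmetric] by (simp add: complex_cnj)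
    qed
    have b'_meas: "b' \<in> borel_measurable borel"
      unfolding b'_def by (rule plancherel_laplace(1)[OF adj_T_continuous adj p0 \<xi>])
    have b_meas: "b \<in> borel_measurable borel"
      unfolding b_eq[abs_def] using b'_meas by measurable
    have "(\<integral>\<^sup>+\<eta>. ennreal ((b \<eta>)\<^sup>2) \<partial>lborel) = (\<integral>\<^sup>+\<eta>. ennreal ((b' \<eta>)\<^sup>2) \<partial>lborel)"
      unfolding b_eq using nn_integral_real_affine[of "\<lambda>\<eta>. ennreal ((b' \<eta>)\<^sup>2)" "-1" 0] b'_meas by simp
    also have "\<dots> \<le> ennreal (C2 * (K * norm y / 2)\<^sup>2 * (\<xi> powr (2 * 0 - 1) + 1 / \<xi>))"
      unfolding b'_def C2_def by (rule plancherel_laplace(2)[OF adj_T_continuous adj p0 \<xi>])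
    finally have b_int: "(\<integral>\<^sup>+\<eta>. ennreal ((b \<eta>)\<^sup>2) \<partial>lborel) \<le> ennreal (C2 * (K * norm y / 2)\<^sup>2 * (2 / \<xi>))"
      using \<xi> by (simp add: powr_minus_divide)
    have "(\<integral>\<^sup>+\<eta>. ennreal (cmod (cinner (R (Complex \<xi> (- \<eta>)) (F (Complex \<xi> (- \<eta>)) x)) y)) \<partial>lborel)
        \<le> (\<integral>\<^sup>+\<eta>. ennreal (a \<eta>) * ennreal (b \<eta>) \<partial>lborel)"
    proof (intro nn_integral_mono)
      fix \<eta>
      have z: "0 < Re (Complex \<xi> (- \<eta>))" using \<xi> by simp
      have "cmod (cinner (R (Complex \<xi> (- \<eta>)) (F (Complex \<xi> (- \<eta>)) x)) y) \<le> a \<eta> * b \<eta>"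
        unfolding cinner_adj[OF R_clin[OF z], symmetric] a_def b_def by (rule cinner_cauchy_schwarz)
      thus "ennreal (cmod (cinner (R (Complex \<xi> (- \<eta>)) (F (Complex \<xi> (- \<eta>)) x)) y)) \<le> ennreal (a \<eta>) * ennreal (b \<eta>)"
        by (simp add: ennreal_leI a_def flip: ennreal_mult')
    qed
    also have "\<dots> \<le> ennreal (E * (B0_weight q \<xi> / \<xi>) * norm x * norm y)"
    proof (rule ennreal_le_of_square_le)
      have "(\<integral>\<^sup>+\<eta>. ennreal (a \<eta>) * ennreal (b \<eta>) \<partial>lborel)\<^sup>2
          \<le> (\<integral>\<^sup>+\<eta>. (ennreal (a \<eta>))\<^sup>2 \<partial>lborel) * (\<integral>\<^sup>+\<eta>. (ennreal (b \<eta>))\<^sup>2 \<partial>lborel)"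
        using a_meas b_meas by (intro Cauchy_Schwarz_nn_integral) auto
      also have "\<dots> = (\<integral>\<^sup>+\<eta>. ennreal ((a \<eta>)\<^sup>2) \<partial>lborel) * (\<integral>\<^sup>+\<eta>. ennreal ((b \<eta>)\<^sup>2) \<partial>lborel)"
        by (simp add: ennreal_power a_def b_def)
      also have "\<dots> \<le> ennreal (C1 * (B * norm x)\<^sup>2 * (\<xi> powr (2 * p - 1) + 1 / \<xi>)) * ennreal (C2 * (K * norm y / 2)\<^sup>2 * (2 / \<xi>))"
        by (intro mult_mono a_int b_int) auto
      also have "\<dots> = ennreal ((C1 * (B * norm x)\<^sup>2 * (\<xi> powr (2 * p - 1) + 1 / \<xi>)) * (C2 * (K * norm y / 2)\<^sup>2 * (2 / \<xi>)))"
        using C2 \<xi> by (intro ennreal_mult''[symmetric]) auto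
      also have "\<dots> \<le> ennreal ((E * (B0_weight q \<xi> / \<xi>) * norm x * norm y)\<^sup>2)"
      proof (rule ennreal_leI)
        have "\<xi> powr (2 * p - 1) + 1 / \<xi> = (\<xi> powr (2 * p) + 1) / \<xi>"
          using \<xi> by (simp add: powr_diff add_divide_distrib)
        hence "(C1 * (B * norm x)\<^sup>2 * (\<xi> powr (2 * p - 1) + 1 / \<xi>)) * (C2 * (K * norm y / 2)\<^sup>2 * (2 / \<xi>))
            = (C1 * C2 * B\<^sup>2 * K\<^sup>2 * (norm x)\<^sup>2 * (norm y)\<^sup>2 / (2 * \<xi>\<^sup>2)) * (\<xi> powr (2 * p) + 1)"
          using \<xi> by (simp add: power_mult_distrib power_divide power2_eq_square field_simps)
        also have "\<dots> \<le> (C1 * C2 * B\<^sup>2 * K\<^sup>2 * (norm x)\<^sup>2 * (norm y)\<^sup>2 / (2 * \<xi>\<^sup>2)) * (2 * (B0_weight q \<xi>)\<^sup>2)"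
          using C1 C2 powr_le_B0_weight[OF p(1,2) \<xi>] by (intro mult_left_mono) auto
        also have "\<dots> = C1 * C2 * B\<^sup>2 * K\<^sup>2 * (norm x)\<^sup>2 * (norm y)\<^sup>2 * (B0_weight q \<xi>)\<^sup>2 / \<xi>\<^sup>2"
          by simp
        also have "\<dots> = (E * (B0_weight q \<xi> / \<xi>) * norm x * norm y)\<^sup>2"
          unfolding E_def using C1 C2 by (simp add: power_mult_distrib power_divide)
        finally show "(C1 * (B * norm x)\<^sup>2 * (\<xi> powr (2 * p - 1) + 1 / \<xi>)) * (C2 * (K * norm y / 2)\<^sup>2 * (2 / \<xi>))
            \<le> (E * (B0_weight q \<xi> / \<xi>) * norm x * norm y)\<^sup>2" .
      qed
      finally show "(\<integral>\<^sup>+\<eta>. ennreal (a \<eta>) * ennreal (b \<eta>) \<partial>lborel)\<^sup>2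
          \<le> ennreal ((E * (B0_weight q \<xi> / \<xi>) * norm x * norm y)\<^sup>2)" .
      show "0 \<le> E * (B0_weight q \<xi> / \<xi>) * norm x * norm y"
        using E0 \<xi> by (simp add: B0_weight_def)
    qed
    finally show ?thesis .
  qed
  thus ?thesis using E0 by blast
qed

end

section \<open>The sesquilinear forms of the functional calculus\<close>

text \<open>The supremum over a countable dense set makes \<^const>\<open>sup_deriv\<close> measurable.\<close>

lemma sup_deriv_eq_rats:
  assumes "f holomorphic_on {z. 0 < Re z}" "0 < \<xi>"
  shows "sup_deriv f \<xi> = (SUP r \<in> (\<rat> :: real set). ennreal (norm (deriv f (Complex \<xi> r))))"
proof (rule antisym)
  show "(SUP r \<in> (\<rat> :: real set). ennreal (norm (deriv f (Complex \<xi> r)))) \<le> sup_deriv f \<xi>"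
    unfolding sup_deriv_def by (rule SUP_subset_mono) auto
  have cont: "continuous_on UNIV (\<lambda>\<eta>. deriv f (Complex \<xi> \<eta>))"
    by (rule continuous_on_compose2[OF holomorphic_on_imp_continuous_on[OF holomorphic_deriv[OF assms(1) open_halfspace_Re_gt]]])
      (auto simp: Complex_eq assms(2) intro!: continuous_intros)
  show "sup_deriv f \<xi> \<le> (SUP r \<in> (\<rat> :: real set). ennreal (norm (deriv f (Complex \<xi> r))))"
    unfolding sup_deriv_def
  proof (rule SUP_least)
    fix \<eta> :: real
    have "\<exists>r\<in>\<rat>. \<eta> < r \<and> r < \<eta> + 1 / real (Suc n)" for n
      by (intro Rats_dense_in_real) simp
    then obtain r where r: "\<And>n. r n \<in> \<rat>" "\<And>n. \<eta> < r n" "\<And>n. r n < \<eta> + 1 / real (Suc n)" by metis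
    have "(\<lambda>n. \<eta> + 1 / real (Suc n)) \<longlonglongrightarrow> \<eta> + 0"
      by (intro tendsto_intros LIMSEQ_Suc lim_1_over_n)
    hence "r \<longlonglongrightarrow> \<eta>"
      using r(2,3) by (intro tendsto_sandwich[of "\<lambda>_. \<eta>" r _ "\<lambda>n. \<eta> + 1 / real (Suc n)"]) (auto intro!: always_eventually less_imp_le)
    hence "(\<lambda>n. deriv f (Complex \<xi> (r n))) \<longlonglongrightarrow> deriv f (Complex \<xi> \<eta>)"
      by (rule continuous_on_tendsto_compose[OF cont]) auto
    hence "(\<lambda>n. ennreal (norm (deriv f (Complex \<xi> (r n))))) \<longlonglongrightarrow> ennreal (norm (deriv f (Complex \<xi> \<eta>)))"
      by (intro tendsto_ennrealI tendsto_norm)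
    thus "ennreal (norm (deriv f (Complex \<xi> \<eta>))) \<le> (SUP r \<in> (\<rat> :: real set). ennreal (norm (deriv f (Complex \<xi> r))))"
      by (rule LIMSEQ_le_const2) (intro exI[of _ 0] allI impI SUP_upper r(1))
  qed
qed

lemma sup_deriv_measurable:
  assumes "f holomorphic_on {z. 0 < Re z}"
  shows "(\<lambda>\<xi>. sup_deriv f \<xi> * indicator {0<..} \<xi>) \<in> borel_measurable borel"
proof -
  have meas: "(\<lambda>\<xi>. indicator {0<..} \<xi> *\<^sub>R deriv f (Complex \<xi> r)) \<in> borel_measurable borel" for r
  proof (rule borel_measurable_continuous_on_indicator)
    show "continuous_on {0<..} (\<lambda>\<xi>. deriv f (Complex \<xi> r))"
      by (rule continuous_on_compose2[OF holomorphic_on_imp_continuous_on[OF holomorphic_deriv[OF assms open_halfspace_Re_gt]]])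
        (auto simp: Complex_eq intro!: continuous_intros)
  qed simp
  have "(\<lambda>\<xi>. SUP r \<in> (\<rat> :: real set). ennreal (norm (indicator {0<..} \<xi> *\<^sub>R deriv f (Complex \<xi> r)))) \<in> borel_measurable borel"
    by (intro borel_measurable_SUP countable_rat 
        measurable_compose[OF measurable_compose[OF meas borel_measurable_norm] measurable_ennreal])
  moreover have "(\<lambda>\<xi>. sup_deriv f \<xi> * indicator {0<..} \<xi>)
      = (\<lambda>\<xi>. SUP r \<in> (\<rat> :: real set). ennreal (norm (indicator {0<..} \<xi> *\<^sub>R deriv f (Complex \<xi> r))))"
  proof
    fix \<xi> :: real
    show "sup_deriv f \<xi> * indicator {0<..} \<xi>
        = (SUP r \<in> (\<rat> :: real set). ennreal (norm (indicator {0<..} \<xi> *\<^sub>R deriv f (Complex \<xi> r))))"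
    proof (cases "0 < \<xi>")
      case False
      have "(\<rat> :: real set) \<noteq> {}" using Rats_0 by blast
      thus ?thesis using False by simp
    qed (simp add: sup_deriv_eq_rats[OF assms])
  qed
  ultimately show ?thesis by simp
qed

text \<open>
  The form of the \<open>\<B>\<close>-calculus, with the squared resolvent replaced by an operator-valued function \<open>V\<close> and
  without the term at infinity. Note that \<open>V\<close> is evaluated at the conjugate of the argument of \<open>f'\<close>.
\<close>

definition vertical_form ::
    "(complex \<Rightarrow> 'h \<Rightarrow> 'h) \<Rightarrow> (complex \<Rightarrow> complex) \<Rightarrow> 'h::complex_hilbert_space \<Rightarrow> 'h \<Rightarrow> complex" where
  "vertical_form V f x y = - complex_of_real (2 / pi) *
     (LINT \<xi>:{0<..}|lborel. complex_of_real \<xi> *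
       (LINT \<eta>|lborel. cinner (V (Complex \<xi> (- \<eta>)) x) y * deriv f (Complex \<xi> \<eta>)))"

lemma vertical_form_cong:
  assumes "\<And>z. 0 < Re z \<Longrightarrow> cinner (V z x) y = cinner (W z x') y'"
  shows "vertical_form V f x y = vertical_form W f x' y'"
proof -
  have eq: "indicator {0<..} \<xi> *\<^sub>R (complex_of_real \<xi> * (LINT \<eta>|lborel. cinner (V (Complex \<xi> (- \<eta>)) x) y * deriv f (Complex \<xi> \<eta>)))
      = indicator {0<..} \<xi> *\<^sub>R (complex_of_real \<xi> * (LINT \<eta>|lborel. cinner (W (Complex \<xi> (- \<eta>)) x') y' * deriv f (Complex \<xi> \<eta>)))" for \<xi>
    by (cases "0 < \<xi>") (simp_all add: assms)
  show ?thesis unfolding vertical_form_def set_lebesgue_integral_def eq ..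
qed

text \<open>
  The supremum of \<open>f'\<close> on a vertical line may be infinite on a null set of lines, so linearity of the
  inner integral is available almost everywhere only.
\<close>

lemma vertical_form_operator:
  fixes V :: "complex \<Rightarrow> 'h::complex_hilbert_space \<Rightarrow> 'h"
  assumes V_clin: "\<And>z. 0 < Re z \<Longrightarrow> bounded_clinear (V z)"
    and V_cont: "\<And>x. continuous_on {z. 0 < Re z} (\<lambda>z. V z x)"
    and "0 \<le> E"
    and V_bound: "\<And>\<xi> x y. 0 < \<xi> \<Longrightarrow>
      (\<integral>\<^sup>+\<eta>. ennreal (cmod (cinner (V (Complex \<xi> (- \<eta>)) x) y)) \<partial>lborel)
        \<le> ennreal (E * (B0_weight q \<xi> / \<xi>) * norm x * norm y)"
    and f: "f holomorphic_on {z. 0 < Re z}" "B0_norm q f < \<infinity>"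
  shows "\<exists>S. bounded_clinear S \<and> (\<forall>x y. cinner (S x) y = vertical_form V f x y) \<and>
    (\<forall>x. norm (S x) \<le> 2 / pi * E * enn2real (B0_norm q f) * norm x)"
proof -
  define N where "N = enn2real (B0_norm q f)"
  define W where "W \<xi> = ennreal (B0_weight q \<xi>) * (sup_deriv f \<xi> * indicator {0<..} \<xi>)" for \<xi>
  define I where "I \<xi> x y = (LINT \<eta>|lborel. cinner (V (Complex \<xi> (- \<eta>)) x) y * deriv f (Complex \<xi> \<eta>))" for \<xi> x y
  define J where "J x y \<xi> = indicator {0<..} \<xi> *\<^sub>R (complex_of_real \<xi> * I \<xi> x y)" for x y \<xi>
  have weight_pos: "0 < B0_weight q \<xi>" if "0 < \<xi>" for \<xi>
    using that by (simp add: B0_weight_def)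
  have weight_meas [measurable]: "B0_weight q \<in> borel_measurable borel"
    unfolding B0_weight_def[abs_def] by measurable
  have W_meas [measurable]: "W \<in> borel_measurable borel"
    unfolding W_def[abs_def] using sup_deriv_measurable[OF f(1)] by measurable
  have W_int: "(\<integral>\<^sup>+\<xi>. W \<xi> \<partial>lborel) = ennreal N"
  proof -
    have "(\<integral>\<^sup>+\<xi>. W \<xi> \<partial>lborel) = B0_norm q f"
      unfolding W_def B0_norm_def by (simp add: mult.assoc)
    thus ?thesis using f(2) unfolding N_def by simp
  qed
  have AE_finite: "AE \<xi> in lborel. 0 < \<xi> \<longrightarrow> sup_deriv f \<xi> < \<infinity>"
  proof -
    have "AE \<xi> in lborel. W \<xi> \<noteq> \<infinity>"
      by (rule nn_integral_noteq_infinite) (simp_all add: W_int)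
    thus ?thesis
    proof eventually_elim
      case (elim \<xi>)
      show ?case
      proof
        assume \<xi>: "0 < \<xi>"
        show "sup_deriv f \<xi> < \<infinity>"
        proof (rule ccontr)
          assume "\<not> sup_deriv f \<xi> < \<infinity>"
          hence "sup_deriv f \<xi> = top" by (simp add: less_top[symmetric])
          hence "W \<xi> = top" using \<xi> weight_pos[OF \<xi>] by (simp add: W_def ennreal_mult_top)
          thus False using elim by simp
        qed
      qed
    qed
  qed
  have deriv_cont: "continuous_on {z. 0 < Re z} (deriv f)"
    by (intro holomorphic_on_imp_continuous_on holomorphic_deriv f(1) open_halfspace_Re_gt)
  have joint: "(\<lambda>p. indicator ({0<..} \<times> UNIV) p *\<^sub>R
      (cinner (V (Complex (fst p) (- snd p)) x) y * deriv f (Complex (fst p) (snd p)))) \<in> borel_measurable (borel \<Otimes>\<^sub>M borel)" for x y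
    unfolding borel_prod
  proof (rule borel_measurable_continuous_on_indicator)
    show "{0<..} \<times> UNIV \<in> sets (borel :: (real \<times> real) measure)"
      by (intro borel_open open_Times) auto
    show "continuous_on ({0<..} \<times> UNIV) (\<lambda>p :: real \<times> real. cinner (V (Complex (fst p) (- snd p)) x) y * deriv f (Complex (fst p) (snd p)))"
      by (intro continuous_intros continuous_on_compose2[OF V_cont] continuous_on_compose2[OF deriv_cont])
        (auto simp: Complex_eq intro!: continuous_intros)
  qed
  have inner_meas: "(\<lambda>\<eta>. cinner (V (Complex \<xi> (- \<eta>)) x) y * deriv f (Complex \<xi> \<eta>)) \<in> borel_measurable borel"
    if "0 < \<xi>" for \<xi> x y
  proof (rule borel_measurable_continuous_onI)
    show "continuous_on UNIV (\<lambda>\<eta>. cinner (V (Complex \<xi> (- \<eta>)) x) y * deriv f (Complex \<xi> \<eta>))"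
      by (intro continuous_intros continuous_on_compose2[OF V_cont] continuous_on_compose2[OF deriv_cont])
        (auto simp: Complex_eq that intro!: continuous_intros)
  qed
  have inner_nn: "(\<integral>\<^sup>+\<eta>. ennreal (norm (cinner (V (Complex \<xi> (- \<eta>)) x) y * deriv f (Complex \<xi> \<eta>))) \<partial>lborel)
      \<le> ennreal (E * (B0_weight q \<xi> / \<xi>) * norm x * norm y) * sup_deriv f \<xi>" if \<xi>: "0 < \<xi>" for \<xi> x y
  proof -
    have Vm: "(\<lambda>\<eta>. ennreal (cmod (cinner (V (Complex \<xi> (- \<eta>)) x) y))) \<in> borel_measurable lborel"
    proof -
      have "continuous_on UNIV (\<lambda>\<eta>. cinner (V (Complex \<xi> (- \<eta>)) x) y)"
        by (intro continuous_intros continuous_on_compose2[OF V_cont])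
          (auto simp: Complex_eq \<xi> intro!: continuous_intros)
      hence "(\<lambda>\<eta>. cinner (V (Complex \<xi> (- \<eta>)) x) y) \<in> borel_measurable borel"
        by (rule borel_measurable_continuous_onI)
      thus ?thesis by measurable
    qed
    have "(\<integral>\<^sup>+\<eta>. ennreal (norm (cinner (V (Complex \<xi> (- \<eta>)) x) y * deriv f (Complex \<xi> \<eta>))) \<partial>lborel)
        \<le> (\<integral>\<^sup>+\<eta>. ennreal (cmod (cinner (V (Complex \<xi> (- \<eta>)) x) y)) * sup_deriv f \<xi> \<partial>lborel)"
      unfolding norm_mult ennreal_mult'[OF norm_ge_zero] sup_deriv_def
      by (intro nn_integral_mono mult_left_mono SUP_upper) auto
    also have "\<dots> = (\<integral>\<^sup>+\<eta>. ennreal (cmod (cinner (V (Complex \<xi> (- \<eta>)) x) y)) \<partial>lborel) * sup_deriv f \<xi>"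
      by (rule nn_integral_multc[OF Vm])
    also have "\<dots> \<le> ennreal (E * (B0_weight q \<xi> / \<xi>) * norm x * norm y) * sup_deriv f \<xi>"
      by (intro mult_right_mono V_bound \<xi>) auto
    finally show ?thesis .
  qed
  have inner_int: "integrable lborel (\<lambda>\<eta>. cinner (V (Complex \<xi> (- \<eta>)) x) y * deriv f (Complex \<xi> \<eta>))"
    if \<xi>: "0 < \<xi>" and fin: "sup_deriv f \<xi> < \<infinity>" for \<xi> x y
  proof (rule integrableI_bounded)
    show "(\<lambda>\<eta>. cinner (V (Complex \<xi> (- \<eta>)) x) y * deriv f (Complex \<xi> \<eta>)) \<in> borel_measurable lborel"
      using inner_meas[OF \<xi>] by simp
    show "(\<integral>\<^sup>+\<eta>. ennreal (norm (cinner (V (Complex \<xi> (- \<eta>)) x) y * deriv f (Complex \<xi> \<eta>))) \<partial>lborel) < \<infinity>"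
      by (rule order_le_less_trans[OF inner_nn[OF \<xi>]]) (use fin in \<open>simp add: ennreal_mult_less_top\<close>)
  qed
  have J_meas: "J x y \<in> borel_measurable lborel" for x y
  proof -
    have "(\<lambda>\<xi>. LINT \<eta>|lborel. indicator ({0<..} \<times> UNIV) (\<xi>, \<eta>) *\<^sub>R
        (cinner (V (Complex \<xi> (- \<eta>)) x) y * deriv f (Complex \<xi> \<eta>))) \<in> borel_measurable borel"
      using joint[of x y] by (intro lborel.borel_measurable_lebesgue_integral) (simp add: case_prod_beta')
    hence "(\<lambda>\<xi>. complex_of_real \<xi> * (LINT \<eta>|lborel. indicator ({0<..} \<times> UNIV) (\<xi>, \<eta>) *\<^sub>R
        (cinner (V (Complex \<xi> (- \<eta>)) x) y * deriv f (Complex \<xi> \<eta>)))) \<in> borel_measurable borel"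
      by measurable
    moreover have "J x y = (\<lambda>\<xi>. complex_of_real \<xi> * (LINT \<eta>|lborel. indicator ({0<..} \<times> UNIV) (\<xi>, \<eta>) *\<^sub>R
        (cinner (V (Complex \<xi> (- \<eta>)) x) y * deriv f (Complex \<xi> \<eta>))))"
      unfolding J_def[abs_def] I_def by (auto simp: indicator_def)
    ultimately show ?thesis by simp
  qed
  have J_bound: "AE \<xi> in lborel. ennreal (norm (J x y \<xi>)) \<le> ennreal (E * norm x * norm y) * W \<xi>" for x y
    using AE_finite
  proof eventually_elim
    case (elim \<xi>)
    show ?case
    proof (cases "0 < \<xi>")
      case True
      note fin = elim[rule_format, OF True]
      have "ennreal (norm (I \<xi> x y)) \<le> ennreal (E * (B0_weight q \<xi> / \<xi>) * norm x * norm y) * sup_deriv f \<xi>"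
        unfolding I_def
        by (rule order_trans[OF integral_norm_bound_ennreal[OF inner_int[OF True fin]] inner_nn[OF True]])
      hence "ennreal \<xi> * ennreal (norm (I \<xi> x y))
          \<le> ennreal \<xi> * (ennreal (E * (B0_weight q \<xi> / \<xi>) * norm x * norm y) * sup_deriv f \<xi>)"
        by (rule mult_left_mono) simp
      also have "\<dots> = ennreal (\<xi> * (E * (B0_weight q \<xi> / \<xi>) * norm x * norm y)) * sup_deriv f \<xi>"
        by (simp only: ennreal_mult'[OF less_imp_le[OF True]] mult.assoc)
      also have "\<xi> * (E * (B0_weight q \<xi> / \<xi>) * norm x * norm y) = E * norm x * norm y * B0_weight q \<xi>"
        using True by simp
      also have "ennreal (E * norm x * norm y * B0_weight q \<xi>) * sup_deriv f \<xi> = ennreal (E * norm x * norm y) * W \<xi>"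
        using True \<open>0 \<le> E\<close> unfolding W_def by (simp add: ennreal_mult' mult.assoc)
      finally show ?thesis
        using True by (simp add: J_def norm_mult ennreal_mult')
    qed (simp add: J_def)
  qed
  have J_nn: "(\<integral>\<^sup>+\<xi>. ennreal (norm (J x y \<xi>)) \<partial>lborel) \<le> ennreal (E * norm x * norm y * N)" for x y
  proof -
    have "(\<integral>\<^sup>+\<xi>. ennreal (norm (J x y \<xi>)) \<partial>lborel) \<le> (\<integral>\<^sup>+\<xi>. ennreal (E * norm x * norm y) * W \<xi> \<partial>lborel)"
      by (rule nn_integral_mono_AE[OF J_bound])
    also have "\<dots> = ennreal (E * norm x * norm y) * ennreal N"
      by (subst nn_integral_cmult) (simp_all add: W_int)
    finally show ?thesis using \<open>0 \<le> E\<close> by (simp add: ennreal_mult')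
  qed
  have J_int: "integrable lborel (J x y)" for x y
    by (rule integrableI_bounded[OF J_meas]) (use order_le_less_trans[OF J_nn] in simp)
  have form: "vertical_form V f x y = - complex_of_real (2 / pi) * (LINT \<xi>|lborel. J x y \<xi>)" for x y
    unfolding vertical_form_def set_lebesgue_integral_def J_def I_def ..
  have "\<exists>S. bounded_clinear S \<and> (\<forall>x y. cinner (S x) y = vertical_form V f x y) \<and>
      (\<forall>x. norm (S x) \<le> (2 / pi * E * N) * norm x)"
  proof (rule sesquilinear_form_operator)
    fix x x' y y' :: 'h and c
    have "AE \<xi> in lborel. J (x + x') y \<xi> = J x y \<xi> + J x' y \<xi>"
      using AE_finite
    proof eventually_elim
      case (elim \<xi>)
      show ?case
      proof (cases "0 < \<xi>")
        case True
        have "I \<xi> (x + x') y = I \<xi> x y + I \<xi> x' y"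
          unfolding I_def using inner_int[OF True elim[rule_format, OF True]] True
          by (subst Bochner_Integration.integral_add[symmetric])
            (simp_all add: bounded_clinear_add[OF V_clin] cinner_add_left distrib_right)
        thus ?thesis unfolding J_def by (simp add: distrib_left scaleR_add_right)
      qed (simp add: J_def)
    qed
    hence "(LINT \<xi>|lborel. J (x + x') y \<xi>) = (LINT \<xi>|lborel. J x y \<xi> + J x' y \<xi>)"
      by (intro integral_cong_AE) (use J_meas in \<open>auto intro: borel_measurable_add\<close>)
    thus "vertical_form V f (x + x') y = vertical_form V f x y + vertical_form V f x' y"
      unfolding form by (simp add: J_int distrib_left)
    have "AE \<xi> in lborel. J x (y + y') \<xi> = J x y \<xi> + J x y' \<xi>"
      using AE_finite
    proof eventually_elim
      case (elim \<xi>)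
      show ?case
      proof (cases "0 < \<xi>")
        case True
        have "I \<xi> x (y + y') = I \<xi> x y + I \<xi> x y'"
          unfolding I_def using inner_int[OF True elim[rule_format, OF True]]
          by (subst Bochner_Integration.integral_add[symmetric])
            (simp_all add: cinner_add_right distrib_right)
        thus ?thesis unfolding J_def by (simp add: distrib_left scaleR_add_right)
      qed (simp add: J_def)
    qed
    hence "(LINT \<xi>|lborel. J x (y + y') \<xi>) = (LINT \<xi>|lborel. J x y \<xi> + J x y' \<xi>)"
      by (intro integral_cong_AE) (use J_meas in \<open>auto intro: borel_measurable_add\<close>)
    thus "vertical_form V f x (y + y') = vertical_form V f x y + vertical_form V f x y'"
      unfolding form by (simp add: J_int distrib_left)
    have J_left: "J (c *\<^sub>C x) y \<xi> = c * J x y \<xi>" for \<xi>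
    proof (cases "0 < \<xi>")
      case True
      hence "I \<xi> (c *\<^sub>C x) y = c * I \<xi> x y"
        unfolding I_def by (simp add: bounded_clinear_scaleC[OF V_clin] cinner_scaleC_left mult.assoc)
      thus ?thesis unfolding J_def by simp
    qed (simp add: J_def)
    show "vertical_form V f (c *\<^sub>C x) y = c * vertical_form V f x y"
      unfolding form J_left by simp
    have J_right: "J x (c *\<^sub>C y) \<xi> = cnj c * J x y \<xi>" for \<xi>
      unfolding J_def I_def by (simp add: cinner_scaleC_right mult.assoc)
    show "vertical_form V f x (c *\<^sub>C y) = cnj c * vertical_form V f x y"
      unfolding form J_right by simp
    have "ennreal (norm (LINT \<xi>|lborel. J x y \<xi>)) \<le> ennreal (E * norm x * norm y * N)"
      by (rule order_trans[OF integral_norm_bound_ennreal[OF J_int] J_nn])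
    hence "norm (LINT \<xi>|lborel. J x y \<xi>) \<le> E * norm x * norm y * N"
      using \<open>0 \<le> E\<close> by (simp add: N_def)
    hence "2 / pi * norm (LINT \<xi>|lborel. J x y \<xi>) \<le> 2 / pi * (E * norm x * norm y * N)"
      by (intro mult_left_mono) auto
    thus "cmod (vertical_form V f x y) \<le> 2 / pi * E * N * norm x * norm y"
      unfolding form norm_mult by (simp add: norm_divide mult_ac)
  next
    show "0 \<le> 2 / pi * E * N" using \<open>0 \<le> E\<close> by (simp add: N_def)
  qed
  thus ?thesis unfolding N_def .
qed

lemma B_calc_eqI:
  assumes "bounded_clinear S" "at_inf f = 0"
    and "\<And>x y. cinner (S x) y = vertical_form (\<lambda>z. shift_inv A z ^^ 2) f x y"
  shows "B_calc A f = S"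
  unfolding B_calc_def
proof (rule the_equality)
  show "bounded_clinear S \<and> (\<forall>x y. cinner (S x) y = at_inf f * cinner x y -
      complex_of_real (2 / pi) * (LINT \<xi>:{0<..}|lborel. complex_of_real \<xi> *
        (LINT \<eta>|lborel. cinner ((shift_inv A (Complex \<xi> (- \<eta>)) ^^ 2) x) y * deriv f (Complex \<xi> \<eta>))))"
    using assms by (simp add: vertical_form_def)
  show "B = S" if "bounded_clinear B \<and> (\<forall>x y. cinner (B x) y = at_inf f * cinner x y -
      complex_of_real (2 / pi) * (LINT \<xi>:{0<..}|lborel. complex_of_real \<xi> *
        (LINT \<eta>|lborel. cinner ((shift_inv A (Complex \<xi> (- \<eta>)) ^^ 2) x) y * deriv f (Complex \<xi> \<eta>))))" for B
  proof
    fix x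
    show "B x = S x"
      by (rule cinner_ext) (use that assms(2,3) in \<open>simp add: vertical_form_def\<close>)
  qed
qed

lemma op_norm_op_graph_le:
  assumes "\<And>x. norm (S x) \<le> M * norm x" "0 \<le> M"
  shows "op_norm (op_graph S) \<le> ennreal M"
  unfolding op_norm_def op_graph_def
proof (rule SUP_least, clarify)
  fix x :: 'a assume "norm x \<le> 1"
  hence "norm (S x) \<le> M * 1" by (intro order_trans[OF assms(1)] mult_left_mono assms(2))
  thus "ennreal (norm (S x)) \<le> ennreal M" by (intro ennreal_leI) simp
qed

section \<open>Smoothing by the functional calculus\<close>

context crandall_pazy_semigroup
begin

text \<open>
  The operator \<open>S\<close> is the one of the form with \<open>V z = (z + A)\<inverse> A\<^sup>\<alpha> (z + A)\<inverse>\<close>. Compared with the form of \<open>f(A)\<close>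
  it satisfies \<open>(1 + A)\<inverse> S = A\<^sup>\<alpha> (1 + A)\<inverse> f(A)\<close>.
\<close>

lemma frac_power_B_calc:
  assumes \<alpha>: "0 < \<alpha>" "\<alpha> < 1" and q: "\<alpha> / \<beta> \<le> q" "q < 1 / 2"
  obtains C where "0 \<le> C"
    and "\<And>f. f \<in> B0_space \<Longrightarrow> B0_norm q f < \<infinity> \<Longrightarrow>
      \<exists>S. bounded_clinear S \<and> op_graph (B_calc A f) O frac_power A \<alpha> = op_graph S \<and>
        (\<forall>x. norm (S x) \<le> C * enn2real (B0_norm q f) * norm x)"
proof -
  have p0: "0 \<le> \<alpha> / \<beta>" and q0: "0 \<le> q" using \<alpha> \<beta>_pos q by (auto intro: order_trans[OF _ q(1)])
  obtain D where D: "0 \<le> D" "\<And>t x. 0 < t \<Longrightarrow> norm (A_pow_T \<alpha> t x) \<le> D * (t powr (- (\<alpha> / \<beta>)) + 1) * norm x"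
    using A_pow_T_norm[OF \<alpha>] by blast
  have T_le: "norm (T t x) \<le> K * (t powr (- 0) + 1) * norm x" if "0 < t" for t x
  proof -
    have "0 \<le> K * norm x" using K_ge_1 by simp
    moreover have "K * (t powr (- 0) + 1) * norm x = K * norm x + K * norm x"
      using that by simp
    ultimately show ?thesis using T_norm[of t x] that by simp
  qed
  have K0: "0 \<le> K" using K_ge_1 by simp
  have "\<exists>E\<ge>0. \<forall>\<xi> x y. 0 < \<xi> \<longrightarrow>
      (\<integral>\<^sup>+\<eta>. ennreal (cmod (cinner (R (Complex \<xi> (- \<eta>)) (R (Complex \<xi> (- \<eta>)) x)) y)) \<partial>lborel)
        \<le> ennreal (E * (B0_weight q \<xi> / \<xi>) * norm x * norm y)"
    by (rule R_comp_vertical_bound[OF order_refl q0 q(2) T_continuous T_le K0 R_def])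
  then obtain E1 where E1: "0 \<le> E1" "\<forall>\<xi> x y. 0 < \<xi> \<longrightarrow>
      (\<integral>\<^sup>+\<eta>. ennreal (cmod (cinner (R (Complex \<xi> (- \<eta>)) (R (Complex \<xi> (- \<eta>)) x)) y)) \<partial>lborel)
        \<le> ennreal (E1 * (B0_weight q \<xi> / \<xi>) * norm x * norm y)"
    by (elim exE conjE)
  have "\<exists>E\<ge>0. \<forall>\<xi> x y. 0 < \<xi> \<longrightarrow>
      (\<integral>\<^sup>+\<eta>. ennreal (cmod (cinner (R (Complex \<xi> (- \<eta>)) (A_pow_R \<alpha> (Complex \<xi> (- \<eta>)) x)) y)) \<partial>lborel)
        \<le> ennreal (E * (B0_weight q \<xi> / \<xi>) * norm x * norm y)"
    by (rule R_comp_vertical_bound[OF p0 q A_pow_T_continuous[OF \<alpha>] D(2) D(1) A_pow_R_eq_wint[OF \<alpha>]])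
  then obtain E2 where E2: "0 \<le> E2" "\<forall>\<xi> x y. 0 < \<xi> \<longrightarrow>
      (\<integral>\<^sup>+\<eta>. ennreal (cmod (cinner (R (Complex \<xi> (- \<eta>)) (A_pow_R \<alpha> (Complex \<xi> (- \<eta>)) x)) y)) \<partial>lborel)
        \<le> ennreal (E2 * (B0_weight q \<xi> / \<xi>) * norm x * norm y)"
    by (elim exE conjE)
  have comp: "bounded_clinear (\<lambda>x. R z (F x))" if "0 < Re z" "bounded_clinear F" for z F
    using bounded_linear_compose[OF bounded_clinear_imp_bounded_linear bounded_clinear_imp_bounded_linear, OF R_clin that(2)]
      that R_clin[OF that(1)] by (auto simp: bounded_clinear_def)
  have R1: "bounded_clinear (R 1)" by (intro R_clin) simp
  note breg = balakrishnan_reg_clin[OF \<alpha>]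
  show ?thesis
  proof (rule that)
    show "0 \<le> 2 / pi * E2" using E2(1) by simp
    fix f assume f: "f \<in> B0_space" "B0_norm q f < \<infinity>"
    hence hol: "f holomorphic_on {z. 0 < Re z}" and inf0: "at_inf f = 0"
      by (auto simp: B0_space_def B_space_def)
    obtain S0 where S0: "bounded_clinear S0" "\<And>x y. cinner (S0 x) y = vertical_form (\<lambda>z x. R z (R z x)) f x y"
      using vertical_form_operator[of "\<lambda>z x. R z (R z x)", OF comp[OF _ R_clin] R_comp_continuous[OF R_continuous] E1(1) E1(2)[rule_format] hol f(2)]
      by blast
    obtain S where S: "bounded_clinear S" "\<And>x y. cinner (S x) y = vertical_form (\<lambda>z x. R z (A_pow_R \<alpha> z x)) f x y"
      "\<And>x. norm (S x) \<le> 2 / pi * E2 * enn2real (B0_norm q f) * norm x"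
      using vertical_form_operator[of "\<lambda>z x. R z (A_pow_R \<alpha> z x)", OF comp[OF _ A_pow_R_clin[OF \<alpha>]]
          R_comp_continuous[OF A_pow_R_continuous[OF \<alpha>]] E2(1) E2(2)[rule_format] hol f(2)]
      by blast
    have B: "B_calc A f = S0"
    proof (rule B_calc_eqI[OF S0(1) inf0])
      show "cinner (S0 x) y = vertical_form (\<lambda>z. shift_inv A z ^^ 2) f x y" for x y
        unfolding S0(2) by (rule vertical_form_cong) (simp add: shift_inv_eq_R numeral_2_eq_2)
    qed
    have eq: "R 1 (S x) = balakrishnan_reg \<alpha> (S0 x)" for x
    proof (rule cinner_ext)
      fix y
      have "cinner (R 1 (S x)) y = vertical_form (\<lambda>z x. R z (A_pow_R \<alpha> z x)) f x (adj (R 1) y)"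
        unfolding cinner_adj[OF R1, symmetric] S(2) ..
      also have "\<dots> = vertical_form (\<lambda>z x. R z (R z x)) f x (adj (balakrishnan_reg \<alpha>) y)"
      proof (rule vertical_form_cong)
        fix z assume z: "0 < Re z"
        have "R 1 (R z (A_pow_R \<alpha> z x)) = balakrishnan_reg \<alpha> (R z (R z x))"
          using z by (simp add: R_R[of z 1] R_A_pow_R[OF \<alpha>] balakrishnan_reg_R[OF \<alpha>])
        thus "cinner (R z (A_pow_R \<alpha> z x)) (adj (R 1) y) = cinner (R z (R z x)) (adj (balakrishnan_reg \<alpha>) y)"
          by (simp add: cinner_adj[OF R1] cinner_adj[OF breg])
      qed
      also have "\<dots> = cinner (balakrishnan_reg \<alpha> (S0 x)) y"
        unfolding cinner_adj[OF breg, symmetric] S0(2) ..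
      finally show "cinner (R 1 (S x)) y = cinner (balakrishnan_reg \<alpha> (S0 x)) y" .
    qed
    have "(x, w) \<in> op_graph (B_calc A f) O frac_power A \<alpha> \<longleftrightarrow> w = S x" for x w
      unfolding B op_graph_def using R_1_injective
      by (auto simp: relcomp_unfold frac_power_iff[OF \<alpha>] eq[symmetric])
    moreover have "(x, w) \<in> op_graph S \<longleftrightarrow> w = S x" for x w
      by (auto simp: op_graph_def)
    ultimately have "op_graph (B_calc A f) O frac_power A \<alpha> = op_graph S"
      by (intro set_eqI) (simp only: split_paired_all)
    thus "\<exists>S. bounded_clinear S \<and> op_graph (B_calc A f) O frac_power A \<alpha> = op_graph S \<and>
        (\<forall>x. norm (S x) \<le> 2 / pi * E2 * enn2real (B0_norm q f) * norm x)"
      using S(1,3) by blast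
  qed
qed

end

lemma crandall_pazy_semigroupI:
  fixes T :: "real \<Rightarrow> 'h::complex_hilbert_space \<Rightarrow> 'h"
  assumes "c0_semigroup T" "bounded_semigroup T" "op_uminus A = generator T" "0 < \<beta>" "crandall_pazy \<beta> T"
  obtains K L where "crandall_pazy_semigroup T A K \<beta> L"
proof -
  obtain M where M: "\<And>t. 0 \<le> t \<Longrightarrow> onorm (T t) \<le> M"
    using assms(2) unfolding bounded_semigroup_def bdd_above_def by auto
  define K where "K = max 1 M"
  interpret S: bdd_diff_semigroup T A K
  proof
    show "norm (T t x) \<le> K * norm x" if "0 \<le> t" for t x
    proof -
      have "bounded_clinear (T t)" using assms(1) that by (auto simp: c0_semigroup_def)
      hence "norm (T t x) \<le> onorm (T t) * norm x" by (rule bounded_clinear_norm)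
      also have "\<dots> \<le> K * norm x" using M[OF that] by (intro mult_right_mono) (auto simp: K_def)
      finally show ?thesis .
    qed
  qed (use assms in \<open>auto simp: K_def crandall_pazy_def\<close>)
  have A: "op_uminus (generator T) = A"
    unfolding assms(3)[symmetric] op_uminus_def by force
  obtain C where "\<forall>\<^sub>F t in at_right 0. op_norm (op_graph (T t) O A) \<le> ennreal (C * t powr (- (1 / \<beta>)))"
    using assms(5) unfolding crandall_pazy_def A by blast
  then obtain b where b: "0 < b"
    "\<And>t. 0 < t \<Longrightarrow> t < b \<Longrightarrow> op_norm (op_graph (T t) O A) \<le> ennreal (C * t powr (- (1 / \<beta>)))"
    unfolding eventually_at_right_field by auto
  define D where "D = max C 0"
  have small: "norm v \<le> D * t powr (- (1 / \<beta>)) * norm x" if t: "0 < t" "t < b" and v: "(T t x, v) \<in> A" for t x v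
  proof -
    have T_clin: "bounded_clinear (T t)" using S.T_clin t by simp
    define r where "r = 1 / norm x"
    have scale: "bounded_clinear (\<lambda>x::'h. complex_of_real r *\<^sub>C x)" by (rule bounded_clinear_scaleC_op)
    have "(complex_of_real r *\<^sub>C T t x, complex_of_real r *\<^sub>C v) \<in> A"
      by (rule S.A_bounded_clinear_commute[OF scale _ v]) (simp add: bounded_clinear_scaleC[OF S.T_clin])
    hence rv: "(T t (r *\<^sub>R x), r *\<^sub>R v) \<in> A"
      unfolding scaleC_of_real bounded_clinear_scaleR[OF T_clin] .
    have "norm (r *\<^sub>R x) \<le> 1" unfolding r_def by simp
    hence "ennreal (norm (r *\<^sub>R v)) \<le> op_norm (op_graph (T t) O A)"
      unfolding op_norm_def op_graph_def using rv by (intro SUP_upper2[of "(r *\<^sub>R x, r *\<^sub>R v)"]) auto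
    also have "\<dots> \<le> ennreal (C * t powr (- (1 / \<beta>)))" by (rule b(2)[OF t])
    also have "\<dots> \<le> ennreal (D * t powr (- (1 / \<beta>)))"
      by (intro ennreal_leI mult_right_mono) (auto simp: D_def)
    finally have le: "norm (r *\<^sub>R v) \<le> D * t powr (- (1 / \<beta>))"
      by (simp add: D_def)
    show ?thesis
    proof (cases "x = 0")
      case True
      have "(T t 0, 0) \<in> A" unfolding bounded_clinear_zero[OF T_clin] S.A_iff
        by (rule tendsto_eventually) (use eventually_at_right_less[of 0] in \<open>eventually_elim, simp add: bounded_clinear_zero[OF S.T_clin]\<close>)
      hence "v = 0" using S.A_unique v True by blast
      thus ?thesis using True by simp
    next
      case False
      thus ?thesis using le by (simp add: r_def divide_le_eq)
    qed
  qed
  define s where "s = b / 2"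
  define L where "L = D + K * D * s powr (- (1 / \<beta>))"
  have L0: "0 \<le> L" unfolding L_def D_def K_def by simp
  have "norm v \<le> L * (t powr (- (1 / \<beta>)) + 1) * norm x" if t: "0 < t" and v: "(T t x, v) \<in> A" for t x v
  proof (cases "t < b")
    case True
    have "D * t powr (- (1 / \<beta>)) \<le> L * (t powr (- (1 / \<beta>)) + 1)"
      unfolding L_def D_def K_def by (intro mult_mono) auto
    thus ?thesis using small[OF t True v] by (meson mult_right_mono norm_ge_zero order_trans)
  next
    case False
    have s: "0 < s" "s < b" "s \<le> t" using b(1) False unfolding s_def by auto
    obtain u where u: "(T s x, u) \<in> A" using S.T_in_domain[OF s(1)] by blast
    have "(T (t - s) (T s x), T (t - s) u) \<in> A" using S.A_T[OF u] s by simp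
    moreover have "T (t - s) (T s x) = T t x" using S.T_add[of "t - s" s x] s by simp
    ultimately have "v = T (t - s) u" using S.A_unique v by simp
    hence "norm v \<le> K * norm u" using S.T_norm[of "t - s" u] s by simp
    also have "\<dots> \<le> K * (D * s powr (- (1 / \<beta>)) * norm x)"
      using small[OF s(1,2) u] by (intro mult_left_mono) (auto simp: K_def)
    also have "\<dots> = (K * D * s powr (- (1 / \<beta>))) * 1 * norm x" by simp
    also have "\<dots> \<le> L * (t powr (- (1 / \<beta>)) + 1) * norm x"
      unfolding L_def D_def K_def by (intro mult_right_mono mult_mono) auto
    finally show ?thesis .
  qed
  hence "crandall_pazy_semigroup T A K \<beta> L"
    using assms(4) L0 by unfold_locales auto
  thus ?thesis by (rule that)
qed

theorem proposition3p1:
  fixes T :: "real \<Rightarrow> 'h::complex_hilbert_space \<Rightarrow> 'h"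
    and A :: "('h \<times> 'h) set"
    and \<beta> q :: real
  assumes "c0_semigroup T"
    and "bounded_semigroup T"
    and "op_uminus A = generator T"
    and "0 < \<beta>" and "\<beta> \<le> 1"
    and "crandall_pazy \<beta> T"
    and "0 < q" and "q < 1/2"
  shows "(\<forall>f \<in> B0_space. B0_norm q f < \<infinity> \<longrightarrow>
            in_LH (op_graph (B_calc A f) O frac_power A (\<beta> * q))) \<and>
         (\<exists>M>0. \<forall>f \<in> B0_space. B0_norm q f < \<infinity> \<longrightarrow>
            op_norm (op_graph (B_calc A f) O frac_power A (\<beta> * q)) \<le> ennreal M * B0_norm q f)"
proof -
  obtain K L where "crandall_pazy_semigroup T A K \<beta> L"
    using crandall_pazy_semigroupI[OF assms(1-4,6)] by blast
  then interpret crandall_pazy_semigroup T A K \<beta> L .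
  have "\<beta> * q \<le> 1 * q" using assms by (intro mult_right_mono) auto
  hence \<alpha>: "0 < \<beta> * q" "\<beta> * q < 1" using assms by (simp, linarith)
  have q: "\<beta> * q / \<beta> \<le> q" using assms by simp
  obtain C where C: "0 \<le> C"
    and S: "\<And>f. f \<in> B0_space \<Longrightarrow> B0_norm q f < \<infinity> \<Longrightarrow>
      \<exists>S. bounded_clinear S \<and> op_graph (B_calc A f) O frac_power A (\<beta> * q) = op_graph S \<and>
        (\<forall>x. norm (S x) \<le> C * enn2real (B0_norm q f) * norm x)"
    using frac_power_B_calc[OF \<alpha> q assms(8)] by blast
  have "in_LH (op_graph (B_calc A f) O frac_power A (\<beta> * q))"
    if "f \<in> B0_space" "B0_norm q f < \<infinity>" for f
    using S[OF that] unfolding in_LH_def by blast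
  moreover have "op_norm (op_graph (B_calc A f) O frac_power A (\<beta> * q)) \<le> ennreal (C + 1) * B0_norm q f"
    if f: "f \<in> B0_space" "B0_norm q f < \<infinity>" for f
  proof -
    obtain S where S': "op_graph (B_calc A f) O frac_power A (\<beta> * q) = op_graph S"
      "\<And>x. norm (S x) \<le> C * enn2real (B0_norm q f) * norm x"
      using S[OF f] by blast
    have "op_norm (op_graph S) \<le> ennreal (C * enn2real (B0_norm q f))"
      using C by (intro op_norm_op_graph_le S'(2)) simp
    also have "\<dots> \<le> ennreal ((C + 1) * enn2real (B0_norm q f))"
      by (intro ennreal_leI mult_right_mono) auto
    also have "\<dots> = ennreal (C + 1) * B0_norm q f"
      using C f(2) by (simp add: ennreal_mult)
    finally show ?thesis unfolding S'(1) .
  qed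
  moreover have "0 < C + 1" using C by simp
  ultimately show ?thesis by blast
qed

end
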